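(* Let $\Omega$ be the 30-60-90 triangle (open, in $\mathbb{R}^2$) with vertices at $(0,0)$, $(\frac{\sqrt 3}{2}, 0)$, and $(\frac{\sqrt 3}{2}, \frac12)$, and let $N$ be its local Weyl counting function with Dirichlet boundary conditions. Then \[ N(p,\lambda) = N(q,\lambda) \qquad \text{for all } \lambda, \] where \[ p = \left(\tfrac{7\sqrt3}{16}, \tfrac{3}{16}\right) \qquad \text{and} \qquad q = \left(\tfrac{5\sqrt3}{16}, \tfrac{3}{16}\right). \]
   Context: For a bounded open set $\Omega \subset \mathbb{R}^2$ with piecewise-smooth boundary, let $\{e_j : j \in \mathbb{N}\}$ be an orthonormal basis of $L^2(\Omega)$ consisting of Dirichlet Laplace eigenfunctions: $\Delta e_j = -\lambda_j^2 e_j$ in $\Omega$, $e_j = 0$ on $\partial\Omega$, with $0 < \lambda_1 \le \lambda_2 \le \cdots \to \infty$. The local Weyl counting function is \[ N(x,\lambda) = \sum_{\lambda_j \le \lambda} |e_j(x)|^2, \qquad x \in \Omega, \] which does not depend on the choice of eigenbasis. *)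

theory Defs
  imports "HOL-Analysis.Analysis"
begin

definition partial_deriv ::
    "'a::euclidean_space \<Rightarrow> ('a \<Rightarrow> complex) \<Rightarrow> 'a \<Rightarrow> complex" where
  "partial_deriv b u x = frechet_derivative u (at x) b"

text \<open>Twice continuous differentiability, meant for open \<open>S\<close>. The differentiability
  conjuncts ensure that the (total) function \<^const>\<open>frechet_derivative\<close> is meaningful.\<close>

definition C2_on :: "'a::euclidean_space set \<Rightarrow> ('a \<Rightarrow> complex) \<Rightarrow> bool" where
  "C2_on S u \<longleftrightarrow>
     u differentiable_on S \<and>
     (\<forall>b\<in>Basis. partial_deriv b u differentiable_on S \<and>
        (\<forall>c\<in>Basis. continuous_on S (partial_deriv c (partial_deriv b u))))"

definition laplacian :: "('a::euclidean_space \<Rightarrow> complex) \<Rightarrow> 'a \<Rightarrow> complex" where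
  "laplacian u x = (\<Sum>b\<in>Basis. partial_deriv b (partial_deriv b u) x)"

text \<open>Square-integrable functions on \<open>\<Omega>\<close> are represented by functions on the whole space
  whose values outside \<open>\<Omega>\<close> are irrelevant. They are complex-valued; a real orthonormal
  basis of the real \<open>L\<^sup>2(\<Omega>)\<close> is in particular one of the complex \<open>L\<^sup>2(\<Omega>)\<close>.\<close>

definition square_integrable_on :: "('a::euclidean_space \<Rightarrow> complex) \<Rightarrow> 'a set \<Rightarrow> bool" where
  "square_integrable_on f \<Omega> \<longleftrightarrow>
     f \<in> borel_measurable (lebesgue_on \<Omega>) \<and>
     integrable (lebesgue_on \<Omega>) (\<lambda>x. (cmod (f x))\<^sup>2)"

definition L2_inner ::
    "'a::euclidean_space set \<Rightarrow> ('a \<Rightarrow> complex) \<Rightarrow> ('a \<Rightarrow> complex) \<Rightarrow> complex" where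
  "L2_inner \<Omega> f g = integral\<^sup>L (lebesgue_on \<Omega>) (\<lambda>x. f x * cnj (g x))"

definition L2_orthonormal_basis ::
    "'a::euclidean_space set \<Rightarrow> (nat \<Rightarrow> 'a \<Rightarrow> complex) \<Rightarrow> bool" where
  "L2_orthonormal_basis \<Omega> e \<longleftrightarrow>
     (\<forall>j. square_integrable_on (e j) \<Omega>) \<and>
     (\<forall>i j. L2_inner \<Omega> (e i) (e j) = (if i = j then 1 else 0)) \<and>
     (\<forall>f. square_integrable_on f \<Omega> \<longrightarrow>
        (\<lambda>n. integral\<^sup>L (lebesgue_on \<Omega>)
                (\<lambda>x. (cmod (f x - (\<Sum>j<n. L2_inner \<Omega> f (e j) * e j x)))\<^sup>2))
          \<longlonglongrightarrow> 0)"

text \<open>The eigenfunctions are classical solutions: \<open>C\<^sup>2\<close> in \<open>\<Omega>\<close> and continuous up to the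
  boundary, where they vanish. In particular their pointwise values in \<open>\<Omega>\<close> are well defined.
  The eigenvalue belonging to \<open>e j\<close> is \<open>(lam j)\<^sup>2\<close>.\<close>

definition dirichlet_eigenbasis ::
    "'a::euclidean_space set \<Rightarrow> (nat \<Rightarrow> 'a \<Rightarrow> complex) \<Rightarrow> (nat \<Rightarrow> real) \<Rightarrow> bool" where
  "dirichlet_eigenbasis \<Omega> e lam \<longleftrightarrow>
     L2_orthonormal_basis \<Omega> e \<and>
     (\<forall>j. C2_on \<Omega> (e j) \<and>
          (\<forall>x\<in>\<Omega>. laplacian (e j) x = - of_real ((lam j)\<^sup>2) * e j x) \<and>
          continuous_on (closure \<Omega>) (e j) \<and>
          (\<forall>x\<in>frontier \<Omega>. e j x = 0)) \<and>
     0 < lam 0 \<and> mono lam \<and> filterlim lam at_top sequentially"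

text \<open>The index set is finite whenever \<open>lam\<close> tends to infinity.\<close>

definition local_weyl_count ::
    "(nat \<Rightarrow> 'a \<Rightarrow> complex) \<Rightarrow> (nat \<Rightarrow> real) \<Rightarrow> 'a \<Rightarrow> real \<Rightarrow> real" where
  "local_weyl_count e lam x L = (\<Sum>j | lam j \<le> L. (cmod (e j x))\<^sup>2)"

definition triangle_30_60_90 :: "(real ^ 2) set" where
  "triangle_30_60_90 =
     interior (convex hull {vector [0, 0], vector [sqrt 3 / 2, 0], vector [sqrt 3 / 2, 1 / 2]})"

end

theory Submission
  imports Defs
begin

text \<open>
  The triangle is a fundamental domain of a reflection group whose linear part is the dihedral
  group of order 12. Every mode \<open>\<phi>\<^sub>k\<close>, the alternating sum of a lattice exponential over that
  dihedral group, satisfies \<open>\<phi>\<^sub>k p = \<phi>\<^sub>k q\<close> or \<open>\<phi>\<^sub>k p = - \<phi>\<^sub>k q\<close>: in torus coordinates \<open>p\<close> and \<open>q\<close>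
  are multiples of one eighth of the period, so this only depends on \<open>k\<close> modulo 8. Changing
  the sign of the modes of the second kind is therefore an isometry \<open>U\<close> of each eigenspace with
  \<open>(U f) q = f p\<close>, and the sum of \<open>|e\<^sub>j p|\<^sup>2\<close> over an eigenspace, being the squared norm of the
  evaluation functional at \<open>p\<close>, agrees with the one at \<open>q\<close>.

  That the modes span each eigenspace of an arbitrary eigenbasis rests on two facts. The modes
  are uniformly dense in the continuous functions vanishing on the boundary (Stone--Weierstrass
  for the symmetric cosine polynomials, multiplied by the Weyl denominator). Modes and
  eigenfunctions of different eigenvalue are orthogonal; as \<open>e\<^sub>j\<close> is only continuous up to the
  boundary, Green's identity is applied to modes cut off near one side at a time.
\<close>


section \<open>Directional derivatives and Green's identity\<close>

text \<open>Inversion lies in the dihedral group and has determinant 1, so the exponentials of a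
  mode pair up into cosines and only the six permutations of three angles remain. The sign change U
  is an isometry only if modes of opposite kinds are orthogonal. Two such modes may share an
  eigenvalue, and then Green's identity between them says nothing. Instead, their product is a
  symmetric cosine polynomial without constant term, and its integral vanishes because each
  symmetrized term satisfies a Neumann condition on the sides. Spanning is used only in an
  approximate form: for one eigenspace the kernel g, the sum of cnj (e_j p) e_j, is approximated
  uniformly by modes, and discarding the modes of other eigenvalues does not affect the coefficients
  in that eigenspace. With K(x) the sum of |e_j x|^2, the bound |f p|^2 <= ||f||^2 K(q) for
  combinations f of modes passes to the limit as K(p)^2 <= K(p) K(q). Exchanging p and q gives
  equality.\<close>

definition has_ddir :: "('a::real_normed_vector \<Rightarrow> 'b::real_normed_vector) \<Rightarrow> 'a \<Rightarrow> 'a \<Rightarrow> 'b \<Rightarrow> bool" where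
  "has_ddir f b x d \<longleftrightarrow> ((\<lambda>t. f (x + t *\<^sub>R b)) has_vector_derivative d) (at 0)"

lemma has_ddir_shift:
  assumes "has_ddir f b (x + t *\<^sub>R b) d"
  shows "((\<lambda>t. f (x + t *\<^sub>R b)) has_vector_derivative d) (at t)"
proof -
  have 1: "((\<lambda>s. s - t) has_vector_derivative 1) (at t)"
    by (auto intro!: derivative_eq_intros simp: has_real_derivative_iff_has_vector_derivative[symmetric])
  have "((\<lambda>s. f ((x + t *\<^sub>R b) + s *\<^sub>R b)) \<circ> (\<lambda>s. s - t) has_vector_derivative 1 *\<^sub>R d) (at t)"
    using vector_diff_chain_at[OF 1, of "\<lambda>s. f ((x + t *\<^sub>R b) + s *\<^sub>R b)" d] assms
    by (simp add: has_ddir_def)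
  then show ?thesis by (simp add: o_def scaleR_diff_left)
qed

lemma has_ddir_local:
  assumes "has_ddir f b x d" "open S" "x \<in> S" "\<And>y. y \<in> S \<Longrightarrow> f y = g y"
  shows "has_ddir g b x d"
proof -
  have "((\<lambda>t. x + t *\<^sub>R b) \<longlongrightarrow> x + 0 *\<^sub>R b) (at 0)"
    by (intro tendsto_intros)
  then have "\<forall>\<^sub>F t in at 0. x + t *\<^sub>R b \<in> S"
    using assms(2,3) by (simp add: tendsto_def)
  then have "\<forall>\<^sub>F t in nhds 0. f (x + t *\<^sub>R b) = g (x + t *\<^sub>R b)"
    unfolding eventually_at_filter
  proof (rule eventually_mono)
    fix t :: real assume "t \<noteq> 0 \<longrightarrow> t \<in> UNIV \<longrightarrow> x + t *\<^sub>R b \<in> S"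
    then have "x + t *\<^sub>R b \<in> S" using assms(3) by (cases "t = 0") auto
    then show "f (x + t *\<^sub>R b) = g (x + t *\<^sub>R b)" by (rule assms(4))
  qed
  then show ?thesis
    using assms(1) has_vector_derivative_cong_ev[where S=UNIV and x=0 and f="\<lambda>t. f (x + t *\<^sub>R b)" and g="\<lambda>t. g (x + t *\<^sub>R b)"]
    by (simp add: has_ddir_def assms(3,4))
qed

lemma has_ddir_zero:
  assumes "open S" "x \<in> S" "\<And>y. y \<in> S \<Longrightarrow> f y = 0" shows "has_ddir f b x 0"
  by (rule has_ddir_local[of "\<lambda>_. 0" b x 0 S]) (auto simp: has_ddir_def assms)

lemma has_ddir_unique: "has_ddir f b x d \<Longrightarrow> has_ddir f b x d' \<Longrightarrow> d = d'"
  unfolding has_ddir_def by (rule vector_derivative_unique_at)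

lemma has_ddir_difference_bound:
  fixes f :: "'a::real_normed_vector \<Rightarrow> 'b::real_normed_vector"
  assumes "\<And>x. has_ddir f b x (f' x)" "\<And>x. norm (f' x) \<le> B"
  shows "norm (f (x + h *\<^sub>R b) - f x) \<le> B * \<bar>h\<bar>"
proof -
  have B: "0 \<le> B" using assms(2)[of x] norm_ge_zero order_trans by blast
  have "norm (f (x + h *\<^sub>R b) - f (x + 0 *\<^sub>R b)) \<le> B * norm (h - 0)"
  proof (rule differentiable_bound[where S=UNIV and f' = "\<lambda>t u. u *\<^sub>R f' (x + t *\<^sub>R b)"])
    show "((\<lambda>t. f (x + t *\<^sub>R b)) has_derivative (\<lambda>u. u *\<^sub>R f' (x + t *\<^sub>R b))) (at t within UNIV)" for t
      using has_ddir_shift[OF assms(1)] by (simp add: has_vector_derivative_def)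
    show "onorm (\<lambda>u. u *\<^sub>R f' (x + t *\<^sub>R b)) \<le> B" for t
      by (rule onorm_bound[OF B]) (metis assms(2) abs_ge_zero mult.commute mult_left_mono norm_scaleR real_norm_def)
  qed auto
  then show ?thesis by simp
qed

text \<open>Translation invariance makes the integral of every difference quotient vanish.\<close>

lemma integral_ddir_eq_0:
  fixes g :: "'a::euclidean_space \<Rightarrow> 'b::{banach,second_countable_topology}"
  assumes der: "\<And>x. has_ddir g b x (g' x)"
    and cont: "continuous_on UNIV g" "continuous_on UNIV g'"
    and K: "compact K" "\<And>x. x \<notin> K \<Longrightarrow> g x = 0"
  shows "integral\<^sup>L lborel g' = 0"
proof -
  have g'0: "g' x = 0" if "x \<notin> K" for x
    by (rule has_ddir_unique[OF der], rule has_ddir_zero[of "- K"])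
       (use K that in \<open>auto simp: compact_imp_closed open_Compl\<close>)
  have "bounded (g' ` K)"
    using K cont(2) by (meson compact_continuous_image compact_imp_bounded continuous_on_subset subset_UNIV)
  then obtain B0 where "\<forall>x\<in>K. norm (g' x) \<le> B0" by (auto simp: bounded_iff)
  then have B: "norm (g' x) \<le> max B0 0" for x using g'0 by (cases "x \<in> K") auto
  define B where "B = max B0 0"
  \<comment> \<open>Every difference quotient below has step at most 1, so this compact sweep of
    \<open>K\<close> along - b contains the supports of all \<open>D n\<close> and carries the
    dominating function.\<close>
  define K' where "K' = (\<lambda>(x,t). x - t *\<^sub>R b) ` (K \<times> {0..1::real})"
  have cK': "compact K'" unfolding K'_def
    by (intro compact_continuous_image compact_Times K continuous_intros) (auto simp: case_prod_unfold intro!: continuous_intros)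
  have KK': "x + h *\<^sub>R b \<in> K \<Longrightarrow> 0 \<le> h \<Longrightarrow> h \<le> 1 \<Longrightarrow> x \<in> K'" for x h
    unfolding K'_def by (rule image_eqI[where x="(x + h *\<^sub>R b, h)"]) auto
  define D where "D = (\<lambda>n x. (1 / inverse (real (Suc n))) *\<^sub>R (g (x + inverse (real (Suc n)) *\<^sub>R b) - g x))"
  have intg: "integrable lborel g"
  proof -
    have "integrable lborel (\<lambda>x. indicator K x *\<^sub>R g x)"
      by (rule borel_integrable_compact) (use K cont in \<open>auto intro: continuous_on_subset\<close>)
    moreover have "(\<lambda>x. indicator K x *\<^sub>R g x) = g" using K by (auto simp: indicator_def fun_eq_iff)
    ultimately show ?thesis by simp
  qed
  have tr: "integral\<^sup>L lborel (\<lambda>x. g (x + c)) = integral\<^sup>L lborel g" "integrable lborel (\<lambda>x. g (x + c))" for c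
  proof -
    have m: "(+) c \<in> measurable lborel borel" by simp
    have gm: "g \<in> borel_measurable borel" using cont(1) by (simp add: borel_measurable_continuous_onI)
    show "integral\<^sup>L lborel (\<lambda>x. g (x + c)) = integral\<^sup>L lborel g"
      using integral_distr[OF m gm] lborel_distr_plus[of c] by (simp add: add.commute)
    show "integrable lborel (\<lambda>x. g (x + c))"
      using integrable_distr_eq[OF m gm] lborel_distr_plus[of c] intg by (simp add: add.commute)
  qed
  have zero: "integral\<^sup>L lborel (D n) = 0" for n
    unfolding D_def using intg tr by (simp add: Bochner_Integration.integral_diff)
  have "(\<lambda>n. integral\<^sup>L lborel (D n)) \<longlonglongrightarrow> integral\<^sup>L lborel g'"
  proof (rule integral_dominated_convergence[where w="\<lambda>x. B * indicator K' x"])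
    show "g' \<in> borel_measurable lborel" using cont(2) by (simp add: borel_measurable_continuous_onI)
    have [measurable]: "g \<in> borel_measurable borel" using cont(1) by (simp add: borel_measurable_continuous_onI)
    show "D n \<in> borel_measurable lborel" for n unfolding D_def by measurable
    have "integrable lborel (\<lambda>x. indicator K' x *\<^sub>R B)"
      by (rule borel_integrable_compact) (use cK' in auto)
    then show "integrable lborel (\<lambda>x. B * indicator K' x)" by (simp add: mult.commute)
    show "AE x in lborel. (\<lambda>i. D i x) \<longlonglongrightarrow> g' x"
    proof (rule AE_I2)
      fix x
      have "((\<lambda>h. norm (g (x + h *\<^sub>R b) - g x - h *\<^sub>R g' x) / norm h) \<longlongrightarrow> 0) (at 0)"
        using der[of x] unfolding has_ddir_def has_vector_derivative_def has_derivative_at by simp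
      then have "((\<lambda>h. norm ((g (x + h *\<^sub>R b) - g x) /\<^sub>R h - g' x)) \<longlongrightarrow> 0) (at 0)"
      proof (rule Lim_transform_eventually)
        show "\<forall>\<^sub>F h in at 0. norm (g (x + h *\<^sub>R b) - g x - h *\<^sub>R g' x) / norm h
            = norm ((g (x + h *\<^sub>R b) - g x) /\<^sub>R h - g' x)"
        proof (rule eventually_at_filter[THEN iffD2], rule always_eventually, intro allI impI)
          fix h :: real assume "h \<noteq> 0"
          then have "(g (x + h *\<^sub>R b) - g x) /\<^sub>R h - g' x = (g (x + h *\<^sub>R b) - g x - h *\<^sub>R g' x) /\<^sub>R h"
            by (simp add: scaleR_diff_right)
          then show "norm (g (x + h *\<^sub>R b) - g x - h *\<^sub>R g' x) / norm h
            = norm ((g (x + h *\<^sub>R b) - g x) /\<^sub>R h - g' x)"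
            by (simp add: divide_inverse_commute)
        qed
      qed
      then have "((\<lambda>h. (g (x + h *\<^sub>R b) - g x) /\<^sub>R h) \<longlongrightarrow> g' x) (at 0)"
        using LIM_zero_cancel tendsto_norm_zero_iff by blast
      moreover have "filterlim (\<lambda>n. inverse (real (Suc n))) (at 0) sequentially"
        using LIMSEQ_inverse_real_of_nat by (auto simp: filterlim_at)
      ultimately show "(\<lambda>i. D i x) \<longlonglongrightarrow> g' x"
        unfolding D_def by (auto dest: filterlim_compose simp: divide_inverse)
    qed
    show "AE x in lborel. norm (D i x) \<le> B * indicator K' x" for i
    proof (rule AE_I2)
      fix x
      let ?h = "inverse (real (Suc i))"
      have h: "0 < ?h" "?h \<le> 1" by (auto simp: inverse_le_1_iff)
      show "norm (D i x) \<le> B * indicator K' x"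
      proof (cases "x \<in> K'")
        case True
        have "norm (g (x + ?h *\<^sub>R b) - g x) \<le> B * \<bar>?h\<bar>"
          by (rule has_ddir_difference_bound[OF der]) (use B B_def in auto)
        moreover have "norm (D i x) = norm (g (x + ?h *\<^sub>R b) - g x) / ?h"
          unfolding D_def norm_scaleR using h by (simp only: real_norm_def abs_of_pos zero_less_divide_1_iff) simp
        ultimately show ?thesis using True h by (simp only: indicator_simps pos_divide_le_eq abs_of_pos mult_1_right)
      next
        case False
        then have "x + ?h *\<^sub>R b \<notin> K" "x \<notin> K" using KK'[of x ?h] KK'[of x 0] h by auto
        then show ?thesis using False K by (simp add: D_def)
      qed
    qed
  qed
  then show ?thesis using zero by (simp add: LIMSEQ_const_iff)
qed

lemma has_ddir_scaleR:
  fixes f :: "'a::real_normed_vector \<Rightarrow> real"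
  assumes "has_ddir f b x f'" "has_ddir g b x g'"
  shows "has_ddir (\<lambda>x. f x *\<^sub>R g x) b x (f x *\<^sub>R g' + f' *\<^sub>R g x)"
  using has_vector_derivative_scaleR[OF assms(1)[unfolded has_ddir_def, folded has_real_derivative_iff_has_vector_derivative] assms(2)[unfolded has_ddir_def]]
  by (simp add: has_ddir_def)

lemma has_ddir_mult:
  fixes f g :: "'a::real_normed_vector \<Rightarrow> real"
  assumes "has_ddir f b x f'" "has_ddir g b x g'"
  shows "has_ddir (\<lambda>x. f x * g x) b x (f x * g' + f' * g x)"
  using has_ddir_scaleR[OF assms] by simp

lemma has_ddir_add:
  "has_ddir f b x f' \<Longrightarrow> has_ddir g b x g' \<Longrightarrow> has_ddir (\<lambda>x. f x + g x) b x (f' + g')"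
  unfolding has_ddir_def by (rule has_vector_derivative_add)

lemma has_ddir_diff:
  "has_ddir f b x f' \<Longrightarrow> has_ddir g b x g' \<Longrightarrow> has_ddir (\<lambda>x. f x - g x) b x (f' - g')"
  unfolding has_ddir_def by (rule has_vector_derivative_diff)

lemma has_ddir_compose_affine:
  fixes h :: "real \<Rightarrow> real"
  assumes "\<And>s. (h has_real_derivative h' s) (at s)"
  shows "has_ddir (\<lambda>x. h ((n \<bullet> x - d) / r)) b x (h' ((n \<bullet> x - d) / r) * (n \<bullet> b) / r)"
proof -
  have "((\<lambda>t. h ((n \<bullet> (x + t *\<^sub>R b) - d) / r)) has_real_derivative h' ((n \<bullet> (x + 0 *\<^sub>R b) - d) / r) * ((n \<bullet> b) / r)) (at 0)"
    by (rule DERIV_chain2[OF assms]) (auto intro!: derivative_eq_intros simp: inner_add_right divide_inverse)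
  then show ?thesis by (simp add: has_ddir_def has_real_derivative_iff_has_vector_derivative)
qed

lemma has_ddir_partial_deriv:
  assumes "u differentiable_on S" "open S" "x \<in> S"
  shows "has_ddir u b x (partial_deriv b u x)"
proof -
  have "u differentiable (at x)" using assms by (simp add: differentiable_on_eq_differentiable_at)
  then have u: "(u has_derivative frechet_derivative u (at x)) (at x)" by (simp add: frechet_derivative_works)
  have "((\<lambda>t. x + t *\<^sub>R b) has_derivative (\<lambda>t. t *\<^sub>R b)) (at 0)"
    by (auto intro!: derivative_eq_intros)
  then have "((\<lambda>t. u (x + t *\<^sub>R b)) has_derivative (\<lambda>t. frechet_derivative u (at x) (t *\<^sub>R b))) (at 0)"
    using has_derivative_compose[of "\<lambda>t. x + t *\<^sub>R b" "\<lambda>t. t *\<^sub>R b" 0 UNIV u] u by simp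
  moreover have "frechet_derivative u (at x) (t *\<^sub>R b) = t *\<^sub>R partial_deriv b u x" for t
    using linear_frechet_derivative[OF \<open>u differentiable (at x)\<close>] by (simp add: linear_cmul partial_deriv_def)
  ultimately show ?thesis by (simp add: has_ddir_def has_vector_derivative_def)
qed

section \<open>Integration by parts for compact support in an open set\<close>

lemma continuous_on_extend_0:
  assumes "open S" "closed K" "K \<subseteq> S" "continuous_on S f" "\<And>x. x \<notin> K \<Longrightarrow> f x = 0"
  shows "continuous_on UNIV f"
proof -
  have "continuous_on (- K) f" by (rule continuous_on_eq[OF continuous_on_const]) (use assms in auto)
  then have "continuous_on (S \<union> - K) f" using assms by (intro continuous_on_open_Un) auto
  moreover have "S \<union> - K = UNIV" using assms by auto
  ultimately show ?thesis by simp
qed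

text \<open>Extension by 0 reduces this to the whole space: off the compact \<open>K\<close> the
  extended function is locally 0, so the boundary of \<open>S\<close> causes no trouble.
  Integrability is concluded as well because the directions are summed later.\<close>

lemma integral_ddir_eq_0_on:
  fixes g :: "'a::euclidean_space \<Rightarrow> 'b::{banach,second_countable_topology}"
  assumes S: "open S"
    and der: "\<And>x. x \<in> S \<Longrightarrow> has_ddir g b x (g' x)"
    and cont: "continuous_on S g" "continuous_on S g'"
    and K: "compact K" "K \<subseteq> S" "\<And>x. x \<in> S \<Longrightarrow> x \<notin> K \<Longrightarrow> g x = 0"
  shows "integral\<^sup>L (lebesgue_on S) g' = 0" "integrable (lebesgue_on S) g'"
proof -
  define G where "G = (\<lambda>x. if x \<in> S then g x else 0)"
  define G' where "G' = (\<lambda>x. if x \<in> S then g' x else 0)"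
  have cK: "closed K" using K compact_imp_closed by blast
  have G0: "G x = 0" if "x \<notin> K" for x using K that by (auto simp: G_def)
  have der': "has_ddir G b x (G' x)" for x
  proof (cases "x \<in> S")
    case True
    then show ?thesis using has_ddir_local[OF der[OF True] S True, of G] by (simp add: G_def G'_def)
  next
    case False
    then have "has_ddir G b x 0" using K by (intro has_ddir_zero[of "- K"]) (use G0 cK in auto)
    then show ?thesis using False by (simp add: G'_def)
  qed
  have G'0: "G' x = 0" if "x \<notin> K" for x
    by (rule has_ddir_unique[OF der'], rule has_ddir_zero[of "- K"]) (use G0 cK that in auto)
  have c: "continuous_on UNIV G" "continuous_on UNIV G'"
    by (rule continuous_on_extend_0[OF S cK \<open>K \<subseteq> S\<close>];
      use cont G0 G'0 in \<open>auto simp: G_def G'_def cong: continuous_on_cong_simp\<close>)+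
  have 0: "integral\<^sup>L lborel G' = 0" by (rule integral_ddir_eq_0[OF der' c K(1) G0])
  have "integrable lborel (\<lambda>x. indicator K x *\<^sub>R G' x)"
    by (rule borel_integrable_compact) (use K c in \<open>auto intro: continuous_on_subset\<close>)
  moreover have "(\<lambda>x. indicator K x *\<^sub>R G' x) = G'" using G'0 by (auto simp: indicator_def fun_eq_iff)
  ultimately have i: "integrable lborel G'" by simp
  have m: "G' \<in> borel_measurable lborel" using c by (simp add: borel_measurable_continuous_onI)
  have 1: "integral\<^sup>L lebesgue G' = 0" "integrable lebesgue G'"
    using 0 i integral_completion[OF m] integrable_completion[OF m] by auto
  have Sm: "S \<inter> space lebesgue \<in> sets lebesgue" using S by simp
  have *: "(\<lambda>x. indicator S x *\<^sub>R g' x) = G'" by (auto simp: G'_def)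
  show "integral\<^sup>L (lebesgue_on S) g' = 0" using integral_restrict_space[OF Sm, of g'] 1 * by simp
  show "integrable (lebesgue_on S) g'" using integrable_restrict_space[OF Sm, of g'] 1 * by simp
qed

text \<open>Only pure second derivatives occur, since the Laplacian contains no mixed ones. The
  derivatives are explicit data, so those of a product with a cutoff can be written down
  directly.\<close>

definition C2_data :: "('a::euclidean_space \<Rightarrow> real) \<Rightarrow> ('a \<Rightarrow> 'a \<Rightarrow> real) \<Rightarrow> ('a \<Rightarrow> 'a \<Rightarrow> real) \<Rightarrow> bool" where
  "C2_data \<psi> D1 D2 \<longleftrightarrow> continuous_on UNIV \<psi> \<and>
     (\<forall>b\<in>Basis. continuous_on UNIV (D1 b) \<and> continuous_on UNIV (D2 b) \<and>
        (\<forall>x. has_ddir \<psi> b x (D1 b x) \<and> has_ddir (D1 b) b x (D2 b x)))"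

text \<open>The functions \<open>D1 b\<close> and \<open>D2 b\<close> are the first and second derivatives of \<open>\<psi>\<close> in direction \<open>b\<close>, so
  the integrand below is \<open>(\<Delta>\<psi> + \<nu> \<psi>) e\<close>. The function \<open>\<psi>\<close> is defined on the whole space and only its
  behaviour at the boundary of \<open>S\<close> decides whether the integral vanishes.\<close>

definition weak_eigen :: "'a::euclidean_space set \<Rightarrow> ('a \<Rightarrow> complex) \<Rightarrow> real \<Rightarrow> ('a \<Rightarrow> real) \<Rightarrow> bool" where
  "weak_eigen S e \<nu> \<psi> \<longleftrightarrow> (\<forall>D1 D2. C2_data \<psi> D1 D2 \<longrightarrow>
     integral\<^sup>L (lebesgue_on S) (\<lambda>x. ((\<Sum>b\<in>Basis. D2 b x) + \<nu> * \<psi> x) *\<^sub>R e x) = 0)"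

text \<open>\<open>X b\<close> is the component of a vector field in direction \<open>b\<close>, so
  the integrand is its divergence: in total nothing flows out of \<open>S\<close>.\<close>

definition zero_net_flux :: "'a::euclidean_space set \<Rightarrow> ('a \<Rightarrow> 'a \<Rightarrow> real) \<Rightarrow> bool" where
  "zero_net_flux S X \<longleftrightarrow> (\<forall>Y. (\<forall>b\<in>Basis. continuous_on UNIV (X b) \<and> continuous_on UNIV (Y b) \<and>
        (\<forall>x. has_ddir (X b) b x (Y b x))) \<longrightarrow>
     integral\<^sup>L (lebesgue_on S) (\<lambda>x. \<Sum>b\<in>Basis. Y b x) = 0)"

text \<open>Green's identity without boundary terms: psi times the Laplacian of e minus e times that
  of psi is the divergence of psi grad e - e grad psi, a field with compact support in
  \<open>S\<close>.\<close>

lemma weak_eigen_compact_support: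
  fixes S :: "'a::euclidean_space set"
  assumes S: "open S" and e: "C2_on S e" "\<And>x. x \<in> S \<Longrightarrow> laplacian e x = - of_real \<nu> * e x"
    and K: "compact K" "K \<subseteq> S" "\<And>x. x \<in> S \<Longrightarrow> x \<notin> K \<Longrightarrow> \<psi> x = 0"
  shows "weak_eigen S e \<nu> \<psi>"
  unfolding weak_eigen_def
proof (intro allI impI)
  fix D1 D2 assume D: "C2_data \<psi> D1 D2"
  define g' where "g' b x = \<psi> x *\<^sub>R partial_deriv b (partial_deriv b e) x - D2 b x *\<^sub>R e x" for b x
  have ed: "e differentiable_on S" using e by (simp add: C2_on_def)
  have sub: "continuous_on UNIV f \<Longrightarrow> continuous_on S f" for f :: "'a \<Rightarrow> real"
    by (rule continuous_on_subset) auto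
  have *: "integral\<^sup>L (lebesgue_on S) (g' b) = 0 \<and> integrable (lebesgue_on S) (g' b)" if b: "b \<in> Basis" for b
  proof -
    have ped: "partial_deriv b e differentiable_on S" using e b by (simp add: C2_on_def)
    have c2: "continuous_on S (partial_deriv b (partial_deriv b e))" using e b by (simp add: C2_on_def)
    define g where "g x = \<psi> x *\<^sub>R partial_deriv b e x - D1 b x *\<^sub>R e x" for x
    have d: "has_ddir g b x (g' b x)" if "x \<in> S" for x
    proof -
      have "has_ddir g b x ((\<psi> x *\<^sub>R partial_deriv b (partial_deriv b e) x + D1 b x *\<^sub>R partial_deriv b e x)
           - (D1 b x *\<^sub>R partial_deriv b e x + D2 b x *\<^sub>R e x))"
        unfolding g_def
        by (intro has_ddir_diff has_ddir_scaleR has_ddir_partial_deriv[OF ed S that] has_ddir_partial_deriv[OF ped S that])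
           (use D b in \<open>auto simp: C2_data_def\<close>)
      then show ?thesis by (simp add: g'_def)
    qed
    have c: "continuous_on S g" "continuous_on S (g' b)"
      unfolding g_def g'_def using D b c2 differentiable_imp_continuous_on[OF ed] differentiable_imp_continuous_on[OF ped]
      by (auto intro!: continuous_intros sub simp: C2_data_def)
    have "g x = 0" if "x \<in> S" "x \<notin> K" for x
    proof -
      \<comment> \<open>The derivative of psi vanishes off \<open>K\<close> too, because
        \<open>S - K\<close> is open.\<close>
      have "has_ddir \<psi> b x 0" by (rule has_ddir_zero[of "S - K"]) (use K S that in \<open>auto simp: open_Diff compact_imp_closed\<close>)
      then have "D1 b x = 0" using D b has_ddir_unique by (fastforce simp: C2_data_def)
      then show ?thesis using K that by (simp add: g_def)
    qed
    then show ?thesis using integral_ddir_eq_0_on[OF S d c K(1,2)] by auto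
  qed
  have "integral\<^sup>L (lebesgue_on S) (\<lambda>x. \<Sum>b\<in>Basis. g' b x) = 0" using * by simp
  moreover have "(\<Sum>b\<in>Basis. g' b x) = - (((\<Sum>b\<in>Basis. D2 b x) + \<nu> * \<psi> x) *\<^sub>R e x)" if "x \<in> S" for x
  proof -
    have "(\<Sum>b\<in>Basis. g' b x) = \<psi> x *\<^sub>R laplacian e x - (\<Sum>b\<in>Basis. D2 b x) *\<^sub>R e x"
      by (simp add: g'_def sum_subtractf laplacian_def scaleR_sum_right scaleR_sum_left)
    then show ?thesis using e(2)[OF that] by (simp add: scaleR_conv_of_real algebra_simps)
  qed
  ultimately have "integral\<^sup>L (lebesgue_on S) (\<lambda>x. - (((\<Sum>b\<in>Basis. D2 b x) + \<nu> * \<psi> x) *\<^sub>R e x)) = 0"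
    by (subst (asm) Bochner_Integration.integral_cong[OF refl, where g="\<lambda>x. - (((\<Sum>b\<in>Basis. D2 b x) + \<nu> * \<psi> x) *\<^sub>R e x)"]) auto
  then show "integral\<^sup>L (lebesgue_on S) (\<lambda>x. ((\<Sum>b\<in>Basis. D2 b x) + \<nu> * \<psi> x) *\<^sub>R e x) = 0"
    by simp
qed

lemma zero_net_flux_compact_support:
  fixes S :: "'a::euclidean_space set"
  assumes S: "open S"
    and K: "compact K" "K \<subseteq> S" "\<And>b x. x \<in> S \<Longrightarrow> x \<notin> K \<Longrightarrow> X b x = 0"
  shows "zero_net_flux S X"
  unfolding zero_net_flux_def
proof (intro allI impI)
  fix Y assume Y: "\<forall>b\<in>Basis. continuous_on UNIV (X b) \<and> continuous_on UNIV (Y b) \<and>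
        (\<forall>x. has_ddir (X b) b x (Y b x))"
  have "integral\<^sup>L (lebesgue_on S) (Y b) = 0 \<and> integrable (lebesgue_on S) (Y b)" if b: "b \<in> Basis" for b
    using integral_ddir_eq_0_on[OF S, of "X b" b "Y b" K] Y b K
    by (meson continuous_on_subset subset_UNIV)
  then show "integral\<^sup>L (lebesgue_on S) (\<lambda>x. \<Sum>b\<in>Basis. Y b x) = 0" by simp
qed

section \<open>Cutoffs near a side\<close>

text \<open>The integral of a cubic B-spline with knots 1, 2, 3, 4: a \<open>C\<^sup>2\<close> step from 0 to 1.\<close>

definition cutoff :: "real \<Rightarrow> real" where
  "cutoff s = (max 0 (s - 1) ^ 3 - 3 * max 0 (s - 2) ^ 3 + 3 * max 0 (s - 3) ^ 3 - max 0 (s - 4) ^ 3) / 6"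

definition cutoff' :: "real \<Rightarrow> real" where
  "cutoff' s = (max 0 (s - 1) ^ 2 - 3 * max 0 (s - 2) ^ 2 + 3 * max 0 (s - 3) ^ 2 - max 0 (s - 4) ^ 2) / 2"

definition cutoff'' :: "real \<Rightarrow> real" where
  "cutoff'' s = max 0 (s - 1) - 3 * max 0 (s - 2) + 3 * max 0 (s - 3) - max 0 (s - 4)"

text \<open>Only the knot s = a needs an argument: there the difference quotient
  \<open>max 0 h ^ Suc n / h\<close> is at most \<open>max 0 h ^ n\<close> in size, which tends to 0
  because n >= 1.\<close>

lemma has_real_derivative_max_power:
  fixes a :: real
  assumes "n \<ge> 1"
  shows "((\<lambda>s. max 0 (s - a) ^ Suc n) has_real_derivative real (Suc n) * max 0 (s - a) ^ n) (at s)"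
proof -
  have n0: "(0::real) ^ n = 0" using assms by simp
  consider "s < a" | "s = a" | "s > a" by linarith
  then show ?thesis
  proof cases
    case 1
    then have "\<forall>\<^sub>F t in nhds s. max 0 (t - a) ^ Suc n = 0"
      using eventually_nhds_in_open[of "{..<a}" s] by (auto elim!: eventually_mono)
    then have "((\<lambda>t. max 0 (t - a) ^ Suc n) has_real_derivative 0) (at s)"
      using DERIV_cong_ev[of s s "\<lambda>t. max 0 (t - a) ^ Suc n" "\<lambda>_. 0" 0 0] DERIV_const by blast
    moreover have "real (Suc n) * max 0 (s - a) ^ n = 0" using 1 assms by simp
    ultimately show ?thesis by metis
  next
    case 3
    then have ev: "\<forall>\<^sub>F t in nhds s. max 0 (t - a) ^ Suc n = (t - a) ^ Suc n"
      using eventually_nhds_in_open[of "{a<..}" s] by (auto elim!: eventually_mono)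
    have "((\<lambda>t. (t - a) ^ Suc n) has_real_derivative real (Suc n) * (s - a) ^ n) (at s)"
      by (auto intro!: derivative_eq_intros simp del: power_Suc)
    then show ?thesis using 3 DERIV_cong_ev[OF refl ev refl] by simp
  next
    case 2
    have "((\<lambda>h::real. max 0 h ^ Suc n / h) \<longlongrightarrow> 0) (at 0)"
    proof (rule Lim_null_comparison)
      show "\<forall>\<^sub>F h in at (0::real). norm (max 0 h ^ Suc n / h) \<le> max 0 h ^ n"
        by (intro always_eventually allI) (auto simp: max_def)
      have "((\<lambda>h::real. max 0 h ^ n) \<longlongrightarrow> max 0 0 ^ n) (at 0)" by (intro tendsto_intros)
      then show "((\<lambda>h::real. max 0 h ^ n) \<longlongrightarrow> 0) (at 0)" by (simp add: n0)
    qed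
    then show ?thesis using 2 by (simp add: DERIV_def n0)
  qed
qed

lemma cutoff_deriv: "(cutoff has_real_derivative cutoff' s) (at s)"
proof -
  have p: "((\<lambda>s. max 0 (s - a) ^ 3) has_real_derivative 3 * max 0 (s - a) ^ 2) (at s)" for a :: real
    using has_real_derivative_max_power[of 2 a s] by (simp add: numeral_eq_Suc)
  show ?thesis unfolding cutoff_def[abs_def]
    by (rule DERIV_cong[OF DERIV_cdivide[OF DERIV_diff[OF DERIV_add[OF DERIV_diff[OF p DERIV_cmult[OF p]] DERIV_cmult[OF p]] p]]])
       (simp add: cutoff'_def)
qed

lemma cutoff'_deriv: "(cutoff' has_real_derivative cutoff'' s) (at s)"
proof -
  have p: "((\<lambda>s. max 0 (s - a) ^ 2) has_real_derivative 2 * max 0 (s - a)) (at s)" for a :: real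
    using has_real_derivative_max_power[of 1 a s] by (simp add: numeral_eq_Suc)
  show ?thesis unfolding cutoff'_def[abs_def]
    by (rule DERIV_cong[OF DERIV_cdivide[OF DERIV_diff[OF DERIV_add[OF DERIV_diff[OF p DERIV_cmult[OF p]] DERIV_cmult[OF p]] p]]])
       (simp add: cutoff''_def)
qed

lemma cutoff_eq_0: "s \<le> 1 \<Longrightarrow> cutoff s = 0" "s \<le> 1 \<Longrightarrow> cutoff' s = 0" "s \<le> 1 \<Longrightarrow> cutoff'' s = 0"
  by (auto simp: cutoff_def cutoff'_def cutoff''_def)

text \<open>Past the last knot no truncation is active, and the coefficients 1, -3, 3, -1 form a
  third difference, which sends s^3 to 6 and kills lower powers.\<close>

lemma cutoff_eq_1: "s \<ge> 4 \<Longrightarrow> cutoff s = 1" "s \<ge> 4 \<Longrightarrow> cutoff' s = 0" "s \<ge> 4 \<Longrightarrow> cutoff'' s = 0"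
  by (auto simp: cutoff_def cutoff'_def cutoff''_def power2_eq_square power3_eq_cube algebra_simps)

lemma continuous_cutoff:
  "continuous_on UNIV cutoff" "continuous_on UNIV cutoff'" "continuous_on UNIV cutoff''"
  unfolding cutoff_def[abs_def] cutoff'_def[abs_def] cutoff''_def[abs_def] by (intro continuous_intros; simp)+

lemma continuous_cutoff_affine:
  fixes n :: "'a::euclidean_space"
  shows "continuous_on S (\<lambda>x. cutoff ((n \<bullet> x - d) / r))" "continuous_on S (\<lambda>x. cutoff' ((n \<bullet> x - d) / r))"
   "continuous_on S (\<lambda>x. cutoff'' ((n \<bullet> x - d) / r))"
proof -
  have *: "continuous_on S (\<lambda>x. (n \<bullet> x - d) / r)" unfolding divide_inverse by (intro continuous_intros)
  have c: "continuous_on S (\<lambda>x. f ((n \<bullet> x - d) / r))" if "continuous_on UNIV f" for f :: "real \<Rightarrow> real"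
    by (rule continuous_on_compose2[OF that *]) simp
  show "continuous_on S (\<lambda>x. cutoff ((n \<bullet> x - d) / r))" by (rule c[OF continuous_cutoff(1)])
  show "continuous_on S (\<lambda>x. cutoff' ((n \<bullet> x - d) / r))" by (rule c[OF continuous_cutoff(2)])
  show "continuous_on S (\<lambda>x. cutoff'' ((n \<bullet> x - d) / r))" by (rule c[OF continuous_cutoff(3)])
qed

lemma cutoff_bound: "\<exists>B\<ge>1. \<forall>s. \<bar>cutoff s\<bar> \<le> B \<and> \<bar>cutoff' s\<bar> \<le> B \<and> \<bar>cutoff'' s\<bar> \<le> B"
proof -
  have bd: "\<exists>B. \<forall>s\<in>{1..4}. \<bar>f s\<bar> \<le> B" if "continuous_on UNIV f" for f :: "real \<Rightarrow> real"
  proof -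
    have "bounded (f ` {1..4})" by (rule compact_imp_bounded, rule compact_continuous_image)
      (use that in \<open>auto intro: continuous_on_subset\<close>)
    then show ?thesis by (auto simp: bounded_iff)
  qed
  obtain B1 B2 B3 where B: "\<forall>s\<in>{1..4}. \<bar>cutoff s\<bar> \<le> B1" "\<forall>s\<in>{1..4}. \<bar>cutoff' s\<bar> \<le> B2" "\<forall>s\<in>{1..4}. \<bar>cutoff'' s\<bar> \<le> B3"
    using bd continuous_cutoff by meson
  define B where "B = max 1 (max B1 (max B2 B3))"
  have "\<bar>cutoff s\<bar> \<le> B \<and> \<bar>cutoff' s\<bar> \<le> B \<and> \<bar>cutoff'' s\<bar> \<le> B" for s
  proof -
    consider "s \<le> 1" | "s \<in> {1..4}" | "s \<ge> 4" by force
    then show ?thesis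
    proof cases
      case 2
      have "\<bar>cutoff s\<bar> \<le> B1" "\<bar>cutoff' s\<bar> \<le> B2" "\<bar>cutoff'' s\<bar> \<le> B3" using B 2 by blast+
      then show ?thesis by (auto simp: B_def)
    qed (auto simp: B_def cutoff_eq_0 cutoff_eq_1)
  qed
  moreover have "B \<ge> 1" by (simp add: B_def)
  ultimately show ?thesis by blast
qed

text \<open>The linear rate in s is what pays for the factor 1 / r that differentiating a cutoff of
  width r produces.\<close>

definition strip_area_bound :: "'a::euclidean_space set \<Rightarrow> 'a \<Rightarrow> real \<Rightarrow> real \<Rightarrow> bool" where
  "strip_area_bound S n d A \<longleftrightarrow> (\<forall>s>0. measure lebesgue {x\<in>S. n \<bullet> x - d \<le> s} \<le> A * s)"

text \<open>The foot of the perpendicular from x to the line need not lie on the boundary of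
  \<open>S\<close>, but it lies outside \<open>S\<close>. Hence the segment to it meets the
  frontier, where e is 0, within distance n . x - d, and uniform continuity of e on the closure
  finishes.\<close>

lemma boundary_strip_small:
  fixes S :: "'a::euclidean_space set" and e :: "'a \<Rightarrow> 'b::real_normed_vector"
  assumes S: "bounded S" "S \<subseteq> {x. n \<bullet> x > d}" and n: "norm n = 1"
    and e: "continuous_on (closure S) e" "\<forall>x\<in>frontier S. e x = 0" and \<delta>: "\<delta> > 0"
  shows "\<exists>s>0. \<forall>x\<in>S. n \<bullet> x - d \<le> s \<longrightarrow> norm (e x) \<le> \<delta>"
proof -
  have "compact (closure S)" using S by simp
  then have "uniformly_continuous_on (closure S) e" using e(1) compact_uniformly_continuous by blast
  then obtain s where s: "s > 0" "\<And>x y. x \<in> closure S \<Longrightarrow> y \<in> closure S \<Longrightarrow> dist x y < s \<Longrightarrow> dist (e x) (e y) < \<delta>"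
    using \<delta> unfolding uniformly_continuous_on_def by metis
  have "norm (e x) \<le> \<delta>" if x: "x \<in> S" and l: "n \<bullet> x - d \<le> s / 2" for x
  proof -
    define z where "z = x - (n \<bullet> x - d) *\<^sub>R n"
    have nn: "n \<bullet> n = 1" using n by (simp add: norm_eq_1)
    have "n \<bullet> z = d" by (simp add: z_def inner_diff_right nn)
    then have "z \<notin> S" using S by auto
    then have "closed_segment x z \<inter> frontier S \<noteq> {}"
      using x by (intro connected_Int_frontier) auto
    then obtain y where y: "y \<in> closed_segment x z" "y \<in> frontier S" by auto
    have "dist x y \<le> dist x z" using y(1) by (metis dist_commute dist_in_closed_segment(1) )
    also have "\<dots> = n \<bullet> x - d" using x S n by (auto simp: z_def dist_norm)
    also have "\<dots> < s" using l s(1) by simp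
    finally have "dist (e x) (e y) < \<delta>" using s(2)[of x y] x y closure_subset by (auto simp: frontier_def)
    then show ?thesis using e(2) y by simp
  qed
  then show ?thesis using s(1) by (intro exI[of _ "s/2"]) auto
qed

section \<open>Removing the cutoff at one side\<close>

lemma integrable_on_bounded_open:
  fixes f :: "'a::euclidean_space \<Rightarrow> 'b::{banach,second_countable_topology}"
  assumes S: "open S" "bounded S" and f: "continuous_on (closure S) f"
  shows "integrable (lebesgue_on S) f"
proof -
  interpret finite_measure "lebesgue_on S"
    using S by (intro finite_measure_lebesgue_on lmeasurable_open) auto
  have "compact (closure S)" using S by simp
  then have "bounded (f ` closure S)" using compact_continuous_image[OF f] compact_imp_bounded by blast
  then obtain B where B: "\<forall>x\<in>closure S. norm (f x) \<le> B" by (auto simp: bounded_iff)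
  have Sm: "S \<in> sets lebesgue" using S by simp
  show ?thesis
  proof (rule integrable_const_bound)
    show "AE x in lebesgue_on S. norm (f x) \<le> B"
      using B closure_subset by (intro AE_I2) (auto simp: space_restrict_space)
    show "f \<in> borel_measurable (lebesgue_on S)"
      by (rule continuous_imp_measurable_on_sets_lebesgue) (use Sm continuous_on_subset[OF f closure_subset] in auto)
  qed
qed

lemma cutoff_mult_ddir:
  assumes "has_ddir (\<psi>::'a::euclidean_space \<Rightarrow> real) b x D"
  shows "has_ddir (\<lambda>x. cutoff ((n \<bullet> x - d) / r) * \<psi> x) b x
    (cutoff ((n \<bullet> x - d) / r) * D + cutoff' ((n \<bullet> x - d) / r) * (n \<bullet> b) / r * \<psi> x)"
  by (rule has_ddir_mult[OF has_ddir_compose_affine[OF cutoff_deriv] assms])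

text \<open>Within a strip of width of order \<open>r\<close>, the terms of \<open>\<Delta>(\<chi> \<psi>)\<close> that involve derivatives of the
  cutoff \<open>\<chi>\<close> are of order \<open>1 / r\<close> because \<open>\<psi>\<close> vanishes linearly; the strip has area of order
  \<open>r\<close> and \<open>e\<close> tends to 0 uniformly on it.\<close>

lemma weak_eigen_remove_cutoff:
  fixes S :: "'a::euclidean_space set" and e :: "'a \<Rightarrow> complex"
  assumes S: "open S" "bounded S" "S \<subseteq> {x. n \<bullet> x > d}" and n: "norm n = 1"
    and A: "strip_area_bound S n d A"
    and e: "continuous_on (closure S) e" "\<forall>x\<in>frontier S. e x = 0"
    and \<psi>: "C \<ge> 0" "\<And>x. x \<in> S \<Longrightarrow> \<bar>\<psi> x\<bar> \<le> C * (n \<bullet> x - d)"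
    and cut: "\<And>r. r > 0 \<Longrightarrow> weak_eigen S e \<nu> (\<lambda>x. cutoff ((n \<bullet> x - d) / r) * \<psi> x)"
  shows "weak_eigen S e \<nu> \<psi>"
  unfolding weak_eigen_def
proof (intro allI impI)
  fix D1 D2 assume D: "C2_data \<psi> D1 D2"
  define l where "l x = n \<bullet> x - d" for x
  define F where "F x = (\<Sum>b\<in>Basis. D2 b x) + \<nu> * \<psi> x" for x
  \<comment> \<open>All of (Laplacian + nu)(cutoff * psi) except cutoff times \<open>F\<close>: the
    terms in which a derivative falls on the cutoff.\<close>
  define R where "R r x = (\<Sum>b\<in>Basis. 2 * (cutoff' (l x / r) * (n \<bullet> b) / r * D1 b x) + cutoff'' (l x / r) * (n \<bullet> b) / r * (n \<bullet> b) / r * \<psi> x)" for r x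
  have cu: "continuous_on T (\<lambda>x. cutoff (l x / r))" "continuous_on T (\<lambda>x. cutoff' (l x / r))" "continuous_on T (\<lambda>x. cutoff'' (l x / r))" for T r
    unfolding l_def by (rule continuous_cutoff_affine)+
  have cD: "continuous_on UNIV \<psi>" "b \<in> Basis \<Longrightarrow> continuous_on UNIV (D1 b)" "b \<in> Basis \<Longrightarrow> continuous_on UNIV (D2 b)" for b
    using D by (auto simp: C2_data_def)
  have cF: "continuous_on UNIV F" unfolding F_def by (intro continuous_intros cD)
  have cR: "continuous_on UNIV (R r)" for r
    unfolding R_def divide_inverse[of _ r] by (intro continuous_intros cD cu[unfolded divide_inverse])
  have sub: "continuous_on UNIV f \<Longrightarrow> continuous_on T f" for f :: "'a \<Rightarrow> real" and T
    by (rule continuous_on_subset) auto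
  have int: "integrable (lebesgue_on S) (\<lambda>x. G x *\<^sub>R e x)" if "continuous_on UNIV G" for G
    by (rule integrable_on_bounded_open[OF S(1,2)]) (intro continuous_on_scaleR e(1) sub[OF that])
  have eq: "integral\<^sup>L (lebesgue_on S) (\<lambda>x. (cutoff (l x / r) * F x) *\<^sub>R e x) = - integral\<^sup>L (lebesgue_on S) (\<lambda>x. R r x *\<^sub>R e x)"
    if r: "r > 0" for r
  proof -
    define E1 where "E1 b x = cutoff (l x / r) * D1 b x + cutoff' (l x / r) * (n \<bullet> b) / r * \<psi> x" for b x
    define E2 where "E2 b x = (cutoff (l x / r) * D2 b x + cutoff' (l x / r) * (n \<bullet> b) / r * D1 b x) +
       (cutoff' (l x / r) * (n \<bullet> b) / r * D1 b x + cutoff'' (l x / r) * (n \<bullet> b) / r * (n \<bullet> b) / r * \<psi> x)" for b x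
    have c': "has_ddir (\<lambda>x. cutoff' (l x / r) * (n \<bullet> b) / r) b x (cutoff'' (l x / r) * (n \<bullet> b) / r * (n \<bullet> b) / r)" for b x
    proof -
      have "has_ddir (\<lambda>x. (n \<bullet> b) / r * cutoff' (l x / r)) b x ((n \<bullet> b) / r * (cutoff'' (l x / r) * (n \<bullet> b) / r) + 0 * cutoff' (l x / r))"
        unfolding l_def by (rule has_ddir_mult[OF _ has_ddir_compose_affine[OF cutoff'_deriv]]) (simp add: has_ddir_def)
      then show ?thesis by (simp add: mult_ac)
    qed
    have "C2_data (\<lambda>x. cutoff (l x / r) * \<psi> x) E1 E2"
      unfolding C2_data_def
    proof (intro conjI ballI allI)
      show "continuous_on UNIV (\<lambda>x. cutoff (l x / r) * \<psi> x)" by (intro continuous_intros cu cD)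
      fix b :: 'a assume b: "b \<in> Basis"
      show "continuous_on UNIV (E1 b)" "continuous_on UNIV (E2 b)"
        unfolding E1_def E2_def divide_inverse[of _ r] by (intro continuous_intros cD b cu[unfolded divide_inverse])+
      fix x
      show "has_ddir (\<lambda>x. cutoff (l x / r) * \<psi> x) b x (E1 b x)"
        unfolding E1_def l_def by (rule cutoff_mult_ddir) (use D b in \<open>auto simp: C2_data_def\<close>)
      have 1: "has_ddir \<psi> b x (D1 b x)" "has_ddir (D1 b) b x (D2 b x)" using D b by (auto simp: C2_data_def)
      show "has_ddir (E1 b) b x (E2 b x)"
        unfolding E1_def E2_def
        by (intro has_ddir_add has_ddir_mult[OF c' 1(1)] cutoff_mult_ddir[OF 1(2), of n d r, folded l_def])
    qed
    then have "integral\<^sup>L (lebesgue_on S) (\<lambda>x. ((\<Sum>b\<in>Basis. E2 b x) + \<nu> * (cutoff (l x / r) * \<psi> x)) *\<^sub>R e x) = 0"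
      using cut[OF r] unfolding weak_eigen_def l_def by blast
    moreover have "(\<Sum>b\<in>Basis. E2 b x) + \<nu> * (cutoff (l x / r) * \<psi> x) = cutoff (l x / r) * F x + R r x" for x
      unfolding E2_def F_def R_def by (simp add: sum.distrib sum_distrib_left algebra_simps)
    ultimately have "integral\<^sup>L (lebesgue_on S) (\<lambda>x. (cutoff (l x / r) * F x) *\<^sub>R e x + R r x *\<^sub>R e x) = 0"
      by (simp add: scaleR_add_left)
    moreover have "integrable (lebesgue_on S) (\<lambda>x. (cutoff (l x / r) * F x) *\<^sub>R e x)"
      by (rule int) (intro continuous_intros cu cF)
    ultimately show ?thesis using int[OF cR] by (simp add: add_eq_0_iff2)
  qed
  define r where "r m = inverse (real (Suc m))" for m
  have r: "r m > 0" for m by (simp add: r_def)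
  have r0: "r \<longlonglongrightarrow> 0" unfolding r_def by (rule LIMSEQ_inverse_real_of_nat)
  obtain B where B: "B \<ge> 1" "\<And>s. \<bar>cutoff s\<bar> \<le> B" "\<And>s. \<bar>cutoff' s\<bar> \<le> B" "\<And>s. \<bar>cutoff'' s\<bar> \<le> B"
    using cutoff_bound by blast
  have "(\<lambda>m. integral\<^sup>L (lebesgue_on S) (\<lambda>x. (cutoff (l x / r m) * F x) *\<^sub>R e x)) \<longlonglongrightarrow> integral\<^sup>L (lebesgue_on S) (\<lambda>x. F x *\<^sub>R e x)"
  proof (rule integral_dominated_convergence[where w="\<lambda>x. B * norm (F x *\<^sub>R e x)"])
    show "(\<lambda>x. F x *\<^sub>R e x) \<in> borel_measurable (lebesgue_on S)" using int[OF cF] by (rule borel_measurable_integrable)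
    have "integrable (lebesgue_on S) (\<lambda>x. (cutoff (l x / r m) * F x) *\<^sub>R e x)" for m
      by (rule int) (intro continuous_intros cu cF)
    then show "(\<lambda>x. (cutoff (l x / r m) * F x) *\<^sub>R e x) \<in> borel_measurable (lebesgue_on S)" for m by (rule borel_measurable_integrable)
    show "integrable (lebesgue_on S) (\<lambda>x. B * norm (F x *\<^sub>R e x))"
      using int[OF cF] by (intro integrable_mult_right integrable_norm)
    show "AE x in lebesgue_on S. norm ((cutoff (l x / r m) * F x) *\<^sub>R e x) \<le> B * norm (F x *\<^sub>R e x)" for m
    proof (rule AE_I2)
      fix x
      have "\<bar>cutoff (l x / r m)\<bar> * (\<bar>F x\<bar> * norm (e x)) \<le> B * (\<bar>F x\<bar> * norm (e x))"
        by (intro mult_right_mono B) auto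
      then show "norm ((cutoff (l x / r m) * F x) *\<^sub>R e x) \<le> B * norm (F x *\<^sub>R e x)"
        by (simp add: abs_mult mult.assoc)
    qed
    show "AE x in lebesgue_on S. (\<lambda>m. (cutoff (l x / r m) * F x) *\<^sub>R e x) \<longlonglongrightarrow> F x *\<^sub>R e x"
    proof (rule AE_I2)
      fix x assume "x \<in> space (lebesgue_on S)"
      then have lx: "l x > 0" using S by (auto simp: l_def space_restrict_space)
      have "\<forall>\<^sub>F m in sequentially. r m < l x / 4" using order_tendstoD(2)[OF r0, of "l x / 4"] lx by simp
      then have "\<forall>\<^sub>F m in sequentially. (cutoff (l x / r m) * F x) *\<^sub>R e x = F x *\<^sub>R e x"
      proof (rule eventually_mono)
        fix m assume "r m < l x / 4"
        then have "l x / r m \<ge> 4" using r[of m] by (simp add: field_simps)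
        then show "(cutoff (l x / r m) * F x) *\<^sub>R e x = F x *\<^sub>R e x" by (simp add: cutoff_eq_1)
      qed
      then show "(\<lambda>m. (cutoff (l x / r m) * F x) *\<^sub>R e x) \<longlonglongrightarrow> F x *\<^sub>R e x" by (rule tendsto_eventually)
    qed
  qed
  moreover have "(\<lambda>m. integral\<^sup>L (lebesgue_on S) (\<lambda>x. R (r m) x *\<^sub>R e x)) \<longlonglongrightarrow> 0"
  proof -
    have "\<exists>M1. \<forall>x\<in>S. \<bar>D1 b x\<bar> \<le> M1" if "b \<in> Basis" for b
    proof -
      have "bounded (D1 b ` closure S)"
        by (rule compact_imp_bounded, rule compact_continuous_image) (use S that cD sub in auto)
      then show ?thesis using closure_subset by (fastforce simp: bounded_iff)
    qed
    then obtain M1 where M1: "\<And>b x. b \<in> Basis \<Longrightarrow> x \<in> S \<Longrightarrow> \<bar>D1 b x\<bar> \<le> M1 b" by metis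
    \<comment> \<open>\<open>R\<close> lives where l x <= 4 r, since \<open>cutoff\<close> is
      constant from 4 on. There |psi| <= 4 C r, which absorbs one of the two factors 1 / r of the
      second derivative; hence 4 * B * C.\<close>
    define M where "M = (\<Sum>b\<in>(Basis::'a set). 2 * (B * \<bar>M1 b\<bar>) + 4 * B * C)"
    have M: "M \<ge> 0" unfolding M_def using B \<psi> by (intro sum_nonneg add_nonneg_nonneg mult_nonneg_nonneg) auto
    have nb: "\<bar>n \<bullet> b\<bar> \<le> 1" if "b \<in> Basis" for b
      using Cauchy_Schwarz_ineq2[of n b] n that by simp
    have Rb: "\<bar>R r x\<bar> \<le> M / r" if x: "x \<in> S" and r: "r > 0" and lr: "l x \<le> 4 * r" for r x
    proof -
      have "\<bar>R r x\<bar> \<le> (\<Sum>b\<in>Basis. \<bar>2 * (cutoff' (l x / r) * (n \<bullet> b) / r * D1 b x) + cutoff'' (l x / r) * (n \<bullet> b) / r * (n \<bullet> b) / r * \<psi> x\<bar>)"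
        unfolding R_def by (rule sum_abs)
      also have "\<dots> \<le> (\<Sum>b\<in>(Basis::'a set). (2 * (B * \<bar>M1 b\<bar>) + 4 * B * C) / r)"
      proof (rule sum_mono)
        fix b :: 'a assume b: "b \<in> Basis"
        have "\<bar>cutoff' (l x / r)\<bar> * \<bar>n \<bullet> b\<bar> * \<bar>D1 b x\<bar> \<le> B * 1 * \<bar>M1 b\<bar>"
          by (intro mult_mono B nb b) (use B M1[OF b x] in auto)
        then have 1: "\<bar>2 * (cutoff' (l x / r) * (n \<bullet> b) / r * D1 b x)\<bar> \<le> 2 * (B * \<bar>M1 b\<bar>) / r"
          using r by (simp add: abs_mult field_simps)
        have "\<bar>\<psi> x\<bar> \<le> C * (4 * r)" using \<psi>(2)[OF x] mult_left_mono[OF lr \<psi>(1)] by (simp add: l_def)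
        then have "\<bar>cutoff'' (l x / r)\<bar> * \<bar>n \<bullet> b\<bar> * \<bar>n \<bullet> b\<bar> * \<bar>\<psi> x\<bar> \<le> B * 1 * 1 * (C * (4 * r))"
          by (intro mult_mono B nb b) (use B in auto)
        then have 2: "\<bar>cutoff'' (l x / r) * (n \<bullet> b) / r * (n \<bullet> b) / r * \<psi> x\<bar> \<le> 4 * B * C / r"
          using r by (simp add: abs_mult field_simps)
        show "\<bar>2 * (cutoff' (l x / r) * (n \<bullet> b) / r * D1 b x) + cutoff'' (l x / r) * (n \<bullet> b) / r * (n \<bullet> b) / r * \<psi> x\<bar> \<le> (2 * (B * \<bar>M1 b\<bar>) + 4 * B * C) / r"
          unfolding add_divide_distrib by (rule order_trans[OF abs_triangle_ineq add_mono[OF 1 2]])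
      qed
      also have "\<dots> = M / r" by (simp add: M_def sum_divide_distrib)
      finally show ?thesis .
    qed
    have R0: "R r x = 0" if "r > 0" "l x > 4 * r" for r x
      using that cutoff_eq_1[of "l x / r"] by (simp add: R_def field_simps)
    have Ab: "measure lebesgue {x\<in>S. l x \<le> s} \<le> A * s" if "s > 0" for s
      using A that by (auto simp: strip_area_bound_def l_def)
    have A0: "A \<ge> 0" using Ab[of 1] measure_nonneg[of lebesgue "{x\<in>S. l x \<le> 1}"] by linarith
    \<comment> \<open>The bounds M / r on \<open>R\<close>, delta on e and 4 A r on the area of the
      strip multiply to a quantity free of r.\<close>
    have main: "norm (integral\<^sup>L (lebesgue_on S) (\<lambda>x. R r x *\<^sub>R e x)) \<le> 4 * M * A * \<delta>"
      if \<delta>: "\<delta> > 0" and s: "\<And>x. x \<in> S \<Longrightarrow> l x \<le> s \<Longrightarrow> norm (e x) \<le> \<delta>" and r: "r > 0" "4 * r \<le> s" for \<delta> s r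
    proof -
      let ?T = "{x\<in>S. l x \<le> 4 * r}"
      have To: "{x. l x \<le> 4 * r} \<in> sets borel" unfolding l_def by measurable
      then have Tm: "?T \<in> sets lebesgue" using S(1) by (auto simp: Collect_conj_eq Int_def[symmetric])
      have "?T \<in> lmeasurable" using Tm S by (intro bounded_set_imp_lmeasurable) (auto intro: bounded_subset)
      have Tm': "?T \<in> sets (lebesgue_on S)" using Tm S by (simp add: sets_restrict_space_iff)
      have meq: "measure (lebesgue_on S) ?T = measure lebesgue ?T" by (rule measure_restrict_space) (use S in auto)
      have fin: "emeasure (lebesgue_on S) ?T < \<infinity>"
        using \<open>?T \<in> lmeasurable\<close> S by (subst emeasure_restrict_space) (auto simp: fmeasurable_def)
      have "norm (integral\<^sup>L (lebesgue_on S) (\<lambda>x. R r x *\<^sub>R e x)) \<le> integral\<^sup>L (lebesgue_on S) (\<lambda>x. M / r * \<delta> * indicator ?T x)"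
      proof (rule order_trans[OF integral_norm_bound], rule integral_mono)
        show "integrable (lebesgue_on S) (\<lambda>x. norm (R r x *\<^sub>R e x))" by (intro integrable_norm int cR)
        show "integrable (lebesgue_on S) (\<lambda>x. M / r * \<delta> * indicator ?T x)"
          using Tm' fin by (intro integrable_mult_right integrable_real_indicator) auto
        fix x assume "x \<in> space (lebesgue_on S)"
        then have x: "x \<in> S" by (simp add: space_restrict_space)
        show "norm (R r x *\<^sub>R e x) \<le> M / r * \<delta> * indicator ?T x"
        proof (cases "l x \<le> 4 * r")
          case True
          have "\<bar>R r x\<bar> * norm (e x) \<le> M / r * \<delta>"
            using Rb[OF x r(1) True] s[OF x] True r M by (intro mult_mono) auto
          then show ?thesis using x True by simp
        qed (use R0 r in auto)
      qed
      also have "\<dots> = M / r * \<delta> * measure lebesgue ?T" using Tm' meq by (simp add: Int_absorb2 space_restrict_space)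
      also have "\<dots> \<le> M / r * \<delta> * (A * (4 * r))" using Ab[of "4 * r"] r M \<delta> by (intro mult_left_mono) auto
      also have "\<dots> = 4 * M * A * \<delta>" using r by simp
      finally show ?thesis .
    qed
    show ?thesis
    proof (rule LIMSEQ_I)
      fix \<epsilon> :: real assume \<epsilon>: "\<epsilon> > 0"
      \<comment> \<open>The added 1 keeps the denominator positive when M * A is 0.\<close>
      define \<delta> where "\<delta> = \<epsilon> / (4 * M * A + 1)"
      have denom_pos: "4 * M * A + 1 > 0" using M A0 by (simp add: add_nonneg_pos)
      then have \<delta>: "\<delta> > 0" using \<epsilon> by (simp add: \<delta>_def)
      have small: "4 * M * A * \<delta> < \<epsilon>" using denom_pos \<epsilon> by (simp add: \<delta>_def field_simps)
      obtain s where s: "s > 0" "\<forall>x\<in>S. n \<bullet> x - d \<le> s \<longrightarrow> norm (e x) \<le> \<delta>"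
        using boundary_strip_small[OF S(2,3) n e \<delta>] by blast
      have "\<forall>\<^sub>F m in sequentially. r m < s / 4" using order_tendstoD(2)[OF r0, of "s / 4"] s by simp
      then obtain N where N: "\<And>m. m \<ge> N \<Longrightarrow> r m < s / 4" by (auto simp: eventually_sequentially)
      have "norm (integral\<^sup>L (lebesgue_on S) (\<lambda>x. R (r m) x *\<^sub>R e x) - 0) < \<epsilon>" if "m \<ge> N" for m
        using main[OF \<delta>, of s "r m"] s(2) N[OF that] r small by (force simp: l_def)
      then show "\<exists>N. \<forall>m\<ge>N. norm (integral\<^sup>L (lebesgue_on S) (\<lambda>x. R (r m) x *\<^sub>R e x) - 0) < \<epsilon>" by blast
    qed
  qed
  then have "(\<lambda>m. - integral\<^sup>L (lebesgue_on S) (\<lambda>x. R (r m) x *\<^sub>R e x)) \<longlonglongrightarrow> - 0"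
    by (rule tendsto_minus)
  ultimately have "integral\<^sup>L (lebesgue_on S) (\<lambda>x. F x *\<^sub>R e x) = - 0"
    unfolding eq[OF r] by (rule LIMSEQ_unique)
  then show "integral\<^sup>L (lebesgue_on S) (\<lambda>x. ((\<Sum>b\<in>Basis. D2 b x) + \<nu> * \<psi> x) *\<^sub>R e x) = 0"
    by (simp add: F_def)
qed

text \<open>Only the component of \<open>X\<close> normal to the side meets the gradient of the
  cutoff. On the strip where \<open>cutoff'\<close> is nonzero this component is at most 4 C r,
  against a factor 1 / r, so the extra term stays bounded; at each fixed point it vanishes for small
  r. Dominated convergence applies.\<close>

lemma zero_net_flux_remove_cutoff:
  fixes S :: "'a::euclidean_space set"
  assumes S: "open S" "bounded S" "S \<subseteq> {x. n \<bullet> x > d}"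
    and X: "C \<ge> 0" "\<And>x. x \<in> S \<Longrightarrow> \<bar>\<Sum>b\<in>Basis. (n \<bullet> b) * X b x\<bar> \<le> C * (n \<bullet> x - d)"
    and cut: "\<And>r. r > 0 \<Longrightarrow> zero_net_flux S (\<lambda>b x. cutoff ((n \<bullet> x - d) / r) * X b x)"
  shows "zero_net_flux S X"
  unfolding zero_net_flux_def
proof (intro allI impI)
  fix Y assume Y: "\<forall>b\<in>Basis. continuous_on UNIV (X b) \<and> continuous_on UNIV (Y b) \<and>
        (\<forall>x. has_ddir (X b) b x (Y b x))"
  define l where "l x = n \<bullet> x - d" for x
  define F where "F x = (\<Sum>b\<in>Basis. Y b x)" for x
  define N where "N x = (\<Sum>b\<in>Basis. (n \<bullet> b) * X b x)" for x
  have cu: "continuous_on T (\<lambda>x. cutoff (l x / r))" "continuous_on T (\<lambda>x. cutoff' (l x / r))" for T r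
    unfolding l_def by (rule continuous_cutoff_affine)+
  have cX: "b \<in> Basis \<Longrightarrow> continuous_on UNIV (X b)" "b \<in> Basis \<Longrightarrow> continuous_on UNIV (Y b)" for b
    using Y by auto
  define G where "G r x = cutoff (l x / r) * F x + cutoff' (l x / r) / r * N x" for r x
  have cF: "continuous_on UNIV F" unfolding F_def by (intro continuous_intros cX)
  have cG: "continuous_on UNIV (G r)" for r unfolding G_def N_def divide_inverse[of _ r]
    by (intro continuous_intros cu[unfolded divide_inverse] cF cX)
  have int: "integrable (lebesgue_on S) G" if "continuous_on UNIV G" for G :: "'a \<Rightarrow> real"
    by (rule integrable_on_bounded_open[OF S(1,2)]) (rule continuous_on_subset[OF that], simp)
  have eq: "integral\<^sup>L (lebesgue_on S) (G r) = 0" if r: "r > 0" for r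
  proof -
    define E where "E b x = cutoff (l x / r) * Y b x + cutoff' (l x / r) * (n \<bullet> b) / r * X b x" for b x
    have "\<forall>b\<in>Basis. continuous_on UNIV (\<lambda>x. cutoff (l x / r) * X b x) \<and> continuous_on UNIV (E b) \<and>
        (\<forall>x. has_ddir (\<lambda>x. cutoff (l x / r) * X b x) b x (E b x))"
    proof (intro ballI conjI allI)
      fix b :: 'a and x assume b: "b \<in> Basis"
      show "continuous_on UNIV (\<lambda>x. cutoff (l x / r) * X b x)" by (intro continuous_intros cu cX b)
      show "continuous_on UNIV (E b)" unfolding E_def divide_inverse[of _ r]
        by (intro continuous_intros cX b cu[unfolded divide_inverse])
      show "has_ddir (\<lambda>x. cutoff (l x / r) * X b x) b x (E b x)"
        unfolding E_def l_def by (rule cutoff_mult_ddir) (use Y b in auto)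
    qed
    then have "integral\<^sup>L (lebesgue_on S) (\<lambda>x. \<Sum>b\<in>Basis. E b x) = 0"
      using cut[OF r] unfolding zero_net_flux_def l_def by blast
    moreover have "(\<Sum>b\<in>Basis. E b x) = G r x" for x
      unfolding E_def F_def G_def N_def by (simp add: sum.distrib sum_distrib_left algebra_simps)
    ultimately show ?thesis by simp
  qed
  define r where "r m = inverse (real (Suc m))" for m
  have r: "r m > 0" for m by (simp add: r_def)
  have r0: "r \<longlonglongrightarrow> 0" unfolding r_def by (rule LIMSEQ_inverse_real_of_nat)
  obtain B where B: "B \<ge> 1" "\<And>s. \<bar>cutoff s\<bar> \<le> B" "\<And>s. \<bar>cutoff' s\<bar> \<le> B"
    using cutoff_bound by blast
  have "(\<lambda>m. integral\<^sup>L (lebesgue_on S) (G (r m))) \<longlonglongrightarrow> integral\<^sup>L (lebesgue_on S) F"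
  proof (rule integral_dominated_convergence[where w="\<lambda>x. B * \<bar>F x\<bar> + 4 * B * C"])
    show "F \<in> borel_measurable (lebesgue_on S)" using int[OF cF] by (rule borel_measurable_integrable)
    show "G (r m) \<in> borel_measurable (lebesgue_on S)" for m using int[OF cG] by (rule borel_measurable_integrable)
    show "integrable (lebesgue_on S) (\<lambda>x. B * \<bar>F x\<bar> + 4 * B * C)"
      by (rule int) (intro continuous_intros cF)
    show "AE x in lebesgue_on S. norm (G (r m) x) \<le> B * \<bar>F x\<bar> + 4 * B * C" for m
    proof (rule AE_I2)
      fix x assume "x \<in> space (lebesgue_on S)"
      then have x: "x \<in> S" by (simp add: space_restrict_space)
      have "\<bar>cutoff' (l x / r m) / r m * N x\<bar> \<le> 4 * B * C"
      proof (cases "l x \<le> 4 * r m")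
        case True
        have "\<bar>N x\<bar> \<le> C * (4 * r m)" using X(2)[OF x] mult_left_mono[OF True X(1)] by (simp add: l_def N_def)
        then have "\<bar>cutoff' (l x / r m)\<bar> * \<bar>N x\<bar> \<le> B * (C * (4 * r m))"
          by (intro mult_mono B) (use B in auto)
        then show ?thesis using r[of m] by (simp add: abs_mult field_simps)
      next
        case False
        then show ?thesis using cutoff_eq_1(2)[of "l x / r m"] r[of m] B X by (simp add: field_simps)
      qed
      moreover have "\<bar>cutoff (l x / r m) * F x\<bar> \<le> B * \<bar>F x\<bar>"
        unfolding abs_mult by (intro mult_right_mono B) auto
      ultimately show "norm (G (r m) x) \<le> B * \<bar>F x\<bar> + 4 * B * C"
        unfolding G_def real_norm_def using abs_triangle_ineq order_trans add_mono by meson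
    qed
    show "AE x in lebesgue_on S. (\<lambda>m. G (r m) x) \<longlonglongrightarrow> F x"
    proof (rule AE_I2)
      fix x assume "x \<in> space (lebesgue_on S)"
      then have lx: "l x > 0" using S by (auto simp: l_def space_restrict_space)
      have "\<forall>\<^sub>F m in sequentially. r m < l x / 4" using order_tendstoD(2)[OF r0, of "l x / 4"] lx by simp
      then have "\<forall>\<^sub>F m in sequentially. G (r m) x = F x"
      proof (rule eventually_mono)
        fix m assume "r m < l x / 4"
        then have "l x / r m \<ge> 4" using r[of m] by (simp add: field_simps)
        then show "G (r m) x = F x" by (simp add: G_def cutoff_eq_1)
      qed
      then show "(\<lambda>m. G (r m) x) \<longlonglongrightarrow> F x" by (rule tendsto_eventually)
    qed
  qed
  then have "integral\<^sup>L (lebesgue_on S) F = 0" using eq[OF r] by (simp add: LIMSEQ_const_iff)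
  then show "integral\<^sup>L (lebesgue_on S) (\<lambda>x. \<Sum>b\<in>Basis. Y b x) = 0" by (simp add: F_def[abs_def])
qed

section \<open>The triangle\<close>

text \<open>A rotation taking n to the first axis puts the strip into the rectangle [d, d + s] x
  [-R, R], of area 2 R s.\<close>

lemma strip_area_bound_exists:
  fixes S :: "(real ^ 2) set"
  assumes S: "S \<in> sets lebesgue" "bounded S" "S \<subseteq> {x. n \<bullet> x > d}" and n: "norm n = 1"
  shows "\<exists>A. strip_area_bound S n d A"
proof -
  obtain R where R: "R > 0" "\<forall>x\<in>S. norm x \<le> R" using S(2) bounded_pos by blast
  have "norm (axis 1 1 :: real ^ 2) = 1" by simp
  then obtain f where f: "orthogonal_transformation f" "f n = (axis 1 1 :: real ^ 2)"
    using orthogonal_transformation_exists_1[OF n] by metis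
  have "measure lebesgue {x\<in>S. n \<bullet> x - d \<le> s} \<le> (2 * R) * s" if s: "s > 0" for s
  proof -
    let ?T = "{x\<in>S. n \<bullet> x - d \<le> s}"
    define a :: "real ^ 2" where "a = vector [d, - R]"
    define b :: "real ^ 2" where "b = vector [d + s, R]"
    have sub: "f ` ?T \<subseteq> cbox a b"
    proof
      fix y assume "y \<in> f ` ?T"
      then obtain x where x: "x \<in> S" "n \<bullet> x - d \<le> s" "y = f x" by auto
      have "y $ 1 = f x \<bullet> f n" using f x by (simp add: inner_axis)
      also have "\<dots> = n \<bullet> x" using f(1) by (simp add: orthogonal_transformation_def inner_commute)
      finally have 1: "y $ 1 = n \<bullet> x" .
      have "\<bar>y $ 2\<bar> \<le> norm y" by (rule component_le_norm_cart)
      also have "\<dots> = norm x" using x f(1) by (simp add: orthogonal_transformation_norm)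
      finally have "\<bar>y $ 2\<bar> \<le> R" using R x by force
      then show "y \<in> cbox a b" using 1 x S by (auto simp: mem_box_cart a_def b_def forall_2)
    qed
    have To: "{x. n \<bullet> x - d \<le> s} \<in> sets borel" by measurable
    then have Tm: "?T \<in> sets lebesgue" using S(1) by (auto simp: Collect_conj_eq Int_def[symmetric])
    have Tl: "?T \<in> lmeasurable" using Tm S by (intro bounded_set_imp_lmeasurable) (auto intro: bounded_subset)
    have "measure lebesgue ?T = measure lebesgue (f ` ?T)"
      using measure_orthogonal_image[OF f(1) Tl] by simp
    also have "\<dots> \<le> measure lebesgue (cbox a b)"
      using sub measurable_orthogonal_image[OF f(1) Tl] by (intro measure_mono_fmeasurable) (auto simp: fmeasurableD)
    also have "\<dots> = (2 * R) * s"
    proof -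
      have "a \<in> cbox a b" using s R by (simp add: mem_box_cart a_def b_def forall_2)
      then have "cbox a b \<noteq> {}" by blast
      then have "measure lborel (cbox a b) = prod (\<lambda>i. b $ i - a $ i) UNIV" by (rule content_cbox_cart)
      then show ?thesis by (simp add: UNIV_2 a_def b_def)
    qed
    finally show ?thesis .
  qed
  then show ?thesis unfolding strip_area_bound_def by blast
qed

text \<open>Inward unit normals of the horizontal leg, the hypotenuse and the vertical leg, whose
  lines have offsets 0, 0 and - (sqrt 3 / 2).\<close>

abbreviation side_normal1 :: "real ^ 2" where "side_normal1 \<equiv> vector [0, 1]"
abbreviation side_normal2 :: "real ^ 2" where "side_normal2 \<equiv> vector [1 / 2, - sqrt 3 / 2]"
abbreviation side_normal3 :: "real ^ 2" where "side_normal3 \<equiv> vector [-1, 0]"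

lemma inner_vec2: "(x::real ^ 2) \<bullet> y = x $ 1 * y $ 1 + x $ 2 * y $ 2"
  by (simp add: inner_vec_def UNIV_2)

lemma side_normal_norm: "norm side_normal1 = 1" "norm side_normal2 = 1" "norm side_normal3 = 1"
  by (simp_all add: norm_eq_sqrt_inner inner_vec2 power2_eq_square[symmetric] power_divide)

lemma triangle_hull:
  "convex hull {vector [0, 0], vector [sqrt 3 / 2, 0], vector [sqrt 3 / 2, 1 / 2]} =
   {x. side_normal1 \<bullet> x \<ge> 0} \<inter> {x. side_normal2 \<bullet> x \<ge> 0} \<inter> {x. side_normal3 \<bullet> x \<ge> - (sqrt 3 / 2)}" (is "?H = ?R")
proof (intro equalityI subsetI)
  fix x assume "x \<in> ?H"
  then obtain u v w where *: "0 \<le> u" "0 \<le> v" "0 \<le> w" "u + v + w = 1"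
    "x = u *\<^sub>R vector [0, 0] + v *\<^sub>R vector [sqrt 3 / 2, 0] + w *\<^sub>R vector [sqrt 3 / 2, 1 / 2]"
    unfolding convex_hull_3 by blast
  have x: "x $ 1 = (v + w) * (sqrt 3 / 2)" "x $ 2 = w / 2" using * by (auto simp: algebra_simps)
  have "(v + w) * sqrt 3 \<le> 1 * sqrt 3" by (rule mult_right_mono) (use * in auto)
  then have "v * sqrt 3 + w * sqrt 3 \<le> sqrt 3" by (simp add: algebra_simps)
  moreover have "w * sqrt 3 \<le> (v + w) * sqrt 3" by (rule mult_right_mono) (use * in auto)
  ultimately show "x \<in> ?R" using * by (simp add: inner_vec2 x algebra_simps)
next
  fix x assume "x \<in> ?R"
  then have x: "x $ 2 \<ge> 0" "x $ 1 \<ge> sqrt 3 * x $ 2" "x $ 1 \<le> sqrt 3 / 2" by (auto simp: inner_vec2)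
  \<comment> \<open>Barycentric coordinates solved from the two components: only the third vertex
    has nonzero height, namely 1/2.\<close>
  define w where "w = 2 * x $ 2"
  define v where "v = 2 * x $ 1 / sqrt 3 - w"
  define u where "u = 1 - v - w"
  have "u \<ge> 0" "v \<ge> 0" "w \<ge> 0" "u + v + w = 1" using x by (auto simp: u_def v_def w_def field_simps)
  moreover have "x = u *\<^sub>R vector [0, 0] + v *\<^sub>R vector [sqrt 3 / 2, 0] + w *\<^sub>R vector [sqrt 3 / 2, 1 / 2]"
    by (simp add: vec_eq_iff forall_2 v_def w_def field_simps)
  ultimately show "x \<in> ?H" unfolding convex_hull_3 by blast
qed

lemma triangle_eq:
  "triangle_30_60_90 = {x. side_normal1 \<bullet> x > 0} \<inter> {x. side_normal2 \<bullet> x > 0} \<inter> {x. side_normal3 \<bullet> x > - (sqrt 3 / 2)}"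
proof -
  have nz: "side_normal1 \<noteq> 0" "side_normal2 \<noteq> 0" "side_normal3 \<noteq> 0" using side_normal_norm by auto
  show ?thesis unfolding triangle_30_60_90_def triangle_hull
    by (simp only: interior_Int interior_halfspace_ge[OF nz(1)] interior_halfspace_ge[OF nz(2)] interior_halfspace_ge[OF nz(3)])
qed

lemma mem_triangle: "x \<in> triangle_30_60_90 \<longleftrightarrow> x $ 2 > 0 \<and> x $ 1 > sqrt 3 * x $ 2 \<and> x $ 1 < sqrt 3 / 2"
  by (auto simp: triangle_eq inner_vec2)

lemma open_triangle: "open triangle_30_60_90" by (simp add: triangle_30_60_90_def)

lemma closed_triangle_hull: "closed (convex hull {vector [0, 0], vector [sqrt 3 / 2, 0], vector [sqrt 3 / 2, 1 / 2] :: real ^ 2})"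
  by (intro compact_imp_closed compact_convex_hull) auto

lemma bounded_triangle: "bounded triangle_30_60_90"
  unfolding triangle_30_60_90_def by (intro bounded_interior bounded_convex_hull) auto

lemma closure_triangle: "x \<in> closure triangle_30_60_90 \<Longrightarrow> x $ 2 \<ge> 0 \<and> x $ 1 \<ge> sqrt 3 * x $ 2 \<and> x $ 1 \<le> sqrt 3 / 2"
proof -
  assume "x \<in> closure triangle_30_60_90"
  then have "x \<in> convex hull {vector [0, 0], vector [sqrt 3 / 2, 0], vector [sqrt 3 / 2, 1 / 2]}"
    using closure_minimal[OF interior_subset closed_triangle_hull] by (auto simp: triangle_30_60_90_def)
  then show ?thesis by (auto simp: triangle_hull inner_vec2)
qed

lemma triangle_halfplanes: "triangle_30_60_90 \<subseteq> {x. side_normal1 \<bullet> x > 0}"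
  "triangle_30_60_90 \<subseteq> {x. side_normal2 \<bullet> x > 0}"
  "triangle_30_60_90 \<subseteq> {x. side_normal3 \<bullet> x > - (sqrt 3 / 2)}"
  by (auto simp: triangle_eq)

text \<open>Off \<open>K\<close> at least one of the cutoffs of widths r1, r2, r3 vanishes, because
  \<open>cutoff\<close> is 0 up to 1; so their product has compact support in the triangle.\<close>

lemma triangle_core_compact:
  assumes "r1 > 0" "r2 > 0" "r3 > 0"
  defines "K \<equiv> {x. side_normal1 \<bullet> x \<ge> r1} \<inter> {x. side_normal2 \<bullet> x \<ge> r2} \<inter> {x. side_normal3 \<bullet> x \<ge> r3 - sqrt 3 / 2}"
  shows "compact K" "K \<subseteq> triangle_30_60_90"
proof -
  show "K \<subseteq> triangle_30_60_90" using assms by (auto simp: triangle_eq)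
  then have "bounded K" using bounded_triangle bounded_subset by blast
  moreover have "closed K" unfolding K_def by (intro closed_Int closed_halfspace_ge)
  ultimately show "compact K" by (simp add: compact_eq_bounded_closed)
qed

text \<open>With all three cutoffs present the support is compact. They are then removed one by one:
  the remaining factor still vanishes linearly at the side concerned, its constant growing by a
  factor B for each cutoff it carries. No separate estimate at the vertices arises.\<close>

lemma triangle_weak_eigen:
  assumes e: "C2_on triangle_30_60_90 e" "\<And>x. x \<in> triangle_30_60_90 \<Longrightarrow> laplacian e x = - of_real \<nu> * e x"
    "continuous_on (closure triangle_30_60_90) e" "\<forall>x\<in>frontier triangle_30_60_90. e x = 0"
    and \<phi>: "C \<ge> 0" "\<And>x. x \<in> triangle_30_60_90 \<Longrightarrow> \<bar>\<phi> x\<bar> \<le> C * (side_normal1 \<bullet> x)"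
     "\<And>x. x \<in> triangle_30_60_90 \<Longrightarrow> \<bar>\<phi> x\<bar> \<le> C * (side_normal2 \<bullet> x)"
     "\<And>x. x \<in> triangle_30_60_90 \<Longrightarrow> \<bar>\<phi> x\<bar> \<le> C * (side_normal3 \<bullet> x + sqrt 3 / 2)"
  shows "weak_eigen triangle_30_60_90 e \<nu> \<phi>"
proof -
  let ?S = triangle_30_60_90
  obtain B where B: "B \<ge> 1" "\<And>s. \<bar>cutoff s\<bar> \<le> B" using cutoff_bound by blast
  have B0: "B * C \<ge> 0" using B \<phi> by simp
  have Sm: "?S \<in> sets lebesgue" using open_triangle by simp
  have cb: "\<bar>cutoff s * y\<bar> \<le> (B * D) * L" if "\<bar>y\<bar> \<le> D * L" for s y D L :: real
    using mult_mono[OF B(2)[of s] that] B by (simp add: abs_mult mult.assoc)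
  note rem = weak_eigen_remove_cutoff[OF open_triangle bounded_triangle _ _ _ e(3,4)]
  obtain A1 A2 A3 where A: "strip_area_bound ?S side_normal1 0 A1" "strip_area_bound ?S side_normal2 0 A2" "strip_area_bound ?S side_normal3 (- (sqrt 3 / 2)) A3"
    using strip_area_bound_exists[OF Sm bounded_triangle triangle_halfplanes(1) side_normal_norm(1)]
      strip_area_bound_exists[OF Sm bounded_triangle triangle_halfplanes(2) side_normal_norm(2)]
      strip_area_bound_exists[OF Sm bounded_triangle triangle_halfplanes(3) side_normal_norm(3)] by blast
  show ?thesis
  proof (rule rem[OF triangle_halfplanes(1) side_normal_norm(1) A(1) \<phi>(1)])
    show "\<bar>\<phi> x\<bar> \<le> C * (side_normal1 \<bullet> x - 0)" if "x \<in> ?S" for x using \<phi>(2)[OF that] by simp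
    fix r1 :: real assume r1: "r1 > 0"
    show "weak_eigen ?S e \<nu> (\<lambda>x. cutoff ((side_normal1 \<bullet> x - 0) / r1) * \<phi> x)"
    proof (rule rem[OF triangle_halfplanes(2) side_normal_norm(2) A(2) B0])
      show "\<bar>cutoff ((side_normal1 \<bullet> x - 0) / r1) * \<phi> x\<bar> \<le> B * C * (side_normal2 \<bullet> x - 0)" if "x \<in> ?S" for x
        using cb[OF \<phi>(3)[OF that]] by simp
      fix r2 :: real assume r2: "r2 > 0"
      show "weak_eigen ?S e \<nu> (\<lambda>x. cutoff ((side_normal2 \<bullet> x - 0) / r2) * (cutoff ((side_normal1 \<bullet> x - 0) / r1) * \<phi> x))"
      proof (rule rem[OF triangle_halfplanes(3) side_normal_norm(3) A(3)])
        show "B * (B * C) \<ge> 0" using B B0 by simp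
        show "\<bar>cutoff ((side_normal2 \<bullet> x - 0) / r2) * (cutoff ((side_normal1 \<bullet> x - 0) / r1) * \<phi> x)\<bar> \<le> B * (B * C) * (side_normal3 \<bullet> x - - (sqrt 3 / 2))" if "x \<in> ?S" for x
          using cb[OF cb[OF \<phi>(4)[OF that]]] by simp
        fix r3 :: real assume r3: "r3 > 0"
        show "weak_eigen ?S e \<nu> (\<lambda>x. cutoff ((side_normal3 \<bullet> x - - (sqrt 3 / 2)) / r3) * (cutoff ((side_normal2 \<bullet> x - 0) / r2) * (cutoff ((side_normal1 \<bullet> x - 0) / r1) * \<phi> x)))"
        proof (rule weak_eigen_compact_support[OF open_triangle e(1,2) triangle_core_compact[OF r1 r2 r3]])
          fix x assume "x \<notin> {x. side_normal1 \<bullet> x \<ge> r1} \<inter> {x. side_normal2 \<bullet> x \<ge> r2} \<inter> {x. side_normal3 \<bullet> x \<ge> r3 - sqrt 3 / 2}"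
          then have "(side_normal1 \<bullet> x - 0) / r1 \<le> 1 \<or> (side_normal2 \<bullet> x - 0) / r2 \<le> 1 \<or> (side_normal3 \<bullet> x - - (sqrt 3 / 2)) / r3 \<le> 1"
            using r1 r2 r3 by (auto simp: divide_le_eq_1)
          then show "cutoff ((side_normal3 \<bullet> x - - (sqrt 3 / 2)) / r3) * (cutoff ((side_normal2 \<bullet> x - 0) / r2) * (cutoff ((side_normal1 \<bullet> x - 0) / r1) * \<phi> x)) = 0"
            using cutoff_eq_0(1) by (metis mult_zero_left mult_zero_right)
        qed auto
      qed
    qed
  qed
qed

text \<open>The same nested removal. A cutoff multiplies all components of \<open>X\<close> alike,
  hence also each normal component, whose linear vanishing at the other sides persists.\<close>

lemma triangle_zero_net_flux:
  fixes X :: "real ^ 2 \<Rightarrow> real ^ 2 \<Rightarrow> real"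
  assumes X: "C \<ge> 0" "\<And>x. x \<in> triangle_30_60_90 \<Longrightarrow> \<bar>\<Sum>b\<in>Basis. (side_normal1 \<bullet> b) * X b x\<bar> \<le> C * (side_normal1 \<bullet> x)"
     "\<And>x. x \<in> triangle_30_60_90 \<Longrightarrow> \<bar>\<Sum>b\<in>Basis. (side_normal2 \<bullet> b) * X b x\<bar> \<le> C * (side_normal2 \<bullet> x)"
     "\<And>x. x \<in> triangle_30_60_90 \<Longrightarrow> \<bar>\<Sum>b\<in>Basis. (side_normal3 \<bullet> b) * X b x\<bar> \<le> C * (side_normal3 \<bullet> x + sqrt 3 / 2)"
  shows "zero_net_flux triangle_30_60_90 X"
proof -
  let ?S = triangle_30_60_90
  obtain B where B: "B \<ge> 1" "\<And>s. \<bar>cutoff s\<bar> \<le> B" using cutoff_bound by blast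
  have B0: "B * C \<ge> 0" using B X by simp
  have cb: "\<bar>\<Sum>b\<in>Basis. (n \<bullet> b) * (cutoff s * Z b x)\<bar> \<le> (B * D) * L" if "\<bar>\<Sum>b\<in>Basis. (n \<bullet> b) * Z b x\<bar> \<le> D * L" for s D L :: real and n x :: "real ^ 2" and Z
  proof -
    have "(\<Sum>b\<in>Basis. (n \<bullet> b) * (cutoff s * Z b x)) = cutoff s * (\<Sum>b\<in>Basis. (n \<bullet> b) * Z b x)"
      by (simp add: sum_distrib_left mult_ac)
    then show ?thesis using mult_mono[OF B(2)[of s] that] B by (simp add: abs_mult mult.assoc)
  qed
  note rem = zero_net_flux_remove_cutoff[OF open_triangle bounded_triangle]
  show ?thesis
  proof (rule rem[OF triangle_halfplanes(1) X(1)])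
    show "\<bar>\<Sum>b\<in>Basis. (side_normal1 \<bullet> b) * X b x\<bar> \<le> C * (side_normal1 \<bullet> x - 0)" if "x \<in> ?S" for x using X(2)[OF that] by simp
    fix r1 :: real assume r1: "r1 > 0"
    show "zero_net_flux ?S (\<lambda>b x. cutoff ((side_normal1 \<bullet> x - 0) / r1) * X b x)"
    proof (rule rem[OF triangle_halfplanes(2) B0])
      show "\<bar>\<Sum>b\<in>Basis. (side_normal2 \<bullet> b) * (cutoff ((side_normal1 \<bullet> x - 0) / r1) * X b x)\<bar> \<le> B * C * (side_normal2 \<bullet> x - 0)" if "x \<in> ?S" for x
        using cb[where Z=X and n=side_normal2 and D=C and L="side_normal2 \<bullet> x" and x=x, OF X(3)[OF that]] by simp
      fix r2 :: real assume r2: "r2 > 0"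
      show "zero_net_flux ?S (\<lambda>b x. cutoff ((side_normal2 \<bullet> x - 0) / r2) * (cutoff ((side_normal1 \<bullet> x - 0) / r1) * X b x))"
      proof (rule rem[OF triangle_halfplanes(3)])
        show "B * (B * C) \<ge> 0" using B B0 by simp
        show "\<bar>\<Sum>b\<in>Basis. (side_normal3 \<bullet> b) * (cutoff ((side_normal2 \<bullet> x - 0) / r2) * (cutoff ((side_normal1 \<bullet> x - 0) / r1) * X b x))\<bar> \<le> B * (B * C) * (side_normal3 \<bullet> x - - (sqrt 3 / 2))" if "x \<in> ?S" for x
          using cb[where Z="\<lambda>b x. cutoff ((side_normal1 \<bullet> x - 0) / r1) * X b x" and n=side_normal3 and D="B * C" and L="side_normal3 \<bullet> x + sqrt 3 / 2" and x=x,
              OF cb[where Z=X and n=side_normal3 and D=C and L="side_normal3 \<bullet> x + sqrt 3 / 2" and x=x, OF X(4)[OF that]]] by simp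
        fix r3 :: real assume r3: "r3 > 0"
        show "zero_net_flux ?S (\<lambda>b x. cutoff ((side_normal3 \<bullet> x - - (sqrt 3 / 2)) / r3) * (cutoff ((side_normal2 \<bullet> x - 0) / r2) * (cutoff ((side_normal1 \<bullet> x - 0) / r1) * X b x)))"
        proof (rule zero_net_flux_compact_support[OF open_triangle triangle_core_compact[OF r1 r2 r3]])
          fix b x assume "x \<notin> {x. side_normal1 \<bullet> x \<ge> r1} \<inter> {x. side_normal2 \<bullet> x \<ge> r2} \<inter> {x. side_normal3 \<bullet> x \<ge> r3 - sqrt 3 / 2}"
          then have "(side_normal1 \<bullet> x - 0) / r1 \<le> 1 \<or> (side_normal2 \<bullet> x - 0) / r2 \<le> 1 \<or> (side_normal3 \<bullet> x - - (sqrt 3 / 2)) / r3 \<le> 1"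
            using r1 r2 r3 by (auto simp: divide_le_eq_1)
          then show "cutoff ((side_normal3 \<bullet> x - - (sqrt 3 / 2)) / r3) * (cutoff ((side_normal2 \<bullet> x - 0) / r2) * (cutoff ((side_normal1 \<bullet> x - 0) / r1) * X b x)) = 0"
            using cutoff_eq_0(1) by (metis mult_zero_left mult_zero_right)
        qed
      qed
    qed
  qed
qed

section \<open>Alternating and symmetric cosine polynomials\<close>

text \<open>Finite linear combinations as an inductive predicate, so that properties are proved one
  term at a time. The scalars are generic because real cosines and complex modes both occur.\<close>

inductive lincomb :: "('i \<Rightarrow> 'a \<Rightarrow> 's::comm_ring_1) \<Rightarrow> 'i set \<Rightarrow> ('a \<Rightarrow> 's) \<Rightarrow> bool" for F I where
  zero: "lincomb F I (\<lambda>x. 0)"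
| add_term: "lincomb F I f \<Longrightarrow> i \<in> I \<Longrightarrow> lincomb F I (\<lambda>x. f x + c * F i x)"

lemma lincomb_scaled_term: "i \<in> I \<Longrightarrow> lincomb F I (\<lambda>x. c * F i x)"
  using lincomb.add_term[OF lincomb.zero] by simp

lemma lincomb_term: "i \<in> I \<Longrightarrow> lincomb F I (F i)"
  using lincomb_scaled_term[of i I F 1] by simp

lemma lincomb_add:
  assumes "lincomb F I f" "lincomb F I g" shows "lincomb F I (\<lambda>x. f x + g x)"
  using assms(2)
proof induction
  case (add_term g i c)
  then have "lincomb F I (\<lambda>x. (f x + g x) + c * F i x)" by (intro lincomb.add_term)
  then show ?case by (simp add: add.assoc)
qed (simp add: assms)

lemma lincomb_scale: "lincomb F I f \<Longrightarrow> lincomb F I (\<lambda>x. d * f x)"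
proof (induction rule: lincomb.induct)
  case (add_term f i c)
  then have "lincomb F I (\<lambda>x. d * f x + (d * c) * F i x)" by (intro lincomb.add_term)
  then show ?case by (simp add: algebra_simps)
qed (simp add: lincomb.zero)

lemma lincomb_diff: "lincomb F I f \<Longrightarrow> lincomb F I g \<Longrightarrow> lincomb F I (\<lambda>x. f x - g x)"
  using lincomb_add[of F I f "\<lambda>x. -1 * g x"] lincomb_scale[of F I g "-1"] by simp

lemma lincomb_trans:
  assumes "lincomb F I f" "\<And>i. i \<in> I \<Longrightarrow> lincomb G J (F i)" shows "lincomb G J f"
  using assms(1)
proof induction
  case (add_term f i c)
  show ?case by (rule lincomb_add[OF add_term.IH lincomb_scale[OF assms(2)[OF add_term.hyps(2)]]])
qed (rule lincomb.zero)

lemma lincomb_mono: "lincomb F I f \<Longrightarrow> I \<subseteq> J \<Longrightarrow> lincomb F J f"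
  by (erule lincomb_trans) (auto intro: lincomb_term)

text \<open>Serves to separate modes of one eigenvalue from the others, and modes of one sign kind
  from the other.\<close>

lemma lincomb_split:
  assumes "lincomb F I f"
  obtains g h where "lincomb F (I \<inter> A) g" "lincomb F (I - A) h" "f = (\<lambda>x. g x + h x)"
proof -
  have "\<exists>g h. lincomb F (I \<inter> A) g \<and> lincomb F (I - A) h \<and> f = (\<lambda>x. g x + h x)"
    using assms
  proof (induction rule: lincomb.induct)
    case zero
    show ?case by (rule exI[of _ "\<lambda>x. 0"], rule exI[of _ "\<lambda>x. 0"]) (simp add: lincomb.zero)
  next
    case (add_term f i c)
    then obtain g h where gh: "lincomb F (I \<inter> A) g" "lincomb F (I - A) h" "f = (\<lambda>x. g x + h x)" by blast
    show ?case
    proof (cases "i \<in> A")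
      case True
      then have "lincomb F (I \<inter> A) (\<lambda>x. g x + c * F i x)" using gh add_term by (intro lincomb.add_term) auto
      then show ?thesis using gh by (intro exI[of _ "\<lambda>x. g x + c * F i x"] exI[of _ h]) (auto simp: algebra_simps)
    next
      case False
      then have "lincomb F (I - A) (\<lambda>x. h x + c * F i x)" using gh add_term by (intro lincomb.add_term) auto
      then show ?thesis using gh by (intro exI[of _ g] exI[of _ "\<lambda>x. h x + c * F i x"]) (auto simp: algebra_simps)
    qed
  qed
  then show ?thesis using that by blast
qed

lemma lincomb_linear_image:
  assumes "lincomb F I f" "T (\<lambda>x. 0) = (\<lambda>x. 0)" "\<And>f g c. T (\<lambda>x. f x + c * g x) = (\<lambda>x. T f x + c * T g x)"
  shows "lincomb (\<lambda>i. T (F i)) I (T f)"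
  using assms(1) by induction (auto simp: assms(2,3) intro: lincomb.intros)

text \<open>In the coordinates \<open>(a, c)\<close> the torus is \<open>\<real>\<^sup>2\<close> modulo \<open>2\<pi>\<close> in each variable. Up to the central
  inversion, under which cosines are invariant, the dihedral group acts by permuting
  \<open>a\<close>, \<open>c\<close> and \<open>- a - c\<close>.\<close>

definition cosf :: "int \<times> int \<Rightarrow> real \<times> real \<Rightarrow> real" where
  "cosf k z = cos (of_int (fst k) * fst z + of_int (snd k) * snd z)"

definition sinf :: "int \<times> int \<Rightarrow> real \<times> real \<Rightarrow> real" where
  "sinf k z = sin (of_int (fst k) * fst z + of_int (snd k) * snd z)"

text \<open>The six permutations of a, c, - a - c, each with its parity. Parity is also the
  determinant of the corresponding linear map of the plane.\<close>

definition alternation :: "(real \<times> real \<Rightarrow> real) \<Rightarrow> real \<times> real \<Rightarrow> real" where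
  "alternation f = (\<lambda>(a, c). f (a, c) - f (c, a) - f (a, - a - c) - f (- a - c, c) + f (c, - a - c) + f (- a - c, a))"

definition symmetrization :: "(real \<times> real \<Rightarrow> real) \<Rightarrow> real \<times> real \<Rightarrow> real" where
  "symmetrization f = (\<lambda>(a, c). f (a, c) + f (c, a) + f (a, - a - c) + f (- a - c, c) + f (c, - a - c) + f (- a - c, a))"

lemma cosf_mult: "cosf k z * cosf l z = 1/2 * cosf (k + l) z + 1/2 * cosf (k - l) z"
  and sinf_mult: "sinf k z * sinf l z = 1/2 * cosf (k - l) z - 1/2 * cosf (k + l) z"
proof -
  define u where "u k = of_int (fst k) * fst z + of_int (snd k) * snd z" for k :: "int \<times> int"
  have "u (k + l) = u k + u l" "u (k - l) = u k - u l" by (simp_all add: u_def algebra_simps)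
  moreover have "cosf k z = cos (u k)" "sinf k z = sin (u k)" for k by (simp_all add: cosf_def sinf_def u_def)
  ultimately show "cosf k z * cosf l z = 1/2 * cosf (k + l) z + 1/2 * cosf (k - l) z"
    "sinf k z * sinf l z = 1/2 * cosf (k - l) z - 1/2 * cosf (k + l) z"
    by (simp_all add: cos_add cos_diff add_divide_distrib diff_divide_distrib)
qed

text \<open>The index set \<open>C\<close> is tracked because orthogonality of modes will rest on a
  product having no term of frequency 0.\<close>

lemma lincomb_cosf_mult:
  assumes "lincomb cosf A f" "lincomb cosf B g" "\<And>a b. a \<in> A \<Longrightarrow> b \<in> B \<Longrightarrow> a + b \<in> C \<and> a - b \<in> C"
  shows "lincomb cosf C (\<lambda>z. f z * g z)"
  using assms(1)
proof induction
  case zero show ?case by (simp add: lincomb.zero)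
next
  case (add_term f i c)
  have "lincomb cosf C (\<lambda>z. cosf i z * g z)"
    using assms(2)
  proof induction
    case zero show ?case by (simp add: lincomb.zero)
  next
    case (add_term g j d)
    have "lincomb cosf C (\<lambda>z. d * (1/2 * cosf (i + j) z + 1/2 * cosf (i - j) z))"
      using assms(3)[OF \<open>i \<in> A\<close> \<open>j \<in> B\<close>] by (intro lincomb_scale lincomb_add lincomb_scaled_term) auto
    then have "lincomb cosf C (\<lambda>z. cosf i z * g z + d * (cosf i z * cosf j z))"
      unfolding cosf_mult using add_term.IH by (intro lincomb_add)
    then show ?case by (simp add: algebra_simps)
  qed
  then have "lincomb cosf C (\<lambda>z. f z * g z + c * (cosf i z * g z))"
    using add_term.IH by (intro lincomb_add lincomb_scale)
  then show ?case by (simp add: algebra_simps)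
qed

text \<open>The two transpositions tested here generate all permutations of a, c, - a - c.\<close>

definition alternating :: "(real \<times> real \<Rightarrow> real) \<Rightarrow> bool" where
  "alternating f \<longleftrightarrow> (\<forall>a c. f (c, a) = - f (a, c) \<and> f (a, - a - c) = - f (a, c))"

definition symmetric :: "(real \<times> real \<Rightarrow> real) \<Rightarrow> bool" where
  "symmetric f \<longleftrightarrow> (\<forall>a c. f (c, a) = f (a, c) \<and> f (a, - a - c) = f (a, c))"

lemma alternating_alternation: "alternating (alternation f)"
  by (simp add: alternating_def alternation_def minus_diff_commute)

lemma symmetric_symmetrization: "symmetric (symmetrization f)"
  by (simp add: symmetric_def symmetrization_def minus_diff_commute)

lemma alternation_of_alternating:
  assumes "alternating f" shows "alternation f z = 6 * f z"
proof -
  obtain a c where z: "z = (a, c)" by force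
  have s: "f (y, x) = - f (x, y)" "f (x, - x - y) = - f (x, y)" for x y using assms unfolding alternating_def by blast+
  have 1: "f (c, - a - c) = f (a, c)" using s(2)[of c a, unfolded minus_diff_commute[of c a]] s(1)[of a c] by linarith
  show ?thesis unfolding z alternation_def prod.case
    using s(1)[of c a] s(2)[of a c] s(1)[of "- a - c" c] s(1)[of "- a - c" a] 1 by linarith
qed

lemma symmetrization_of_symmetric:
  assumes "symmetric f" shows "symmetrization f z = 6 * f z"
proof -
  obtain a c where z: "z = (a, c)" by force
  have s: "f (y, x) = f (x, y)" "f (x, - x - y) = f (x, y)" for x y using assms unfolding symmetric_def by blast+
  have 1: "f (c, - a - c) = f (a, c)" using s(2)[of c a, unfolded minus_diff_commute[of c a]] s(1)[of a c] by linarith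
  show ?thesis unfolding z symmetrization_def prod.case
    using s(1)[of c a] s(2)[of a c] s(1)[of "- a - c" c] s(1)[of "- a - c" a] 1 by linarith
qed

text \<open>One sixth of \<open>alternation\<close> fixes an alternating function and turns each
  cosine in it into a mode with the same index.\<close>

lemma lincomb_alternating:
  assumes "lincomb cosf I f" "alternating f"
  shows "lincomb (\<lambda>k. alternation (cosf k)) I f"
proof -
  have "lincomb (\<lambda>k. alternation (cosf k)) I (alternation f)"
    by (rule lincomb_linear_image[OF assms(1)]) (auto simp: alternation_def fun_eq_iff algebra_simps)
  then have "lincomb (\<lambda>k. alternation (cosf k)) I (\<lambda>z. 1/6 * alternation f z)" by (rule lincomb_scale)
  then show ?thesis using alternation_of_alternating[OF assms(2)] by simp
qed

lemma lincomb_symmetric: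
  assumes "lincomb cosf I f" "symmetric f"
  shows "lincomb (\<lambda>k. symmetrization (cosf k)) I f"
proof -
  have "lincomb (\<lambda>k. symmetrization (cosf k)) I (symmetrization f)"
    by (rule lincomb_linear_image[OF assms(1)]) (auto simp: symmetrization_def fun_eq_iff algebra_simps)
  then have "lincomb (\<lambda>k. symmetrization (cosf k)) I (\<lambda>z. 1/6 * symmetrization f z)" by (rule lincomb_scale)
  then show ?thesis using symmetrization_of_symmetric[OF assms(2)] by simp
qed

definition freq_orbit :: "int \<times> int \<Rightarrow> (int \<times> int) set" where
  "freq_orbit = (\<lambda>(m, n). {(m, n), (n, m), (m - n, - n), (- m, n - m), (- n, m - n), (n - m, - m)})"

lemma alt_cosf: "alternation (cosf (m, n)) z = cosf (m, n) z - cosf (n, m) z - cosf (m - n, - n) z - cosf (- m, n - m) z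
    + cosf (- n, m - n) z + cosf (n - m, - m) z"
  by (cases z) (simp add: alternation_def cosf_def algebra_simps)

lemma sym_cosf: "symmetrization (cosf (m, n)) z = cosf (m, n) z + cosf (n, m) z + cosf (m - n, - n) z + cosf (- m, n - m) z
    + cosf (- n, m - n) z + cosf (n - m, - m) z"
  by (cases z) (simp add: symmetrization_def cosf_def algebra_simps)

lemma lincomb_alt_cosf: "lincomb cosf (freq_orbit k) (alternation (cosf k))"
proof -
  obtain m n where k: "k = (m, n)" by force
  have "alternation (cosf k) = (\<lambda>z. cosf (m, n) z - cosf (n, m) z - cosf (m - n, - n) z - cosf (- m, n - m) z
    + cosf (- n, m - n) z + cosf (n - m, - m) z)" by (simp add: k alt_cosf fun_eq_iff)
  then show ?thesis by (simp only:) (intro lincomb_add lincomb_diff lincomb_term; simp add: freq_orbit_def k)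
qed

lemma lincomb_sym_cosf: "lincomb cosf (freq_orbit k) (symmetrization (cosf k))"
proof -
  obtain m n where k: "k = (m, n)" by force
  have "symmetrization (cosf k) = (\<lambda>z. cosf (m, n) z + cosf (n, m) z + cosf (m - n, - n) z + cosf (- m, n - m) z
    + cosf (- n, m - n) z + cosf (n - m, - m) z)" by (simp add: k sym_cosf fun_eq_iff)
  then show ?thesis by (simp only:) (intro lincomb_add lincomb_diff lincomb_term; simp add: freq_orbit_def k)
qed

lemma cosf_uminus: "cosf (- k) z = cosf k z"
  using cos_minus[of "of_int (fst k) * fst z + of_int (snd k) * snd z"] by (simp add: cosf_def)

lemma alt_cosf_uminus: "alternation (cosf (- k)) = alternation (cosf k)"
  unfolding alternation_def cosf_uminus by simp

text \<open>Another starting frequency in the orbit permutes the six terms and multiplies their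
  signs by a common parity. So whether a mode has equal or opposite values at two points depends on
  the orbit alone.\<close>

lemma alt_cosf_orbit:
  assumes "l \<in> freq_orbit k"
  shows "(\<forall>z. alternation (cosf l) z = alternation (cosf k) z) \<or> (\<forall>z. alternation (cosf l) z = - alternation (cosf k) z)"
proof -
  obtain m n where k: "k = (m, n)" by force
  have "cosf (- i, - j) z = cosf (i, j) z" for i j z using cosf_uminus[of "(i, j)"] by simp
  from this[of "m - n" "-n"] this[of "-m" "n - m"] this[of "- n" "m - n"] this[of "n - m" "- m"] this[of n "n-m"]
  show ?thesis using assms unfolding k freq_orbit_def by (auto simp: alt_cosf)
qed

text \<open>With \<open>S = cis a + cis c + cis (- a - c)\<close>, the functions \<open>trace_im\<close>, \<open>trace_re\<close> and \<open>trace_mod\<close>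
  below are \<open>Im S\<close>, \<open>Re S\<close> and \<open>(|S|\<^sup>2 - 3) / 2\<close>.\<close>

definition trace_im :: "real \<Rightarrow> real \<Rightarrow> real" where "trace_im a c = sin a + sin c - sin (a + c)"

text \<open>The product form exposes zero lines and signs. At doubled angles it is a polynomial
  identity in the sines and cosines.\<close>

lemma trace_im_eq: "trace_im a c = 4 * sin (a / 2) * sin (c / 2) * sin ((a + c) / 2)"
proof -
  have "trace_im (2 * p) (2 * q) = 4 * sin p * sin q * sin (p + q)" for p q
  proof -
    have *: "2 * p + 2 * q = 2 * (p + q)" by simp
    have "sin p ^ 2 = 1 - cos p ^ 2" "sin q ^ 2 = 1 - cos q ^ 2" by (simp_all add: sin_squared_eq)
    then show ?thesis unfolding trace_im_def * sin_double sin_add cos_add by algebra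
  qed
  from this[of "a / 2" "c / 2"] show ?thesis by (simp add: add_divide_distrib)
qed

text \<open>By \<open>trace_im_eq\<close> this is 16 times the product of the sines of half the
  positive roots of G2: a, c, a + c (short) and c - a, 2 a + c, a + 2 c (long).\<close>

definition weyl_denom :: "real \<times> real \<Rightarrow> real" where
  "weyl_denom = (\<lambda>(a, c). trace_im a c * trace_im (c - a) (2 * a + c))"

text \<open>The factor from the short roots is invariant under permutations, while the one from the
  long roots changes sign under each transposition.\<close>

lemma alternating_weyl_denom: "alternating weyl_denom"
proof -
  have "trace_im c a = trace_im a c" for a c by (simp add: trace_im_def add.commute)
  moreover have "trace_im a (- a - c) = trace_im a c" for a c
    using sin_minus[of "a + c"] by (simp add: trace_im_def)
  moreover have "trace_im (a - c) (2 * c + a) = - trace_im (c - a) (2 * a + c)" for a c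
    using sin_minus[of "c - a"] by (simp add: trace_im_def algebra_simps)
  moreover have "trace_im (- a - c - a) (2 * a + (- a - c)) = - trace_im (c - a) (2 * a + c)" for a c
    using sin_minus[of "c - a"] sin_minus[of "2 * a + c"] sin_minus[of "a + 2 * c"] by (simp add: trace_im_def algebra_simps)
  ultimately have "weyl_denom (c, a) = - weyl_denom (a, c)" "weyl_denom (a, - a - c) = - weyl_denom (a, c)" for a c
    unfolding weyl_denom_def prod.case by (metis mult_minus_right)+
  then show ?thesis unfolding alternating_def by blast
qed

text \<open>Both factors are sums of sines, and a product of two sines is a difference of
  cosines.\<close>

lemma lincomb_weyl_denom: "lincomb cosf UNIV weyl_denom"
proof -
  have *: "lincomb cosf UNIV (\<lambda>z. sinf k z * sinf l z)" for k l
    unfolding sinf_mult by (intro lincomb_diff lincomb_scaled_term UNIV_I)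
  have "lincomb cosf UNIV (\<lambda>z.
     (sinf (1,0) z * sinf (-1,1) z + sinf (1,0) z * sinf (2,1) z - sinf (1,0) z * sinf (1,2) z) +
     (sinf (0,1) z * sinf (-1,1) z + sinf (0,1) z * sinf (2,1) z - sinf (0,1) z * sinf (1,2) z) -
     (sinf (1,1) z * sinf (-1,1) z + sinf (1,1) z * sinf (2,1) z - sinf (1,1) z * sinf (1,2) z))"
    by (intro lincomb_add lincomb_diff *)
  moreover have "weyl_denom z = (sinf (1,0) z * sinf (-1,1) z + sinf (1,0) z * sinf (2,1) z - sinf (1,0) z * sinf (1,2) z) +
     (sinf (0,1) z * sinf (-1,1) z + sinf (0,1) z * sinf (2,1) z - sinf (0,1) z * sinf (1,2) z) -
     (sinf (1,1) z * sinf (-1,1) z + sinf (1,1) z * sinf (2,1) z - sinf (1,1) z * sinf (1,2) z)" for z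
  proof -
    obtain a c where z: "z = (a, c)" by force
    have "trace_im a c = sinf (1,0) z + sinf (0,1) z - sinf (1,1) z" by (simp add: z trace_im_def sinf_def)
    moreover have "trace_im (c - a) (2 * a + c) = sinf (-1,1) z + sinf (2,1) z - sinf (1,2) z"
      by (simp add: z trace_im_def sinf_def)
    ultimately show ?thesis by (simp add: z weyl_denom_def distrib_left distrib_right left_diff_distrib right_diff_distrib)
  qed
  ultimately show ?thesis by presburger
qed

text \<open>The walls a = 0, a = c and a + 2 c = 2 pi are the horizontal leg, the hypotenuse and the
  vertical leg in the coordinates \<open>torus_pos\<close>.\<close>

definition in_alcove :: "real \<times> real \<Rightarrow> bool" where
  "in_alcove = (\<lambda>(a, c). 0 \<le> a \<and> a \<le> c \<and> a + 2 * c \<le> 2 * pi)"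

lemma weyl_denom_pos: "0 < a \<Longrightarrow> a < c \<Longrightarrow> a + 2 * c < 2 * pi \<Longrightarrow> weyl_denom (a, c) > 0"
  unfolding weyl_denom_def trace_im_eq prod.case
  by (intro mult_pos_pos sin_gt_zero) (auto simp: field_simps)

lemma trace_im_nonneg: "in_alcove (a, c) \<Longrightarrow> trace_im a c \<ge> 0"
  unfolding trace_im_eq in_alcove_def
  by (intro mult_nonneg_nonneg sin_ge_zero) (auto simp: field_simps)

lemma lincomb_one: "lincomb cosf UNIV (\<lambda>z. d)"
  using lincomb_scaled_term[of "(0,0)" UNIV cosf d] by (simp add: cosf_def)

definition trace_re :: "real \<times> real \<Rightarrow> real" where "trace_re = (\<lambda>(a, c). cos a + cos c + cos (a + c))"
definition trace_mod :: "real \<times> real \<Rightarrow> real" where "trace_mod = (\<lambda>(a, c). cos (a - c) + cos (a + 2 * c) + cos (2 * a + c))"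

lemma lincomb_trace_re: "lincomb cosf UNIV trace_re"
proof -
  have *: "trace_re = (\<lambda>z. cosf (1,0) z + cosf (0,1) z + cosf (1,1) z)" by (auto simp: trace_re_def cosf_def)
  show ?thesis by (subst *) (intro lincomb_add lincomb_term UNIV_I)
qed

lemma lincomb_trace_mod: "lincomb cosf UNIV trace_mod"
proof -
  have *: "trace_mod = (\<lambda>z. cosf (1,-1) z + cosf (1,2) z + cosf (2,1) z)" by (auto simp: trace_mod_def cosf_def)
  show ?thesis by (subst *) (intro lincomb_add lincomb_term UNIV_I)
qed

lemma symmetric_trace_re: "symmetric trace_re"
proof -
  have "cos (- a - c) = cos (a + c)" for a c :: real using cos_minus[of "a + c"] by simp
  then show ?thesis by (simp add: symmetric_def trace_re_def add.commute)
qed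

lemma symmetric_trace_mod: "symmetric trace_mod"
proof -
  have 1: "cos (c - a) = cos (a - c)" for a c :: real using cos_minus[of "a - c"] by simp
  have 2: "cos (a + 2 * (- a - c)) = cos (a + 2 * c)" for a c :: real using cos_minus[of "a + 2 * c"] by (simp add: algebra_simps)
  show ?thesis using 1 2 by (auto simp: symmetric_def trace_mod_def add.commute algebra_simps)
qed

text \<open>Expanding |S|^2 gives 3 plus twice the cosines of the pairwise differences of a, c, - a
  - c.\<close>

lemma re_im_mod: "trace_re (a, c) ^ 2 + trace_im a c ^ 2 = 3 + 2 * trace_mod (a, c)"
proof -
  have p: "cos (a - c) = cos a * cos c + sin a * sin c" by (rule cos_diff)
  have q: "cos (a + 2 * c) = cos c * cos (a + c) - sin c * sin (a + c)" using cos_add[of c "a + c"] by (simp add: algebra_simps)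
  have r: "cos (2 * a + c) = cos a * cos (a + c) - sin a * sin (a + c)" using cos_add[of a "a + c"] by (simp add: algebra_simps)
  have "sin a ^ 2 + cos a ^ 2 = 1" "sin c ^ 2 + cos c ^ 2 = 1" "sin (a + c) ^ 2 + cos (a + c) ^ 2 = 1" by simp_all
  then show ?thesis unfolding trace_re_def trace_im_def trace_mod_def prod.case p q r by algebra
qed

text \<open>For unimodular numbers with product 1 the second elementary symmetric function is the
  conjugate of the first. Hence the sum alone determines the monic cubic with these roots.\<close>

lemma cis_root_of_sum:
  assumes "cis a + cis c + cis (- a - c) = cis a' + cis c' + cis (- a' - c')"
  shows "cis a' = cis a \<or> cis a' = cis c \<or> cis a' = cis (- a - c)"
    "cis c' = cis a \<or> cis c' = cis c \<or> cis c' = cis (- a - c)"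
    "cis (- a' - c') = cis a \<or> cis (- a' - c') = cis c \<or> cis (- a' - c') = cis (- a - c)"
proof -
  let ?x = "cis a" and ?y = "cis c" and ?z = "cis (- a - c)"
  let ?x' = "cis a'" and ?y' = "cis c'" and ?z' = "cis (- a' - c')"
  have p: "?x * ?y * ?z = 1" "?x' * ?y' * ?z' = 1" by (simp_all add: cis_mult)
  have e: "cis x * cis y + cis y * cis (- x - y) + cis (- x - y) * cis x = cnj (cis x + cis y + cis (- x - y))" for x y
    by (simp add: cis_mult cis_cnj add_ac)
  have q: "?x * ?y + ?y * ?z + ?z * ?x = ?x' * ?y' + ?y' * ?z' + ?z' * ?x'"
    unfolding e assms ..
  have f: "(t - ?x) * (t - ?y) * (t - ?z) = (t - ?x') * (t - ?y') * (t - ?z')" for t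
    using p q assms by algebra
  show "cis a' = cis a \<or> cis a' = cis c \<or> cis a' = cis (- a - c)" using f[of ?x'] by auto
  show "cis c' = cis a \<or> cis c' = cis c \<or> cis c' = cis (- a - c)" using f[of ?y'] by auto
  show "cis (- a' - c') = cis a \<or> cis (- a' - c') = cis c \<or> cis (- a' - c') = cis (- a - c)" using f[of ?z'] by auto
qed

lemma cis_inj: "cis x = cis y \<Longrightarrow> 0 \<le> x \<Longrightarrow> x < 2 * pi \<Longrightarrow> 0 \<le> y \<Longrightarrow> y < 2 * pi \<Longrightarrow> x = y"
proof -
  assume "cis x = cis y" and b: "0 \<le> x" "x < 2 * pi" "0 \<le> y" "y < 2 * pi"
  then have "cos x = cos y" "sin x = sin y" by (auto simp: complex_eq_iff)
  then have "cos (x - y) = 1" using sin_cos_squared_add3[of y] by (simp add: cos_diff)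
  then obtain n :: int where n: "x - y = of_int n * 2 * pi" using cos_one_2pi_int by blast
  have "\<bar>x - y\<bar> < 2 * pi" using b by linarith
  then have "\<bar>of_int n\<bar> < (1 :: real)" using pi_gt_zero by (simp add: n abs_mult)
  then have "n = 0" by linarith
  then show "x = y" using n by simp
qed

text \<open>On the alcove \<open>Im S \<ge> 0\<close>, so \<open>Re S\<close> and \<open>|S|\<^sup>2\<close> determine \<open>S\<close>. The numbers \<open>cis a\<close>, \<open>cis c\<close>,
  \<open>cis (- a - c)\<close> are the roots of \<open>t\<^sup>3 - S t\<^sup>2 + cnj S t - 1\<close>, and on the alcove their arguments
  \<open>a \<le> c \<le> 2\<pi> - a - c\<close> are sorted.\<close>

lemma alcove_separation:
  assumes z: "in_alcove (a, c)" "in_alcove (a', c')"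
    and eq: "trace_re (a, c) = trace_re (a', c')" "trace_mod (a, c) = trace_mod (a', c')"
  shows "a = a' \<and> c = c'"
proof -
  have "trace_im a c ^ 2 = trace_im a' c' ^ 2"
    using re_im_mod[of a c] re_im_mod[of a' c'] eq by simp
  then have im: "trace_im a c = trace_im a' c'" using trace_im_nonneg[OF z(1)] trace_im_nonneg[OF z(2)]
    by (simp add: power2_eq_iff_nonneg)
  have S: "cis x + cis y + cis (- x - y) = Complex (trace_re (x, y)) (trace_im x y)" for x y
    using cos_minus[of "x + y"] sin_minus[of "x + y"]
    by (simp add: complex_eq_iff trace_re_def trace_im_def)
  have sum: "cis a + cis c + cis (- a - c) = cis a' + cis c' + cis (- a' - c')"
    unfolding S eq im ..
  have per: "cis (- x - y) = cis (2 * pi - x - y)" for x y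
    by (simp add: complex_eq_iff cos_diff sin_diff)
  note r0 = cis_root_of_sum[OF sum] cis_root_of_sum[OF sum[symmetric]]
  note r = r0[unfolded per[of a c] per[of a' c']]
  \<comment> \<open>At the origin the third argument 2 pi - a - c equals 2 pi and leaves the
    half-open range of \<open>cis_inj\<close>, so this vertex is treated apart.\<close>
  have triv: "x = 0 \<and> y = 0" if "in_alcove (x, y)" "cis x = 1" "cis y = 1" for x y
  proof -
    have xy: "0 \<le> x" "x \<le> y" "x + 2 * y \<le> 2 * pi" using that(1) by (auto simp: in_alcove_def)
    then have "0 \<le> y" "x < 2 * pi" "y < 2 * pi" using pi_gt_zero by linarith+
    then show ?thesis using cis_inj[of x 0] cis_inj[of y 0] that(2,3) xy pi_gt_zero by simp
  qed
  consider "a = 0 \<and> c = 0" | "a' = 0 \<and> c' = 0" | "\<not> (a = 0 \<and> c = 0)" "\<not> (a' = 0 \<and> c' = 0)" by blast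
  then show ?thesis
  proof cases
    case 1
    then have "cis a' = 1" "cis c' = 1" using r0(1,2) by auto
    then show ?thesis using triv[OF z(2)] 1 by simp
  next
    case 2
    then have "cis a = 1" "cis c = 1" using r0(4,5) by auto
    then show ?thesis using triv[OF z(1)] 2 by simp
  next
    case 3
    then have b: "0 \<le> a" "a \<le> c" "c \<le> 2 * pi - a - c" "2 * pi - a - c < 2 * pi"
       "0 \<le> a'" "a' \<le> c'" "c' \<le> 2 * pi - a' - c'" "2 * pi - a' - c' < 2 * pi"
      using z by (auto simp: in_alcove_def)
    define I where "I = {0..<2 * pi}"
    have I: "a \<in> I" "c \<in> I" "2 * pi - a - c \<in> I" "a' \<in> I" "c' \<in> I" "2 * pi - a' - c' \<in> I"
      unfolding I_def atLeastLessThan_iff using b by linarith+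
    have i: "x = y" if "cis x = cis y" "x \<in> I" "y \<in> I" for x y using cis_inj[OF that(1)] that(2,3) by (simp add: I_def)
    \<comment> \<open>Each sorted triple is contained in the other, so their least elements agree,
      and likewise their greatest.\<close>
    have "a' = a \<or> a' = c \<or> a' = 2 * pi - a - c" using r(1) i I by blast
    moreover have "a = a' \<or> a = c' \<or> a = 2 * pi - a' - c'" using r(4) i I by blast
    ultimately have 1: "a = a'" using b by linarith
    have "2 * pi - a' - c' = a \<or> 2 * pi - a' - c' = c \<or> 2 * pi - a' - c' = 2 * pi - a - c" using r(3) i I by blast
    moreover have "2 * pi - a - c = a' \<or> 2 * pi - a - c = c' \<or> 2 * pi - a - c = 2 * pi - a' - c'" using r(6) i I by blast
    ultimately have "2 * pi - a - c = 2 * pi - a' - c'" using b by linarith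
    then show ?thesis using 1 by simp
  qed
qed

section \<open>Values of the modes at the two points\<close>

lemma cos_eighth_mod: "cos (of_int j * (pi / 4)) = cos (of_int (j mod 8) * (pi / 4))"
proof -
  define q r where "q = j div 8" and "r = j mod 8"
  have "j = 8 * q + r" by (simp add: q_def r_def)
  then have "of_int j * (pi / 4) = of_int r * (pi / 4) + 2 * pi * of_int q"
    by (simp add: algebra_simps)
  then have "cos (of_int j * (pi / 4)) = cos (of_int r * (pi / 4))"
    by (simp only: cos_add sin_int_2pin cos_int_2pin)
  then show ?thesis by (simp add: r_def)
qed

text \<open>The coefficients are taken from 1, 3, -4 and from 1, 2, -3: the torus coordinates of p
  and q in units of pi / 4, completed to sum 0. The 64 pairs of residues are checked one by one;
  absolute values merge the two possible signs.\<close>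

lemma cos_table_identity:
  fixes C :: "int \<Rightarrow> real"
  assumes s: "C 0 = 1" "C 1 = sqrt 2 / 2" "C 2 = 0" "C 3 = - sqrt 2 / 2" "C 4 = -1" "C 5 = - sqrt 2 / 2" "C 6 = 0" "C 7 = sqrt 2 / 2"
  shows "x \<in> {0,1,2,3,4,5,6,7} \<Longrightarrow> y \<in> {0,1,2,3,4,5,6,7} \<Longrightarrow>
    \<bar>C ((1 * x + 3 * y) mod 8) - C ((3 * x + 1 * y) mod 8) - C ((1 * x + (- 4) * y) mod 8)
     - C (((-4) * x + 3 * y) mod 8) + C ((3 * x + (-4) * y) mod 8) + C (((-4) * x + 1 * y) mod 8)\<bar> =
    \<bar>C ((1 * x + 2 * y) mod 8) - C ((2 * x + 1 * y) mod 8) - C ((1 * x + (- 3) * y) mod 8)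
     - C (((-3) * x + 2 * y) mod 8) + C ((2 * x + (-3) * y) mod 8) + C (((-3) * x + 1 * y) mod 8)\<bar>"
  by (elim insertE emptyE; simp only:; simp add: s)

lemma alt_cosf_p_q:
  "alternation (cosf k) (pi / 4, 3 * pi / 4) = alternation (cosf k) (pi / 4, pi / 2) \<or>
   alternation (cosf k) (pi / 4, 3 * pi / 4) = - alternation (cosf k) (pi / 4, pi / 2)"
proof -
  obtain m n where k: "k = (m, n)" by force
  define C where "C j = cos (of_int j * (pi / 4))" for j :: int
  have Cm: "C j = C (j mod 8)" for j unfolding C_def by (rule cos_eighth_mod)
  define x y where "x = m mod 8" "y = n mod 8"
  have C1: "cosf (i, j) (pi / 4, 3 * pi / 4) = C (i + 3 * j)" "cosf (i, j) (pi / 4, pi / 2) = C (i + 2 * j)" for i j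
    by (simp_all add: cosf_def C_def algebra_simps)
  have red: "C (i * m + j * n) = C ((i * x + j * y) mod 8)" for i j
  proof -
    have "(i * m + j * n) mod 8 = (i * x + j * y) mod 8"
      unfolding x_y_def by (intro mod_add_cong mod_mult_cong) simp_all
    then show ?thesis using Cm[of "i * m + j * n"] by simp
  qed
  have "alternation (cosf k) (pi / 4, 3 * pi / 4) = C (1 * m + 3 * n) - C (3 * m + 1 * n) - C (1 * m + (- 4) * n)
     - C ((-4) * m + 3 * n) + C (3 * m + (-4) * n) + C ((-4) * m + 1 * n)"
    unfolding k alt_cosf C1 by (simp add: algebra_simps)
  note P = this[unfolded red]
  have "alternation (cosf k) (pi / 4, pi / 2) = C (1 * m + 2 * n) - C (2 * m + 1 * n) - C (1 * m + (- 3) * n)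
     - C ((-3) * m + 2 * n) + C (2 * m + (-3) * n) + C ((-3) * m + 1 * n)"
    unfolding k alt_cosf C1 by (simp add: algebra_simps)
  note Q = this[unfolded red]
  have s: "C 0 = 1" "C 1 = sqrt 2 / 2" "C 2 = 0" "C 3 = - sqrt 2 / 2" "C 4 = -1" "C 5 = - sqrt 2 / 2" "C 6 = 0" "C 7 = sqrt 2 / 2"
  proof -
    show "C 0 = 1" "C 1 = sqrt 2 / 2" "C 2 = 0" "C 4 = -1" by (simp_all add: C_def cos_45)
    \<comment> \<open>Evenness and period 8 fold the entries 5, 6, 7 onto 3, 2, 1.\<close>
    have "C (8 - j) = C j" for j
    proof -
      have "C (8 - j) = C (- j)" using Cm[of "8 - j"] Cm[of "- j"] by (simp only: minus_mod_self1)
      then show ?thesis by (simp add: C_def)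
    qed
    from this[of 3] this[of 2] this[of 1]
    have 1: "C 5 = C 3" "C 6 = C 2" "C 7 = C 1" by simp_all
    have "3 * (pi / 4) = pi - pi / 4" by simp
    then have "C 3 = cos (pi - pi / 4)" by (simp add: C_def)
    then show "C 3 = - sqrt 2 / 2" by (simp only: cos_pi_minus cos_45 minus_divide_left)
    then show "C 5 = - sqrt 2 / 2" using 1 by simp
    show "C 6 = 0" "C 7 = sqrt 2 / 2" using 1 by (simp_all add: C_def cos_45)
  qed
  have "x \<in> {0..<8}" "y \<in> {0..<8}" by (simp_all add: x_y_def)
  then have xy: "x \<in> {0,1,2,3,4,5,6,7}" "y \<in> {0,1,2,3,4,5,6,7}" by auto
  show ?thesis using cos_table_identity[of C, OF s xy] unfolding P Q abs_eq_iff .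
qed

section \<open>Modes of the triangle\<close>

text \<open>Scaled so that the translations in the group generated by the reflections in the sides
  become shifts by multiples of 2 pi in each coordinate.\<close>

definition torus_pos :: "real ^ 2 \<Rightarrow> real \<times> real" where
  "torus_pos x = (4 * pi / 3 * x $ 2, 2 * pi / sqrt 3 * x $ 1 - 2 * pi / 3 * x $ 2)"

text \<open>The transpose of \<open>torus_pos\<close> applied to k, so that modes become functions
  of an inner product with x.\<close>

definition freq :: "int \<times> int \<Rightarrow> real ^ 2" where
  "freq k = vector [2 * pi / sqrt 3 * of_int (snd k), 4 * pi / 3 * of_int (fst k) - 2 * pi / 3 * of_int (snd k)]"

definition shell :: "real \<Rightarrow> (int \<times> int) set" where
  "shell \<nu> = {k. freq k \<bullet> freq k = \<nu>}"

lemma cosf_torus_pos: "cosf k (torus_pos x) = cos (freq k \<bullet> x)"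
  by (simp add: cosf_def torus_pos_def freq_def inner_vec2 algebra_simps)

text \<open>This is the norm form of the hexagonal lattice. Its invariance on
  \<open>freq_orbit\<close> gives all terms of a mode the same eigenvalue.\<close>

lemma freq_norm: "freq k \<bullet> freq k = 16 * pi\<^sup>2 / 9 * of_int (fst k ^ 2 - fst k * snd k + snd k ^ 2)"
  by (simp add: freq_def inner_vec2 field_simps power2_eq_square)

lemma freq_norm_orbit: "l \<in> freq_orbit k \<Longrightarrow> freq l \<bullet> freq l = freq k \<bullet> freq k"
proof -
  assume "l \<in> freq_orbit k"
  then have "fst l ^ 2 - fst l * snd l + snd l ^ 2 = fst k ^ 2 - fst k * snd k + snd k ^ 2"
    by (cases k) (auto simp: freq_orbit_def power2_eq_square algebra_simps)
  then show ?thesis by (simp only: freq_norm)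
qed

lemma freq_eq_0: "freq k = 0 \<longleftrightarrow> k = 0"
  by (cases k) (auto simp: freq_def vec_eq_iff forall_2 zero_prod_def)

text \<open>The Lipschitz bounds turn vanishing on a side into linear vanishing. \<open>D1\<close>
  is given in all directions and linearly in them, so that derivatives normal to the slanted side
  are available.\<close>

definition helmholtz :: "real \<Rightarrow> (real ^ 2 \<Rightarrow> real) \<Rightarrow> (real ^ 2 \<Rightarrow> real ^ 2 \<Rightarrow> real) \<Rightarrow> (real ^ 2 \<Rightarrow> real ^ 2 \<Rightarrow> real) \<Rightarrow> bool" where
  "helmholtz \<nu> \<phi> D1 D2 \<longleftrightarrow> C2_data \<phi> D1 D2 \<and> (\<forall>x. (\<Sum>b\<in>Basis. D2 b x) = - \<nu> * \<phi> x) \<and>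
     (\<exists>C\<ge>0. \<forall>x y. \<bar>\<phi> x - \<phi> y\<bar> \<le> C * norm (x - y)) \<and>
     (\<forall>v x. has_ddir \<phi> v x (D1 v x)) \<and> (\<forall>x. linear (\<lambda>v. D1 v x)) \<and>
     (\<forall>v. \<exists>C\<ge>0. \<forall>x y. \<bar>D1 v x - D1 v y\<bar> \<le> C * norm (x - y))"

lemma abs_diff_le_of_deriv:
  fixes h h' :: "real \<Rightarrow> real"
  assumes "\<And>s. (h has_real_derivative h' s) (at s)" "\<And>s. \<bar>h' s\<bar> \<le> 1"
  shows "\<bar>h s - h t\<bar> \<le> \<bar>s - t\<bar>"
  using field_differentiable_bound[of UNIV h h' 1 s t] assms by auto

lemma lipschitz_cos_sin: "\<bar>cos s - cos t\<bar> \<le> \<bar>s - t\<bar>" "\<bar>sin s - sin t\<bar> \<le> \<bar>s - (t::real)\<bar>"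
  by (rule abs_diff_le_of_deriv[OF DERIV_cos]; simp) (rule abs_diff_le_of_deriv[OF DERIV_sin]; simp)

lemma helmholtz_cosf:
  "helmholtz (freq k \<bullet> freq k) (\<lambda>x. cosf k (torus_pos x)) (\<lambda>v x. - (freq k \<bullet> v) * sin (freq k \<bullet> x)) (\<lambda>v x. - (freq k \<bullet> v)\<^sup>2 * cos (freq k \<bullet> x))"
proof -
  let ?\<kappa> = "freq k"
  have d1: "has_ddir (\<lambda>x. cos (?\<kappa> \<bullet> x)) v x (- (?\<kappa> \<bullet> v) * sin (?\<kappa> \<bullet> x))" for v x
    using has_ddir_compose_affine[OF DERIV_cos, of ?\<kappa> 0 1 v x] by (simp add: mult.commute)
  have d2: "has_ddir (\<lambda>x. - (?\<kappa> \<bullet> v) * sin (?\<kappa> \<bullet> x)) v x (- (?\<kappa> \<bullet> v)\<^sup>2 * cos (?\<kappa> \<bullet> x))" for v x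
  proof -
    have "has_ddir (\<lambda>x. - (?\<kappa> \<bullet> v) * sin (?\<kappa> \<bullet> x)) v x (- (?\<kappa> \<bullet> v) * (cos (?\<kappa> \<bullet> x) * (?\<kappa> \<bullet> v)) + 0 * sin (?\<kappa> \<bullet> x))"
      by (rule has_ddir_mult) (use has_ddir_compose_affine[OF DERIV_sin, of ?\<kappa> 0 1 v x] in \<open>auto simp: has_ddir_def\<close>)
    then show ?thesis by (simp add: power2_eq_square mult_ac)
  qed
  have ip: "\<bar>?\<kappa> \<bullet> x - ?\<kappa> \<bullet> y\<bar> \<le> norm ?\<kappa> * norm (x - y)" for x y
    unfolding inner_diff_right[symmetric] by (rule Cauchy_Schwarz_ineq2)
  have l0: "\<bar>cos (?\<kappa> \<bullet> x) - cos (?\<kappa> \<bullet> y)\<bar> \<le> norm ?\<kappa> * norm (x - y)"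
       "\<bar>sin (?\<kappa> \<bullet> x) - sin (?\<kappa> \<bullet> y)\<bar> \<le> norm ?\<kappa> * norm (x - y)" for x y
    using lipschitz_cos_sin ip order_trans by blast+
  have l1: "\<bar>- (?\<kappa> \<bullet> v) * sin (?\<kappa> \<bullet> x) - - (?\<kappa> \<bullet> v) * sin (?\<kappa> \<bullet> y)\<bar> \<le> (\<bar>?\<kappa> \<bullet> v\<bar> * norm ?\<kappa>) * norm (x - y)" for v x y
  proof -
    have "\<bar>- (?\<kappa> \<bullet> v) * sin (?\<kappa> \<bullet> x) - - (?\<kappa> \<bullet> v) * sin (?\<kappa> \<bullet> y)\<bar> = \<bar>?\<kappa> \<bullet> v\<bar> * \<bar>sin (?\<kappa> \<bullet> x) - sin (?\<kappa> \<bullet> y)\<bar>"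
      unfolding right_diff_distrib[symmetric] abs_mult by simp
    also have "\<dots> \<le> \<bar>?\<kappa> \<bullet> v\<bar> * (norm ?\<kappa> * norm (x - y))" using l0(2) by (rule mult_left_mono) simp
    finally show ?thesis by (simp add: mult.assoc)
  qed
  show ?thesis unfolding helmholtz_def cosf_torus_pos
  proof (intro conjI allI)
    show "C2_data (\<lambda>x. cos (?\<kappa> \<bullet> x)) (\<lambda>v x. - (?\<kappa> \<bullet> v) * sin (?\<kappa> \<bullet> x)) (\<lambda>v x. - (?\<kappa> \<bullet> v)\<^sup>2 * cos (?\<kappa> \<bullet> x))"
      unfolding C2_data_def by (intro conjI ballI allI d1 d2 continuous_intros)
    show "(\<Sum>b\<in>Basis. - (?\<kappa> \<bullet> b)\<^sup>2 * cos (?\<kappa> \<bullet> x)) = - (?\<kappa> \<bullet> ?\<kappa>) * cos (?\<kappa> \<bullet> x)" for x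
      by (subst euclidean_inner[of ?\<kappa> ?\<kappa>]) (simp add: sum_distrib_right sum_negf power2_eq_square)
    show "\<exists>C\<ge>0. \<forall>x y. \<bar>cos (?\<kappa> \<bullet> x) - cos (?\<kappa> \<bullet> y)\<bar> \<le> C * norm (x - y)"
      using l0 by (intro exI[of _ "norm ?\<kappa>"]) auto
    show "has_ddir (\<lambda>x. cos (?\<kappa> \<bullet> x)) v x (- (?\<kappa> \<bullet> v) * sin (?\<kappa> \<bullet> x))" for v x by (rule d1)
    show "linear (\<lambda>v. - (?\<kappa> \<bullet> v) * sin (?\<kappa> \<bullet> x))" for x
      by (rule linearI) (auto simp: inner_add_right algebra_simps)
    show "\<exists>C\<ge>0. \<forall>x y. \<bar>- (?\<kappa> \<bullet> v) * sin (?\<kappa> \<bullet> x) - - (?\<kappa> \<bullet> v) * sin (?\<kappa> \<bullet> y)\<bar> \<le> C * norm (x - y)" for v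
      using l1[of v] by (intro exI[of _ "\<bar>?\<kappa> \<bullet> v\<bar> * norm ?\<kappa>"]) auto
  qed
qed

lemma has_ddir_cmult: "has_ddir (f :: 'a::real_normed_vector \<Rightarrow> real) b x d \<Longrightarrow> has_ddir (\<lambda>x. c * f x) b x (c * d)"
  using has_ddir_mult[of "\<lambda>_. c" b x 0 f d] by (simp add: has_ddir_def)

lemma lipschitz_add_scaled:
  fixes f g :: "'a::real_normed_vector \<Rightarrow> real"
  assumes "\<exists>C\<ge>0. \<forall>x y. \<bar>f x - f y\<bar> \<le> C * norm (x - y)" "\<exists>C\<ge>0. \<forall>x y. \<bar>g x - g y\<bar> \<le> C * norm (x - y)"
  shows "\<exists>C\<ge>0. \<forall>x y. \<bar>(f x + c * g x) - (f y + c * g y)\<bar> \<le> C * norm (x - y)"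
proof -
  obtain C D where C: "C \<ge> 0" "\<And>x y. \<bar>f x - f y\<bar> \<le> C * norm (x - y)" and D: "D \<ge> 0" "\<And>x y. \<bar>g x - g y\<bar> \<le> D * norm (x - y)"
    using assms by blast
  have "\<bar>(f x + c * g x) - (f y + c * g y)\<bar> \<le> (C + \<bar>c\<bar> * D) * norm (x - y)" for x y
  proof -
    have "\<bar>(f x + c * g x) - (f y + c * g y)\<bar> = \<bar>(f x - f y) + c * (g x - g y)\<bar>" by (simp add: algebra_simps)
    also have "\<dots> \<le> \<bar>f x - f y\<bar> + \<bar>c\<bar> * \<bar>g x - g y\<bar>" unfolding abs_mult[symmetric] by (rule abs_triangle_ineq)
    also have "\<dots> \<le> C * norm (x - y) + \<bar>c\<bar> * (D * norm (x - y))" by (intro add_mono mult_left_mono C D) auto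
    finally show ?thesis by (simp add: algebra_simps)
  qed
  then show ?thesis using C D by (intro exI[of _ "C + \<bar>c\<bar> * D"]) auto
qed

lemma helmholtz_add_scaled:
  assumes "helmholtz \<nu> f D1 D2" "helmholtz \<nu> g E1 E2"
  shows "helmholtz \<nu> (\<lambda>x. f x + c * g x) (\<lambda>v x. D1 v x + c * E1 v x) (\<lambda>v x. D2 v x + c * E2 v x)"
proof -
  note A = assms[unfolded helmholtz_def]
  show ?thesis unfolding helmholtz_def
  proof (intro conjI allI)
    show "C2_data (\<lambda>x. f x + c * g x) (\<lambda>v x. D1 v x + c * E1 v x) (\<lambda>v x. D2 v x + c * E2 v x)"
      using A unfolding C2_data_def by (intro conjI ballI allI continuous_intros has_ddir_add has_ddir_cmult) auto
    show "(\<Sum>b\<in>Basis. D2 b x + c * E2 b x) = - \<nu> * (f x + c * g x)" for x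
      using A by (simp add: sum.distrib sum_distrib_left[symmetric] algebra_simps)
    show "\<exists>C\<ge>0. \<forall>x y. \<bar>f x + c * g x - (f y + c * g y)\<bar> \<le> C * norm (x - y)"
      using A by (intro lipschitz_add_scaled) auto
    show "has_ddir (\<lambda>x. f x + c * g x) v x (D1 v x + c * E1 v x)" for v x
      using A by (intro has_ddir_add has_ddir_cmult) auto
    show "linear (\<lambda>v. D1 v x + c * E1 v x)" for x
      using A linear_compose_add[of "\<lambda>v. D1 v x" "\<lambda>v. c * E1 v x"] linear_compose_scale_right[of "\<lambda>v. E1 v x" c] by simp
    show "\<exists>C\<ge>0. \<forall>x y. \<bar>D1 v x + c * E1 v x - (D1 v y + c * E1 v y)\<bar> \<le> C * norm (x - y)" for v
      using A by (intro lipschitz_add_scaled) auto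
  qed
qed

lemma helmholtz_lincomb:
  assumes "lincomb cosf (shell \<nu>) F"
  shows "\<exists>D1 D2. helmholtz \<nu> (\<lambda>x. F (torus_pos x)) D1 D2"
  using assms
proof induction
  case zero
  have "helmholtz \<nu> (\<lambda>x. 0) (\<lambda>_ _. 0) (\<lambda>_ _. 0)"
    by (auto simp: helmholtz_def C2_data_def has_ddir_def linear_zero intro!: exI[of _ 0])
  then show ?case by blast
next
  case (add_term f i c)
  then obtain D1 D2 where D: "helmholtz \<nu> (\<lambda>x. f (torus_pos x)) D1 D2" by blast
  have "helmholtz \<nu> (\<lambda>x. cosf i (torus_pos x)) (\<lambda>v x. - (freq i \<bullet> v) * sin (freq i \<bullet> x)) (\<lambda>v x. - (freq i \<bullet> v)\<^sup>2 * cos (freq i \<bullet> x))"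
    using helmholtz_cosf[of i] add_term by (simp add: shell_def)
  from helmholtz_add_scaled[OF D this] show ?case by blast
qed

section \<open>Reflections in the sides and orthogonality of modes\<close>

lemma lincomb_cosf_even_periodic:
  assumes "lincomb cosf I F"
  shows "F (- z) = F z" "F (a, c + 2 * pi) = F (a, c)"
proof -
  have 1: "cosf k (- z) = cosf k z" for k z
    using cos_minus[of "of_int (fst k) * fst z + of_int (snd k) * snd z"] by (simp add: cosf_def)
  have 2: "cosf k (a, c + 2 * pi) = cosf k (a, c)" for k
  proof -
    have "cosf k (a, c + 2 * pi) = cos ((of_int (fst k) * a + of_int (snd k) * c) + 2 * pi * of_int (snd k))"
      by (simp add: cosf_def algebra_simps)
    also have "\<dots> = cos (of_int (fst k) * a + of_int (snd k) * c)" by (simp only: cos_add sin_int_2pin cos_int_2pin) simp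
    finally show ?thesis by (simp add: cosf_def)
  qed
  show "F (- z) = F z" using assms by induction (auto simp: 1)
  show "F (a, c + 2 * pi) = F (a, c)" using assms by induction (auto simp: 2)
qed

text \<open>In torus coordinates the three reflections are a transposition composed with inversion,
  the swap of a and c, and a transposition composed with a shift by 2 pi. The factor sigma is -1 for
  alternating and 1 for symmetric functions, which covers the Dirichlet and the Neumann case at
  once.\<close>

lemma reflection_across_sides:
  assumes F: "lincomb cosf I F" and s: "\<And>a c. F (c, a) = \<sigma> * F (a, c)" "\<And>a c. F (a, - a - c) = \<sigma> * F (a, c)"
  shows "side_normal1 \<bullet> x = 0 \<Longrightarrow> F (torus_pos (x + t *\<^sub>R side_normal1)) = \<sigma> * F (torus_pos (x - t *\<^sub>R side_normal1))"
    "side_normal2 \<bullet> x = 0 \<Longrightarrow> F (torus_pos (x + t *\<^sub>R side_normal2)) = \<sigma> * F (torus_pos (x - t *\<^sub>R side_normal2))"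
    "side_normal3 \<bullet> x = - (sqrt 3 / 2) \<Longrightarrow> F (torus_pos (x + t *\<^sub>R side_normal3)) = \<sigma> * F (torus_pos (x - t *\<^sub>R side_normal3))"
proof -
  note ep = lincomb_cosf_even_periodic[OF F]
  have s2: "F (- a, a + c) = \<sigma> * F (a, c)" for a c
    using s(2)[of a c] ep(1)[of "(a, - a - c)"] by (simp add: add.commute)
  have s3: "F (a, 2 * pi - a - c) = \<sigma> * F (a, c)" for a c
    using s(2)[of a c] ep(2)[of a "- a - c"] by (simp add: algebra_simps)
  {
    assume "side_normal1 \<bullet> x = 0"
    then have x: "x $ 2 = 0" by (simp add: inner_vec2)
    define a c where "a = - (4 * pi / 3 * t)" and "c = 2 * pi / sqrt 3 * x $ 1 + 2 * pi / 3 * t"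
    have P: "torus_pos (x + t *\<^sub>R side_normal1) = (- a, a + c)" "torus_pos (x - t *\<^sub>R side_normal1) = (a, c)"
      by (simp_all add: torus_pos_def x a_def c_def)
    show "F (torus_pos (x + t *\<^sub>R side_normal1)) = \<sigma> * F (torus_pos (x - t *\<^sub>R side_normal1))" unfolding P by (rule s2)
  }
  {
    assume "side_normal2 \<bullet> x = 0"
    then have x: "x $ 1 = sqrt 3 * x $ 2" by (simp add: inner_vec2)
    define u w where "u = 4 * pi / 3 * x $ 2" and "w = 2 * pi / sqrt 3 * t"
    have w: "w = 2 * pi * sqrt 3 / 3 * t" by (simp add: w_def field_simps)
    have P: "torus_pos (x + t *\<^sub>R side_normal2) = (u - w, u + w)" "torus_pos (x - t *\<^sub>R side_normal2) = (u + w, u - w)"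
      unfolding w u_def by (simp_all add: torus_pos_def x field_simps)
    show "F (torus_pos (x + t *\<^sub>R side_normal2)) = \<sigma> * F (torus_pos (x - t *\<^sub>R side_normal2))" unfolding P by (rule s(1))
  }
  {
    assume "side_normal3 \<bullet> x = - (sqrt 3 / 2)"
    then have x: "x $ 1 = sqrt 3 / 2" by (simp add: inner_vec2)
    define a c where "a = 4 * pi / 3 * x $ 2" and "c = pi - 2 * pi / 3 * x $ 2 + 2 * pi / sqrt 3 * t"
    have P: "torus_pos (x + t *\<^sub>R side_normal3) = (a, 2 * pi - a - c)" "torus_pos (x - t *\<^sub>R side_normal3) = (a, c)"
      by (simp_all add: torus_pos_def x a_def c_def field_simps)
    show "F (torus_pos (x + t *\<^sub>R side_normal3)) = \<sigma> * F (torus_pos (x - t *\<^sub>R side_normal3))" unfolding P by (rule s3)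
  }
qed

text \<open>Comparison with the foot of the perpendicular. It may fall outside the triangle, which
  is why g lives on the whole space.\<close>

lemma lipschitz_zero_on_line:
  fixes g :: "'a::real_inner \<Rightarrow> real"
  assumes C: "\<And>x y. \<bar>g x - g y\<bar> \<le> C * norm (x - y)" and z: "\<And>x. n \<bullet> x = d \<Longrightarrow> g x = 0"
    and n: "norm n = 1" and x: "n \<bullet> x > d"
  shows "\<bar>g x\<bar> \<le> C * (n \<bullet> x - d)"
proof -
  define y where "y = x - (n \<bullet> x - d) *\<^sub>R n"
  have "n \<bullet> n = 1" using n by (simp add: norm_eq_1)
  then have "n \<bullet> y = d" by (simp add: y_def inner_diff_right)
  then have "g y = 0" by (rule z)
  then show ?thesis using C[of x y] x n by (simp add: y_def)
qed

text \<open>Alternation makes F equal to - F on each side, so F vanishes there linearly, and the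
  weak equation reduces to (nu - nu') times the integral of F e.\<close>

lemma triangle_orthogonal_to_shell:
  assumes F: "lincomb cosf (shell \<nu>') F" "alternating F"
    and e: "C2_on triangle_30_60_90 e" "\<And>x. x \<in> triangle_30_60_90 \<Longrightarrow> laplacian e x = - of_real \<nu> * e x"
    "continuous_on (closure triangle_30_60_90) e" "\<forall>x\<in>frontier triangle_30_60_90. e x = 0"
    and \<nu>: "\<nu> \<noteq> \<nu>'"
  shows "integral\<^sup>L (lebesgue_on triangle_30_60_90) (\<lambda>x. F (torus_pos x) *\<^sub>R e x) = 0"
proof -
  obtain D1 D2 where h: "helmholtz \<nu>' (\<lambda>x. F (torus_pos x)) D1 D2" using helmholtz_lincomb[OF F(1)] by blast
  then obtain C where C: "C \<ge> 0" "\<And>x y. \<bar>F (torus_pos x) - F (torus_pos y)\<bar> \<le> C * norm (x - y)" unfolding helmholtz_def by blast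
  have s: "F (c, a) = -1 * F (a, c)" "F (a, - a - c) = -1 * F (a, c)" for a c
    unfolding mult_minus1 using F(2) unfolding alternating_def by blast+
  have z: "side_normal1 \<bullet> x = 0 \<Longrightarrow> F (torus_pos x) = 0" "side_normal2 \<bullet> x = 0 \<Longrightarrow> F (torus_pos x) = 0"
    "side_normal3 \<bullet> x = - (sqrt 3 / 2) \<Longrightarrow> F (torus_pos x) = 0" for x
    using reflection_across_sides[OF F(1) s, of x 0] by simp_all
  have "weak_eigen triangle_30_60_90 e \<nu> (\<lambda>x. F (torus_pos x))"
  proof (rule triangle_weak_eigen[OF e C(1)])
    fix x assume x: "x \<in> triangle_30_60_90"
    show "\<bar>F (torus_pos x)\<bar> \<le> C * (side_normal1 \<bullet> x)"
      using lipschitz_zero_on_line[where g="\<lambda>x. F (torus_pos x)" and x=x and d=0, OF C(2) z(1) side_normal_norm(1)] x triangle_halfplanes by auto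
    show "\<bar>F (torus_pos x)\<bar> \<le> C * (side_normal2 \<bullet> x)"
      using lipschitz_zero_on_line[where g="\<lambda>x. F (torus_pos x)" and x=x and d=0, OF C(2) z(2) side_normal_norm(2)] x triangle_halfplanes by auto
    show "\<bar>F (torus_pos x)\<bar> \<le> C * (side_normal3 \<bullet> x + sqrt 3 / 2)"
      using lipschitz_zero_on_line[where g="\<lambda>x. F (torus_pos x)" and x=x and d="- (sqrt 3 / 2)", OF C(2) z(3) side_normal_norm(3)] x triangle_halfplanes by auto
  qed
  then have "integral\<^sup>L (lebesgue_on triangle_30_60_90) (\<lambda>x. ((\<Sum>b\<in>Basis. D2 b x) + \<nu> * F (torus_pos x)) *\<^sub>R e x) = 0"
    using h unfolding weak_eigen_def helmholtz_def by blast
  moreover have "((\<Sum>b\<in>Basis. D2 b x) + \<nu> * F (torus_pos x)) *\<^sub>R e x = (\<nu> - \<nu>') *\<^sub>R (F (torus_pos x) *\<^sub>R e x)" for x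
  proof -
    have "(\<Sum>b\<in>Basis. D2 b x) = - \<nu>' * F (torus_pos x)" using h unfolding helmholtz_def by blast
    then show ?thesis by (simp add: algebra_simps)
  qed
  ultimately have "integral\<^sup>L (lebesgue_on triangle_30_60_90) (\<lambda>x. (\<nu> - \<nu>') *\<^sub>R (F (torus_pos x) *\<^sub>R e x)) = 0"
    by (simp only:)
  then show ?thesis unfolding integral_scaleR_right using \<nu> by simp
qed

text \<open>A symmetric function is even across each side, so its normal derivative vanishes there and
  its Laplacian integrates to 0.\<close>

lemma triangle_integral_symmetric:
  assumes F: "lincomb cosf (shell \<nu>) F" "symmetric F" and \<nu>: "\<nu> \<noteq> 0"
  shows "integral\<^sup>L (lebesgue_on triangle_30_60_90) (\<lambda>x. F (torus_pos x)) = 0"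
proof -
  obtain D1 D2 where h: "helmholtz \<nu> (\<lambda>x. F (torus_pos x)) D1 D2" using helmholtz_lincomb[OF F(1)] by blast
  have dd: "has_ddir (\<lambda>x. F (torus_pos x)) v x (D1 v x)" for v x using h unfolding helmholtz_def by blast
  have lin: "linear (\<lambda>v. D1 v x)" for x using h unfolding helmholtz_def by blast
  have s: "F (c, a) = 1 * F (a, c)" "F (a, - a - c) = 1 * F (a, c)" for a c
    unfolding mult_1 using F(2) unfolding symmetric_def by blast+
  \<comment> \<open>Evenness identifies the derivatives along n and - n, which linearity makes
    opposite.\<close>
  have zero: "D1 n x = 0" if "\<And>t. F (torus_pos (x + t *\<^sub>R n)) = 1 * F (torus_pos (x - t *\<^sub>R n))" for n x
  proof -
    have "has_ddir (\<lambda>x. F (torus_pos x)) n x (D1 (- n) x)"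
      using dd[of "- n" x] that by (simp add: has_ddir_def)
    then have "D1 n x = D1 (- n) x" using dd has_ddir_unique by blast
    then show ?thesis using linear_neg[OF lin] by simp
  qed
  have z: "side_normal1 \<bullet> x = 0 \<Longrightarrow> D1 side_normal1 x = 0" "side_normal2 \<bullet> x = 0 \<Longrightarrow> D1 side_normal2 x = 0"
    "side_normal3 \<bullet> x = - (sqrt 3 / 2) \<Longrightarrow> D1 side_normal3 x = 0" for x
    by (rule zero, erule reflection_across_sides[OF F(1) s])+
  have sumD: "(\<Sum>b\<in>Basis. (n \<bullet> b) * D1 b x) = D1 n x" for n x
  proof -
    have "D1 n x = D1 (\<Sum>b\<in>Basis. (n \<bullet> b) *\<^sub>R b) x" by (simp add: euclidean_representation)
    also have "\<dots> = (\<Sum>b\<in>Basis. (n \<bullet> b) * D1 b x)" by (simp add: linear_sum[OF lin] linear_cmul[OF lin])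
    finally show ?thesis by simp
  qed
  have lip: "\<exists>C\<ge>0. \<forall>x y. \<bar>D1 v x - D1 v y\<bar> \<le> C * norm (x - y)" for v using h unfolding helmholtz_def by blast
  obtain C1 C2 C3 where C: "C1 \<ge> 0" "\<And>x y. \<bar>D1 side_normal1 x - D1 side_normal1 y\<bar> \<le> C1 * norm (x - y)"
     "C2 \<ge> 0" "\<And>x y. \<bar>D1 side_normal2 x - D1 side_normal2 y\<bar> \<le> C2 * norm (x - y)"
     "C3 \<ge> 0" "\<And>x y. \<bar>D1 side_normal3 x - D1 side_normal3 y\<bar> \<le> C3 * norm (x - y)"
    using lip[of side_normal1] lip[of side_normal2] lip[of side_normal3] by blast
  define C where "C = C1 + C2 + C3"
  have C': "\<bar>D1 side_normal1 x - D1 side_normal1 y\<bar> \<le> C * norm (x - y)"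
     "\<bar>D1 side_normal2 x - D1 side_normal2 y\<bar> \<le> C * norm (x - y)"
     "\<bar>D1 side_normal3 x - D1 side_normal3 y\<bar> \<le> C * norm (x - y)" for x y
    by (rule order_trans[OF C(2)] order_trans[OF C(4)] order_trans[OF C(6)]; use C in \<open>auto simp: C_def intro!: mult_right_mono\<close>)+
  have "zero_net_flux triangle_30_60_90 D1"
  proof (rule triangle_zero_net_flux)
    show "C \<ge> 0" using C by (simp add: C_def)
    fix x assume x: "x \<in> triangle_30_60_90"
    show "\<bar>\<Sum>b\<in>Basis. (side_normal1 \<bullet> b) * D1 b x\<bar> \<le> C * (side_normal1 \<bullet> x)" unfolding sumD
      using lipschitz_zero_on_line[where g="D1 side_normal1" and x=x and d=0, OF C'(1) z(1) side_normal_norm(1)] x triangle_halfplanes by auto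
    show "\<bar>\<Sum>b\<in>Basis. (side_normal2 \<bullet> b) * D1 b x\<bar> \<le> C * (side_normal2 \<bullet> x)" unfolding sumD
      using lipschitz_zero_on_line[where g="D1 side_normal2" and x=x and d=0, OF C'(2) z(2) side_normal_norm(2)] x triangle_halfplanes by auto
    show "\<bar>\<Sum>b\<in>Basis. (side_normal3 \<bullet> b) * D1 b x\<bar> \<le> C * (side_normal3 \<bullet> x + sqrt 3 / 2)" unfolding sumD
      using lipschitz_zero_on_line[where g="D1 side_normal3" and x=x and d="- (sqrt 3 / 2)", OF C'(3) z(3) side_normal_norm(3)] x triangle_halfplanes by auto
  qed
  moreover have "\<forall>b\<in>Basis. continuous_on UNIV (D1 b) \<and> continuous_on UNIV (D2 b) \<and> (\<forall>x. has_ddir (D1 b) b x (D2 b x))"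
    using h unfolding helmholtz_def C2_data_def by simp
  ultimately have "integral\<^sup>L (lebesgue_on triangle_30_60_90) (\<lambda>x. \<Sum>b\<in>Basis. D2 b x) = 0"
    unfolding zero_net_flux_def by blast
  moreover have "(\<Sum>b\<in>Basis. D2 b x) = - \<nu> * F (torus_pos x)" for x using h unfolding helmholtz_def by blast
  ultimately show ?thesis using \<nu> by simp
qed

lemma continuous_lincomb_cosf:
  assumes "lincomb cosf I F" shows "continuous_on S (\<lambda>x. F (torus_pos x))"
  using assms
proof induction
  case (add_term f i c)
  have "continuous_on S (\<lambda>x. cosf i (torus_pos x))" unfolding cosf_torus_pos by (intro continuous_intros)
  then show ?case using add_term by (intro continuous_intros)
qed simp

text \<open>F may mix eigenvalues; each symmetrized cosine in it has a single one, nonzero because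
  its frequency is.\<close>

lemma triangle_integral_symmetric_lincomb:
  assumes F: "lincomb cosf I F" "symmetric F" and I: "0 \<notin> I"
  shows "integral\<^sup>L (lebesgue_on triangle_30_60_90) (\<lambda>x. F (torus_pos x)) = 0"
proof -
  have "lincomb (\<lambda>k. symmetrization (cosf k)) I F" by (rule lincomb_symmetric[OF F])
  then show ?thesis
  proof induction
    case (add_term f k c)
    have k: "k \<noteq> 0" using add_term I by blast
    have "freq_orbit k \<subseteq> shell (freq k \<bullet> freq k)" unfolding shell_def using freq_norm_orbit by blast
    then have l: "lincomb cosf (shell (freq k \<bullet> freq k)) (symmetrization (cosf k))" using lincomb_sym_cosf lincomb_mono by blast
    then have 1: "integral\<^sup>L (lebesgue_on triangle_30_60_90) (\<lambda>x. symmetrization (cosf k) (torus_pos x)) = 0"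
      using symmetric_symmetrization k by (intro triangle_integral_symmetric) (auto simp: freq_eq_0)
    have "lincomb cosf UNIV f"
      by (rule lincomb_trans[OF add_term.hyps(1)]) (use lincomb_sym_cosf lincomb_mono in blast)
    then have "integrable (lebesgue_on triangle_30_60_90) (\<lambda>x. f (torus_pos x))"
      "integrable (lebesgue_on triangle_30_60_90) (\<lambda>x. symmetrization (cosf k) (torus_pos x))"
      using l continuous_lincomb_cosf by (blast intro: integrable_on_bounded_open[OF open_triangle bounded_triangle])+
    then show ?case using 1 add_term.IH by simp
  qed simp
qed

text \<open>This also covers modes of equal eigenvalue. The product of two alternating functions is
  symmetric, its frequencies are the k' + l' and k' - l', and the hypothesis excludes 0 among
  them.\<close>

lemma triangle_alt_orthogonal:
  assumes "\<And>k' l'. k' \<in> freq_orbit k \<Longrightarrow> l' \<in> freq_orbit l \<Longrightarrow> k' \<noteq> l' \<and> k' \<noteq> - l'"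
  shows "integral\<^sup>L (lebesgue_on triangle_30_60_90) (\<lambda>x. alternation (cosf k) (torus_pos x) * alternation (cosf l) (torus_pos x)) = 0"
proof (rule triangle_integral_symmetric_lincomb[where F="\<lambda>z. alternation (cosf k) z * alternation (cosf l) z" and I="{m. m \<noteq> 0}"])
  show "lincomb cosf {m. m \<noteq> 0} (\<lambda>z. alternation (cosf k) z * alternation (cosf l) z)"
    by (rule lincomb_cosf_mult[OF lincomb_alt_cosf lincomb_alt_cosf]) (use assms in \<open>auto simp: eq_neg_iff_add_eq_0\<close>)
  have a: "alternation f (c, a) = - alternation f (a, c)" "alternation f (a, - a - c) = - alternation f (a, c)" for f a c
    using alternating_alternation unfolding alternating_def by blast+
  show "symmetric (\<lambda>z. alternation (cosf k) z * alternation (cosf l) z)"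
    unfolding symmetric_def a(2) by (metis a(1) minus_mult_minus)
qed simp

text \<open>A frequency shared up to sign would make the two modes equal or opposite, and then their
  values at z and w would agree for both or for neither.\<close>

lemma triangle_alt_orthogonal_pq:
  assumes "alternation (cosf k) z = alternation (cosf k) w" "alternation (cosf l) z \<noteq> alternation (cosf l) w"
  shows "integral\<^sup>L (lebesgue_on triangle_30_60_90) (\<lambda>x. alternation (cosf k) (torus_pos x) * alternation (cosf l) (torus_pos x)) = 0"
proof (rule triangle_alt_orthogonal, rule ccontr)
  fix k' l' assume "k' \<in> freq_orbit k" "l' \<in> freq_orbit l" "\<not> (k' \<noteq> l' \<and> k' \<noteq> - l')"
  then have "alternation (cosf k') = alternation (cosf l')" by (metis alt_cosf_uminus)
  then have "(\<forall>z. alternation (cosf l) z = alternation (cosf k) z) \<or> (\<forall>z. alternation (cosf l) z = - alternation (cosf k) z)"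
    using alt_cosf_orbit[OF \<open>k' \<in> freq_orbit k\<close>] alt_cosf_orbit[OF \<open>l' \<in> freq_orbit l\<close>] by (metis minus_minus)
  then show False using assms by metis
qed

section \<open>The triangle in torus coordinates\<close>

lemma torus_pos_closure: "x \<in> closure triangle_30_60_90 \<Longrightarrow> in_alcove (torus_pos x)"
proof -
  assume "x \<in> closure triangle_30_60_90"
  then have x: "x $ 2 \<ge> 0" "x $ 1 \<ge> sqrt 3 * x $ 2" "x $ 1 \<le> sqrt 3 / 2" using closure_triangle by auto
  have "2 * pi / sqrt 3 * x $ 1 \<ge> 2 * pi / sqrt 3 * (sqrt 3 * x $ 2)" using x by (intro mult_left_mono) auto
  moreover have "2 * pi / sqrt 3 * x $ 1 \<le> 2 * pi / sqrt 3 * (sqrt 3 / 2)" using x by (intro mult_left_mono) auto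
  ultimately show ?thesis using x by (auto simp: in_alcove_def torus_pos_def)
qed

lemma weyl_denom_triangle: "x \<in> triangle_30_60_90 \<Longrightarrow> weyl_denom (torus_pos x) > 0"
proof -
  assume "x \<in> triangle_30_60_90"
  then have x: "x $ 2 > 0" "x $ 1 > sqrt 3 * x $ 2" "x $ 1 < sqrt 3 / 2" by (auto simp: mem_triangle)
  have "2 * pi / sqrt 3 * x $ 1 > 2 * pi / sqrt 3 * (sqrt 3 * x $ 2)" using x by (intro mult_strict_left_mono) auto
  moreover have "2 * pi / sqrt 3 * x $ 1 < 2 * pi / sqrt 3 * (sqrt 3 / 2)" using x by (intro mult_strict_left_mono) auto
  ultimately show ?thesis using x unfolding torus_pos_def by (intro weyl_denom_pos) auto
qed

lemma torus_pos_inj: "torus_pos x = torus_pos y \<Longrightarrow> x = y"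
  by (auto simp: torus_pos_def vec_eq_iff forall_2)

section \<open>Density of the modes\<close>

text \<open>The quotient g / W is regularised to g W / (W^2 + delta), with error g delta / (W^2 +
  delta). The error is below epsilon where |g| is; on the compact rest W is bounded away from
  0.\<close>

lemma approximate_by_quotient:
  fixes g W :: "'a::metric_space \<Rightarrow> real"
  assumes S: "compact S" and g: "continuous_on S g" and W: "continuous_on S W"
    and z: "\<And>x. x \<in> S \<Longrightarrow> W x = 0 \<Longrightarrow> g x = 0" and \<epsilon>: "\<epsilon> > 0"
  shows "\<exists>h. continuous_on S h \<and> (\<forall>x\<in>S. \<bar>g x - W x * h x\<bar> < \<epsilon>)"
proof -
  have "bounded (g ` S)" using compact_continuous_image[OF g S] compact_imp_bounded by blast
  then obtain G0 where "\<forall>x\<in>S. \<bar>g x\<bar> \<le> G0" by (auto simp: bounded_iff)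
  then obtain G where G: "G > 0" "\<And>x. x \<in> S \<Longrightarrow> \<bar>g x\<bar> \<le> G" by (metis less_max_iff_disj max.coboundedI2 max.commute zero_less_one)
  define K where "K = {x \<in> S. \<epsilon> \<le> \<bar>g x\<bar>}"
  have "compact K"
  proof -
    have "closedin (top_of_set S) (S \<inter> (\<lambda>x. \<bar>g x\<bar>) -` {\<epsilon>..})"
      by (intro continuous_closedin_preimage continuous_intros g)
    moreover have "S \<inter> (\<lambda>x. \<bar>g x\<bar>) -` {\<epsilon>..} = K" by (auto simp: K_def)
    ultimately show ?thesis using closedin_compact[OF S] by simp
  qed
  have "\<exists>m>0. \<forall>x\<in>K. m \<le> (W x)\<^sup>2"
  proof (cases "K = {}")
    case True then show ?thesis by (intro exI[of _ 1]) auto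
  next
    case False
    have "continuous_on K (\<lambda>x. (W x)\<^sup>2)"
      by (intro continuous_intros continuous_on_subset[OF W]) (auto simp: K_def)
    then obtain x0 where x0: "x0 \<in> K" "\<forall>x\<in>K. (W x0)\<^sup>2 \<le> (W x)\<^sup>2"
      using continuous_attains_inf[OF \<open>compact K\<close> False] by blast
    have "W x0 \<noteq> 0" using z[of x0] x0(1) \<epsilon> by (auto simp: K_def)
    then show ?thesis using x0 by (intro exI[of _ "(W x0)\<^sup>2"]) auto
  qed
  then obtain m where m: "m > 0" "\<And>x. x \<in> K \<Longrightarrow> m \<le> (W x)\<^sup>2" by blast
  \<comment> \<open>Chosen to make G * (delta / m), which bounds the error on \<open>K\<close>,
    equal to epsilon.\<close>
  define \<delta> where "\<delta> = \<epsilon> * m / G"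
  have \<delta>: "\<delta> > 0" using \<epsilon> m G by (simp add: \<delta>_def)
  have denom_pos: "(W x)\<^sup>2 + \<delta> > 0" for x using \<delta> by (simp add: add_nonneg_pos)
  define h where "h x = g x * W x / ((W x)\<^sup>2 + \<delta>)" for x
  have "continuous_on S h" unfolding h_def
    by (intro continuous_intros g W) (use denom_pos in \<open>simp add: less_imp_neq[THEN not_sym]\<close>)
  moreover have "\<bar>g x - W x * h x\<bar> < \<epsilon>" if x: "x \<in> S" for x
  proof -
    have "g x - W x * h x = g x * (\<delta> / ((W x)\<^sup>2 + \<delta>))"
      using denom_pos[of x] by (simp add: h_def field_simps power2_eq_square)
    then have eq: "\<bar>g x - W x * h x\<bar> = \<bar>g x\<bar> * (\<delta> / ((W x)\<^sup>2 + \<delta>))"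
      using denom_pos[of x] \<delta> by (simp add: abs_mult)
    show ?thesis
    proof (cases "x \<in> K")
      case True
      have lt: "\<delta> / ((W x)\<^sup>2 + \<delta>) < \<delta> / m"
        using m(2)[OF True] m(1) \<delta> by (intro divide_strict_left_mono mult_pos_pos) auto
      have "\<bar>g x\<bar> * (\<delta> / ((W x)\<^sup>2 + \<delta>)) \<le> G * (\<delta> / ((W x)\<^sup>2 + \<delta>))"
        using G(2)[OF x] denom_pos[of x] \<delta> by (intro mult_right_mono) auto
      also have "\<dots> < G * (\<delta> / m)" using lt G(1) by (rule mult_strict_left_mono)
      also have "\<dots> = \<epsilon>" using G m by (simp add: \<delta>_def)
      finally show ?thesis using eq by simp
    next
      case False
      then have "\<bar>g x\<bar> < \<epsilon>" using x by (auto simp: K_def)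
      moreover have "\<delta> / ((W x)\<^sup>2 + \<delta>) \<le> 1" using denom_pos[of x] by simp
      then have "\<bar>g x\<bar> * (\<delta> / ((W x)\<^sup>2 + \<delta>)) \<le> \<bar>g x\<bar> * 1" by (intro mult_left_mono) auto
      ultimately show ?thesis using eq by simp
    qed
  qed
  ultimately show ?thesis by blast
qed

text \<open>Alternating functions are not closed under products, so Stone-Weierstrass cannot be
  applied to them directly; the symmetric ones form an algebra with constants, and dividing by the
  Weyl denominator leads to them.\<close>

lemma alternating_dense:
  assumes g: "continuous_on (closure triangle_30_60_90) g" "\<And>x. x \<in> frontier triangle_30_60_90 \<Longrightarrow> g x = (0::real)"
    and \<epsilon>: "\<epsilon> > 0"
  shows "\<exists>F. lincomb cosf UNIV F \<and> alternating F \<and> (\<forall>x\<in>closure triangle_30_60_90. \<bar>g x - F (torus_pos x)\<bar> < \<epsilon>)"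
proof -
  let ?S = "closure triangle_30_60_90"
  have S: "compact ?S" using bounded_triangle by simp
  define W where "W x = weyl_denom (torus_pos x)" for x
  have W: "continuous_on ?S W" unfolding W_def using lincomb_weyl_denom by (rule continuous_lincomb_cosf)
  have "bounded (W ` ?S)" using compact_continuous_image[OF W S] compact_imp_bounded by blast
  then obtain B0 where "\<forall>x\<in>?S. \<bar>W x\<bar> \<le> B0" by (auto simp: bounded_iff)
  then obtain B where B: "B > 0" "\<And>x. x \<in> ?S \<Longrightarrow> \<bar>W x\<bar> \<le> B" by (metis less_max_iff_disj max.coboundedI2 max.commute zero_less_one)
  \<comment> \<open>\<open>W\<close> is positive in the open triangle, so its zeros in the closure
    lie on the frontier.\<close>
  have "g x = 0" if "x \<in> ?S" "W x = 0" for x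
    using that weyl_denom_triangle[of x] g(2)[of x] open_triangle by (auto simp: W_def frontier_def interior_open)
  then obtain h0 where h0: "continuous_on ?S h0" "\<And>x. x \<in> ?S \<Longrightarrow> \<bar>g x - W x * h0 x\<bar> < \<epsilon> / 2"
    using approximate_by_quotient[OF S g(1) W, of "\<epsilon> / 2"] \<epsilon> by (metis half_gt_zero)
  define R where "R = {\<lambda>x. h (torus_pos x) | h. lincomb cosf UNIV h \<and> symmetric h}"
  interpret function_ring_on R ?S
  proof
    show "compact ?S" by (rule S)
    show "continuous_on ?S f" if "f \<in> R" for f using that continuous_lincomb_cosf by (auto simp: R_def)
    show "(\<lambda>x. f x + g x) \<in> R" if fg: "f \<in> R" "g \<in> R" for f g
    proof -
      obtain h k where "f = (\<lambda>x. h (torus_pos x))" "lincomb cosf UNIV h" "symmetric h" "g = (\<lambda>x. k (torus_pos x))" "lincomb cosf UNIV k" "symmetric k"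
        using fg unfolding R_def by blast
      then show ?thesis unfolding R_def
        by (intro CollectI exI[of _ "\<lambda>z. h z + k z"]) (auto intro: lincomb_add simp: symmetric_def)
    qed
    show "(\<lambda>x. f x * g x) \<in> R" if fg: "f \<in> R" "g \<in> R" for f g
    proof -
      obtain h k where "f = (\<lambda>x. h (torus_pos x))" "lincomb cosf UNIV h" "symmetric h" "g = (\<lambda>x. k (torus_pos x))" "lincomb cosf UNIV k" "symmetric k"
        using fg unfolding R_def by blast
      then show ?thesis unfolding R_def
        by (intro CollectI exI[of _ "\<lambda>z. h z * k z"]) (auto intro: lincomb_cosf_mult[where A=UNIV and B=UNIV] simp: symmetric_def)
    qed
    show "(\<lambda>_. c) \<in> R" for c unfolding R_def
      by (intro CollectI exI[of _ "\<lambda>z. c"]) (auto intro: lincomb_one simp: symmetric_def)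
    show "\<exists>f\<in>R. f x \<noteq> f y" if "x \<in> ?S" "y \<in> ?S" "x \<noteq> y" for x y
    proof (rule ccontr)
      assume n: "\<not> (\<exists>f\<in>R. f x \<noteq> f y)"
      have n': "f x = f y" if "f \<in> R" for f using n that by blast
      have "(\<lambda>x. trace_re (torus_pos x)) \<in> R" "(\<lambda>x. trace_mod (torus_pos x)) \<in> R"
        unfolding R_def using lincomb_trace_re symmetric_trace_re lincomb_trace_mod symmetric_trace_mod by blast+
      note n'[OF this(1)] n'[OF this(2)]
      then have "torus_pos x = torus_pos y"
        using alcove_separation[of "fst (torus_pos x)" "snd (torus_pos x)" "fst (torus_pos y)" "snd (torus_pos y)"] torus_pos_closure[OF that(1)] torus_pos_closure[OF that(2)]
        by (simp add: prod_eq_iff)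
      then show False using torus_pos_inj that(3) by blast
    qed
  qed
  \<comment> \<open>The tolerance is divided by the bound B on |W| to allow for the later
    multiplication by \<open>W\<close>.\<close>
  obtain h where h: "lincomb cosf UNIV h" "symmetric h" "\<And>x. x \<in> ?S \<Longrightarrow> \<bar>h0 x - h (torus_pos x)\<bar> < \<epsilon> / (2 * B)"
    using Stone_Weierstrass_basic[OF h0(1), of "\<epsilon> / (2 * B)"] \<epsilon> B by (auto simp: R_def)
  define F where "F z = weyl_denom z * h z" for z
  have "lincomb cosf UNIV F" unfolding F_def by (rule lincomb_cosf_mult[OF lincomb_weyl_denom h(1)]) auto
  moreover have "alternating F"
  proof -
    have w: "weyl_denom (c, a) = - weyl_denom (a, c)" "weyl_denom (a, - a - c) = - weyl_denom (a, c)" for a c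
      using alternating_weyl_denom unfolding alternating_def by blast+
    have s: "h (c, a) = h (a, c)" "h (a, - a - c) = h (a, c)" for a c
      using h(2) unfolding symmetric_def by blast+
    have "F (c, a) = - F (a, c)" "F (a, - a - c) = - F (a, c)" for a c
      unfolding F_def using w(1)[of c a] s(1)[of c a] w(2)[of a c] s(2)[of a c] by simp_all
    then show ?thesis unfolding alternating_def by blast
  qed
  moreover have "\<bar>g x - F (torus_pos x)\<bar> < \<epsilon>" if x: "x \<in> ?S" for x
  proof -
    have "\<bar>W x\<bar> * \<bar>h0 x - h (torus_pos x)\<bar> \<le> B * (\<epsilon> / (2 * B))"
      using B x h(3)[OF x] by (intro mult_mono) auto
    then have "\<bar>W x * h0 x - F (torus_pos x)\<bar> \<le> \<epsilon> / 2"
      using B by (simp add: F_def W_def[symmetric] right_diff_distrib[symmetric] abs_mult)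
    then show ?thesis using h0(2)[OF x] by linarith
  qed
  ultimately show ?thesis by blast
qed

definition alt_mode :: "int \<times> int \<Rightarrow> real ^ 2 \<Rightarrow> complex" where
  "alt_mode k x = complex_of_real (alternation (cosf k) (torus_pos x))"

lemma lincomb_alt_mode:
  assumes "lincomb cosf I F" "alternating F"
  shows "lincomb alt_mode I (\<lambda>x. complex_of_real (F (torus_pos x)))"
  using lincomb_alternating[OF assms]
proof induction
  case (add_term f k c)
  then have "lincomb alt_mode I (\<lambda>x. complex_of_real (f (torus_pos x)) + of_real c * alt_mode k x)"
    by (intro lincomb.add_term)
  then show ?case unfolding of_real_add of_real_mult alt_mode_def[symmetric] .
qed (simp add: lincomb.zero)

lemma alt_mode_dense:
  assumes g: "continuous_on (closure triangle_30_60_90) g" "\<And>x. x \<in> frontier triangle_30_60_90 \<Longrightarrow> g x = (0::complex)"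
    and \<epsilon>: "\<epsilon> > 0"
  shows "\<exists>f. lincomb alt_mode UNIV f \<and> (\<forall>x\<in>closure triangle_30_60_90. cmod (g x - f x) < \<epsilon>)"
proof -
  obtain F where F: "lincomb cosf UNIV F" "alternating F" "\<And>x. x \<in> closure triangle_30_60_90 \<Longrightarrow> \<bar>Re (g x) - F (torus_pos x)\<bar> < \<epsilon> / 2"
    using alternating_dense[of "\<lambda>x. Re (g x)" "\<epsilon> / 2"] g \<epsilon> by (auto intro: continuous_intros)
  obtain G where G: "lincomb cosf UNIV G" "alternating G" "\<And>x. x \<in> closure triangle_30_60_90 \<Longrightarrow> \<bar>Im (g x) - G (torus_pos x)\<bar> < \<epsilon> / 2"
    using alternating_dense[of "\<lambda>x. Im (g x)" "\<epsilon> / 2"] g \<epsilon> by (auto intro: continuous_intros)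
  define f where "f x = complex_of_real (F (torus_pos x)) + \<i> * complex_of_real (G (torus_pos x))" for x
  have "lincomb alt_mode UNIV f" unfolding f_def
    by (intro lincomb_add lincomb_scale lincomb_alt_mode F G)
  moreover have "cmod (g x - f x) < \<epsilon>" if "x \<in> closure triangle_30_60_90" for x
    using cmod_le[of "g x - f x"] F(3)[OF that] G(3)[OF that] by (simp add: f_def)
  ultimately show ?thesis by blast
qed

lemma continuous_alt_mode: "continuous_on S (alt_mode k)"
proof -
  have "lincomb cosf UNIV (alternation (cosf k))" using lincomb_alt_cosf lincomb_mono by blast
  then show ?thesis unfolding alt_mode_def[abs_def] by (intro continuous_intros continuous_lincomb_cosf)
qed

lemma continuous_lincomb_alt_mode: "lincomb alt_mode I f \<Longrightarrow> continuous_on S f"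
  by (induction rule: lincomb.induct) (auto intro!: continuous_intros continuous_alt_mode)

section \<open>Comparison at the two points\<close>

text \<open>The set where h is nonzero is open, and a nonempty open set is not negligible. This
  turns an identity in mean square into a pointwise one.\<close>

lemma integral_eq_0_imp_zero:
  fixes h :: "'a::euclidean_space \<Rightarrow> real"
  assumes S: "open S" and h: "continuous_on S h" "integrable (lebesgue_on S) h" "\<And>x. h x \<ge> 0"
    and 0: "integral\<^sup>L (lebesgue_on S) h = 0" and x: "x \<in> S"
  shows "h x = 0"
proof (rule ccontr)
  assume nz: "h x \<noteq> 0"
  let ?U = "S \<inter> h -` (- {0})"
  have U: "open ?U" using h(1) S by (intro continuous_open_preimage) auto
  have "AE x in lebesgue_on S. h x = 0"
    using integral_nonneg_eq_0_iff_AE[OF h(2)] h(3) 0 by simp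
  then have "AE x in lebesgue. x \<in> S \<longrightarrow> h x = 0"
    using S by (subst (asm) AE_restrict_space_iff) auto
  then have "{x. \<not> (x \<in> S \<longrightarrow> h x = 0)} \<in> null_sets lebesgue"
    by (rule AE_E3) (auto intro: negligible_iff_null_sets[THEN iffD1] negligible_subset simp: negligible_iff_null_sets[symmetric])
  then have "negligible ?U" by (auto simp: negligible_iff_null_sets[symmetric] elim: negligible_subset)
  moreover have "?U \<noteq> {}" using x nz by auto
  ultimately show False using open_not_negligible[OF U] by blast
qed

section \<open>Comparison of the modes with an arbitrary eigenbasis\<close>

context
  fixes e :: "nat \<Rightarrow> real ^ 2 \<Rightarrow> complex" and lam :: "nat \<Rightarrow> real"
  assumes basis: "dirichlet_eigenbasis triangle_30_60_90 e lam"
begin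

lemma eigenfunction_props: "C2_on triangle_30_60_90 (e j)"
  "x \<in> triangle_30_60_90 \<Longrightarrow> laplacian (e j) x = - of_real ((lam j)\<^sup>2) * e j x"
  "continuous_on (closure triangle_30_60_90) (e j)" "\<forall>x\<in>frontier triangle_30_60_90. e j x = 0"
  using basis unfolding dirichlet_eigenbasis_def by blast+

lemma lam_pos: "lam j > 0"
proof -
  have "lam 0 > 0" "mono lam" using basis unfolding dirichlet_eigenbasis_def by auto
  then show ?thesis using monoD[of lam 0 j] by simp
qed

lemma finite_lam_le: "finite {j. lam j \<le> L}"
proof -
  have "filterlim lam at_top sequentially" using basis unfolding dirichlet_eigenbasis_def by blast
  then have "\<forall>\<^sub>F j in sequentially. L < lam j" by (simp add: filterlim_at_top_dense)
  then obtain N where "\<And>j. j \<ge> N \<Longrightarrow> L < lam j" by (auto simp: eventually_sequentially)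
  then have "j < N" if "lam j \<le> L" for j using that by (cases "N \<le> j") (force simp: not_le[symmetric])+
  then have "{j. lam j \<le> L} \<subseteq> {..<N}" by auto
  then show ?thesis by (rule finite_subset) simp
qed

lemma finite_lam_eq: "finite {j. lam j = \<mu>}"
  by (rule finite_subset[OF _ finite_lam_le[of \<mu>]]) auto

lemma integrable_triangle:
  "continuous_on (closure triangle_30_60_90) f \<Longrightarrow> integrable (lebesgue_on triangle_30_60_90) f"
  for f :: "real ^ 2 \<Rightarrow> 'b::{banach,second_countable_topology}"
  by (rule integrable_on_bounded_open[OF open_triangle bounded_triangle])

lemma L2_inner_alt_mode:
  assumes "k \<in> shell \<nu>" "\<nu> \<noteq> (lam j)\<^sup>2"
  shows "L2_inner triangle_30_60_90 (alt_mode k) (e j) = 0"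
proof -
  have "freq_orbit k \<subseteq> shell \<nu>" using assms freq_norm_orbit unfolding shell_def by fastforce
  then have "lincomb cosf (shell \<nu>) (alternation (cosf k))" using lincomb_alt_cosf lincomb_mono by blast
  then have "integral\<^sup>L (lebesgue_on triangle_30_60_90) (\<lambda>x. alternation (cosf k) (torus_pos x) *\<^sub>R e j x) = 0"
    using triangle_orthogonal_to_shell[OF _ alternating_alternation eigenfunction_props(1,2) eigenfunction_props(3,4)] assms by metis
  then have "cnj (integral\<^sup>L (lebesgue_on triangle_30_60_90) (\<lambda>x. alternation (cosf k) (torus_pos x) *\<^sub>R e j x)) = 0" by simp
  then show ?thesis unfolding Bochner_Integration.integral_cnj[symmetric] by (simp add: L2_inner_def alt_mode_def scaleR_conv_of_real)
qed

lemma L2_inner_add_scaled: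
  assumes "continuous_on (closure triangle_30_60_90) f" "continuous_on (closure triangle_30_60_90) g"
    "continuous_on (closure triangle_30_60_90) h"
  shows "L2_inner triangle_30_60_90 (\<lambda>x. f x + c * g x) h = L2_inner triangle_30_60_90 f h + c * L2_inner triangle_30_60_90 g h"
proof -
  have "integrable (lebesgue_on triangle_30_60_90) (\<lambda>x. f x * cnj (h x))" "integrable (lebesgue_on triangle_30_60_90) (\<lambda>x. g x * cnj (h x))"
    by (intro integrable_triangle continuous_intros assms)+
  then show ?thesis unfolding L2_inner_def by (simp add: distrib_right mult.assoc)
qed

lemma L2_inner_shell:
  assumes "lincomb alt_mode I f" "\<And>k. k \<in> I \<Longrightarrow> k \<notin> shell ((lam j)\<^sup>2)"
  shows "L2_inner triangle_30_60_90 f (e j) = 0"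
  using assms(1)
proof induction
  case zero show ?case by (simp add: L2_inner_def)
next
  case (add_term f k c)
  have "L2_inner triangle_30_60_90 (alt_mode k) (e j) = 0"
    using L2_inner_alt_mode[of k "freq k \<bullet> freq k" j] assms(2)[OF add_term.hyps(2)] by (auto simp: shell_def)
  then show ?case using add_term.IH continuous_lincomb_alt_mode[OF add_term.hyps(1)]
    by (subst L2_inner_add_scaled) (auto intro: continuous_alt_mode eigenfunction_props)
qed

text \<open>Coefficients at other eigenvalues vanish, so the partial sums of the expansion are
  eventually constant. Completeness makes the remaining error 0 in mean square, and continuity makes
  it 0 at every point.\<close>

lemma shell_expansion:
  assumes f: "lincomb alt_mode (shell (\<mu>\<^sup>2)) f" and \<mu>: "\<mu> > 0" and x: "x \<in> triangle_30_60_90"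
  shows "f x = (\<Sum>j | lam j = \<mu>. L2_inner triangle_30_60_90 f (e j) * e j x)"
proof -
  let ?T = triangle_30_60_90
  let ?J = "{j. lam j = \<mu>}"
  have cf: "continuous_on S f" for S using f by (rule continuous_lincomb_alt_mode)
  have z: "L2_inner ?T f (e j) = 0" if "j \<notin> ?J" for j
  proof (rule L2_inner_shell[OF f])
    have "(lam j)\<^sup>2 \<noteq> \<mu>\<^sup>2" using that lam_pos[of j] \<mu> by (auto simp: power2_eq_iff)
    then show "k \<notin> shell ((lam j)\<^sup>2)" if "k \<in> shell (\<mu>\<^sup>2)" for k using that by (auto simp: shell_def)
  qed
  obtain N where N: "?J \<subseteq> {..<N}" using finite_nat_iff_bounded finite_lam_eq by blast
  have eq: "(\<Sum>j<n. L2_inner ?T f (e j) * e j x) = (\<Sum>j\<in>?J. L2_inner ?T f (e j) * e j x)" if "n \<ge> N" for n x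
    by (rule sum.mono_neutral_right) (use z N that in auto)
  define h where "h x = (cmod (f x - (\<Sum>j\<in>?J. L2_inner ?T f (e j) * e j x)))\<^sup>2" for x
  have ch: "continuous_on (closure ?T) h" unfolding h_def
    by (intro continuous_intros cf eigenfunction_props(3))
  have "continuous_on (closure ?T) (\<lambda>x. (cmod (f x))\<^sup>2)" by (intro continuous_intros cf)
  then have "square_integrable_on f ?T"
    unfolding square_integrable_on_def
    using borel_measurable_integrable[OF integrable_triangle[OF cf]] integrable_triangle by blast
  then have "(\<lambda>n. integral\<^sup>L (lebesgue_on ?T) (\<lambda>x. (cmod (f x - (\<Sum>j<n. L2_inner ?T f (e j) * e j x)))\<^sup>2)) \<longlonglongrightarrow> 0"
    using basis unfolding dirichlet_eigenbasis_def L2_orthonormal_basis_def by blast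
  moreover have "\<forall>\<^sub>F n in sequentially. integral\<^sup>L (lebesgue_on ?T) (\<lambda>x. (cmod (f x - (\<Sum>j<n. L2_inner ?T f (e j) * e j x)))\<^sup>2) = integral\<^sup>L (lebesgue_on ?T) h"
    unfolding eventually_sequentially by (rule exI[of _ N]) (simp add: eq h_def[abs_def])
  ultimately have "(\<lambda>n. integral\<^sup>L (lebesgue_on ?T) h) \<longlonglongrightarrow> 0" by (rule Lim_transform_eventually)
  then have "integral\<^sup>L (lebesgue_on ?T) h = 0" by (simp add: LIMSEQ_const_iff)
  then have "h x = 0"
    using integral_eq_0_imp_zero[OF open_triangle continuous_on_subset[OF ch closure_subset] integrable_triangle[OF ch]] x
    by (simp add: h_def)
  then show ?thesis by (simp add: h_def)
qed

text \<open>Parseval's identity, from inserting the finite expansion into one of the two factors of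
  |f|^2.\<close>

lemma shell_norm:
  assumes f: "lincomb alt_mode (shell (\<mu>\<^sup>2)) f" and \<mu>: "\<mu> > 0"
  shows "integral\<^sup>L (lebesgue_on triangle_30_60_90) (\<lambda>x. (cmod (f x))\<^sup>2) = (\<Sum>j | lam j = \<mu>. (cmod (L2_inner triangle_30_60_90 f (e j)))\<^sup>2)"
proof -
  let ?T = triangle_30_60_90
  let ?c = "\<lambda>j. L2_inner ?T f (e j)"
  have cf: "continuous_on S f" for S using f by (rule continuous_lincomb_alt_mode)
  have i: "integrable (lebesgue_on ?T) (\<lambda>x. e j x * cnj (f x))" for j
    by (intro integrable_triangle continuous_intros cf eigenfunction_props)
  have "complex_of_real (integral\<^sup>L (lebesgue_on ?T) (\<lambda>x. (cmod (f x))\<^sup>2)) = integral\<^sup>L (lebesgue_on ?T) (\<lambda>x. f x * cnj (f x))"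
    by (subst integral_complex_of_real[symmetric]) (simp only: complex_norm_square)
  also have "\<dots> = integral\<^sup>L (lebesgue_on ?T) (\<lambda>x. \<Sum>j | lam j = \<mu>. ?c j * (e j x * cnj (f x)))"
  proof (rule Bochner_Integration.integral_cong[OF refl])
    fix x assume "x \<in> space (lebesgue_on ?T)"
    then have "x \<in> ?T" by (simp add: space_restrict_space)
    from shell_expansion[OF f \<mu> this] have "f x * cnj (f x) = (\<Sum>j | lam j = \<mu>. ?c j * e j x) * cnj (f x)" by metis
    then show "f x * cnj (f x) = (\<Sum>j | lam j = \<mu>. ?c j * (e j x * cnj (f x)))" by (simp add: sum_distrib_right mult.assoc)
  qed
  also have "\<dots> = (\<Sum>j | lam j = \<mu>. ?c j * integral\<^sup>L (lebesgue_on ?T) (\<lambda>x. e j x * cnj (f x)))"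
    using i by (subst Bochner_Integration.integral_sum) auto
  also have "\<dots> = (\<Sum>j | lam j = \<mu>. ?c j * cnj (?c j))"
    unfolding L2_inner_def Bochner_Integration.integral_cnj[symmetric] by (simp add: mult.commute)
  also have "\<dots> = complex_of_real (\<Sum>j | lam j = \<mu>. (cmod (?c j))\<^sup>2)" by (simp only: of_real_sum complex_norm_square)
  finally show ?thesis by (simp only: of_real_eq_iff)
qed

text \<open>The sign relating the values at \<open>p\<close> and \<open>q\<close> is the same for all modes in an orbit, so modes with
  different signs have no frequency in common and their product has no constant term.\<close>

lemma split_orthogonal:
  assumes "lincomb alt_mode (I \<inter> {k. alt_mode k p = alt_mode k q}) g" "lincomb alt_mode (I - {k. alt_mode k p = alt_mode k q}) h"
  shows "L2_inner triangle_30_60_90 g h = 0"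
proof -
  let ?T = triangle_30_60_90
  have 1: "L2_inner ?T (alt_mode k) (alt_mode l) = 0" if "alt_mode k p = alt_mode k q" "alt_mode l p \<noteq> alt_mode l q" for k l
  proof -
    have "integral\<^sup>L (lebesgue_on ?T) (\<lambda>x. alternation (cosf k) (torus_pos x) * alternation (cosf l) (torus_pos x)) = 0"
      using triangle_alt_orthogonal_pq[of k "torus_pos p" "torus_pos q" l] that by (simp add: alt_mode_def)
    then show ?thesis unfolding L2_inner_def alt_mode_def
      by (simp flip: of_real_mult)
  qed
  have 2: "L2_inner ?T g (alt_mode l) = 0" if "alt_mode l p \<noteq> alt_mode l q" for l
    using assms(1)
  proof induction
    case zero show ?case by (simp add: L2_inner_def)
  next
    case (add_term f k c)
    then show ?case using 1[of k l] that continuous_lincomb_alt_mode[OF add_term.hyps(1)]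
      by (subst L2_inner_add_scaled) (auto intro: continuous_alt_mode)
  qed
  have c: "L2_inner ?T u v = cnj (L2_inner ?T v u)" for u v
    unfolding L2_inner_def Bochner_Integration.integral_cnj[symmetric] by (simp add: mult.commute)
  have "L2_inner ?T h g = 0"
    using assms(2)
  proof induction
    case zero show ?case by (simp add: L2_inner_def)
  next
    case (add_term f k c)
    have "L2_inner ?T (alt_mode k) g = 0" using 2[of k] add_term.hyps(2) by (subst \<open>\<And>u v. L2_inner ?T u v = cnj (L2_inner ?T v u)\<close>) simp
    then show ?case using add_term.IH continuous_lincomb_alt_mode[OF add_term.hyps(1)] continuous_lincomb_alt_mode[OF assms(1)]
      by (subst L2_inner_add_scaled) (auto intro: continuous_alt_mode)
  qed
  then show ?thesis using c[of g h] by simp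
qed

text \<open>Split f = g + h into the modes with equal and with opposite values at p and q. Then u =
  g - h satisfies u q = f p, and it has the norm of f because g and h are orthogonal. Cauchy-Schwarz
  for the expansion of u at q does the rest.\<close>

lemma shell_point_bound:
  assumes f: "lincomb alt_mode (shell (\<mu>\<^sup>2)) f" and \<mu>: "\<mu> > 0"
    and pq: "p \<in> triangle_30_60_90" "q \<in> triangle_30_60_90" "\<And>k. alt_mode k p = alt_mode k q \<or> alt_mode k p = - alt_mode k q"
  shows "(cmod (f p))\<^sup>2 \<le> (\<Sum>j | lam j = \<mu>. (cmod (L2_inner triangle_30_60_90 f (e j)))\<^sup>2) * (\<Sum>j | lam j = \<mu>. (cmod (e j q))\<^sup>2)"
proof -
  let ?T = triangle_30_60_90
  let ?A = "{k. alt_mode k p = alt_mode k q}"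
  obtain g h where gh: "lincomb alt_mode (shell (\<mu>\<^sup>2) \<inter> ?A) g" "lincomb alt_mode (shell (\<mu>\<^sup>2) - ?A) h" "f = (\<lambda>x. g x + h x)"
    using lincomb_split[OF f] by blast
  define u where "u x = g x - h x" for x
  have u: "lincomb alt_mode (shell (\<mu>\<^sup>2)) u" unfolding u_def
    by (intro lincomb_diff) (use gh lincomb_mono in \<open>blast+\<close>)
  have "g p = g q" using gh(1) by induction auto
  moreover have "h p = - h q" using gh(2)
  proof induction
    case (add_term f k c)
    then have "alt_mode k p = - alt_mode k q" using pq(3)[of k] by auto
    then show ?case using add_term.IH by simp
  qed simp
  ultimately have fu: "f p = u q" by (simp add: gh(3) u_def)
  have cg: "continuous_on S g" "continuous_on S h" for S using gh continuous_lincomb_alt_mode by blast+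
  have norm: "integral\<^sup>L (lebesgue_on ?T) (\<lambda>x. (cmod (u x))\<^sup>2) = integral\<^sup>L (lebesgue_on ?T) (\<lambda>x. (cmod (f x))\<^sup>2)"
  proof -
    have i: "integrable (lebesgue_on ?T) (\<lambda>x. (cmod (g x))\<^sup>2 + (cmod (h x))\<^sup>2)" "integrable (lebesgue_on ?T) (\<lambda>x. g x * cnj (h x))"
      by (intro integrable_triangle continuous_intros cg)+
    have "integral\<^sup>L (lebesgue_on ?T) (\<lambda>x. Re (g x * cnj (h x))) = Re (L2_inner ?T g h)"
      unfolding L2_inner_def using i(2) by (rule integral_Re)
    then have r: "integral\<^sup>L (lebesgue_on ?T) (\<lambda>x. Re (g x * cnj (h x))) = 0" using split_orthogonal[OF gh(1,2)] by simp
    have ir: "integrable (lebesgue_on ?T) (\<lambda>x. Re (g x * cnj (h x)))" using i(2) by (rule integrable_Re)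
    have e1: "(cmod (u x))\<^sup>2 = ((cmod (g x))\<^sup>2 + (cmod (h x))\<^sup>2) - 2 * Re (g x * cnj (h x))"
      "(cmod (f x))\<^sup>2 = ((cmod (g x))\<^sup>2 + (cmod (h x))\<^sup>2) + 2 * Re (g x * cnj (h x))" for x
      unfolding cmod_power2 by (simp_all add: u_def gh(3) power2_eq_square algebra_simps)
    have "integral\<^sup>L M (\<lambda>x. a x - 2 * c x) = integral\<^sup>L M (\<lambda>x. a x + 2 * c x)"
      if "integrable M a" "integrable M c" "integral\<^sup>L M c = 0" for M :: "(real ^ 2) measure" and a c :: "real ^ 2 \<Rightarrow> real"
      using that by simp
    then show ?thesis unfolding e1 using i(1) ir r by blast
  qed
  have "cmod (u q) \<le> (\<Sum>j | lam j = \<mu>. cmod (L2_inner ?T u (e j)) * cmod (e j q))"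
    unfolding shell_expansion[OF u \<mu> pq(2)] by (rule order_trans[OF norm_sum]) (simp add: norm_mult)
  then have "(cmod (u q))\<^sup>2 \<le> (\<Sum>j | lam j = \<mu>. cmod (L2_inner ?T u (e j)) * cmod (e j q))\<^sup>2"
    by (intro power_mono) auto
  also have "\<dots> \<le> (\<Sum>j | lam j = \<mu>. (cmod (L2_inner ?T u (e j)))\<^sup>2) * (\<Sum>j | lam j = \<mu>. (cmod (e j q))\<^sup>2)"
    by (rule Cauchy_Schwarz_ineq_sum)
  finally show ?thesis unfolding fu using norm shell_norm[OF u \<mu>] shell_norm[OF f \<mu>] by simp
qed

lemma eigenspace_density_le:
  assumes \<mu>: "\<mu> > 0"
    and pq: "p \<in> triangle_30_60_90" "q \<in> triangle_30_60_90" "\<And>k. alt_mode k p = alt_mode k q \<or> alt_mode k p = - alt_mode k q"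
  shows "(\<Sum>j | lam j = \<mu>. (cmod (e j p))\<^sup>2) \<le> (\<Sum>j | lam j = \<mu>. (cmod (e j q))\<^sup>2)"
proof -
  let ?T = triangle_30_60_90
  let ?J = "{j. lam j = \<mu>}"
  define K where "K x = (\<Sum>j\<in>?J. (cmod (e j x))\<^sup>2)" for x
  \<comment> \<open>The kernel of evaluation at p: its coefficients are \<open>cnj (e i p)\<close>,
    so its value at p and its squared norm are both \<open>K p\<close>.\<close>
  define g where "g x = (\<Sum>j\<in>?J. cnj (e j p) * e j x)" for x
  have cg: "continuous_on (closure ?T) g" unfolding g_def by (intro continuous_intros eigenfunction_props)
  have gz: "g x = 0" if "x \<in> frontier ?T" for x using eigenfunction_props(4) that by (simp add: g_def)
  have ortho: "L2_inner ?T (e i) (e j) = (if i = j then 1 else 0)" for i j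
    using basis unfolding dirichlet_eigenbasis_def L2_orthonormal_basis_def by blast
  have gi: "L2_inner ?T g (e i) = cnj (e i p)" if i: "i \<in> ?J" for i
  proof -
    have "integrable (lebesgue_on ?T) (\<lambda>x. e j x * cnj (e i x))" for j
      by (intro integrable_triangle continuous_intros eigenfunction_props)
    then have "L2_inner ?T g (e i) = (\<Sum>j\<in>?J. cnj (e j p) * L2_inner ?T (e j) (e i))"
      unfolding L2_inner_def g_def by (simp add: sum_distrib_right mult.assoc)
    also have "\<dots> = (\<Sum>j\<in>?J. if j = i then cnj (e j p) else 0)" by (rule sum.cong) (auto simp: ortho)
    also have "\<dots> = cnj (e i p)" using i finite_lam_eq by simp
    finally show ?thesis .
  qed
  have ex: "\<exists>f. lincomb alt_mode (shell (\<mu>\<^sup>2)) f \<and> (\<forall>i\<in>?J. cmod (L2_inner ?T f (e i) - cnj (e i p)) \<le> \<epsilon> * integral\<^sup>L (lebesgue_on ?T) (\<lambda>x. cmod (e i x)))"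
    if \<epsilon>: "\<epsilon> > 0" for \<epsilon>
  proof -
    obtain F where F: "lincomb alt_mode UNIV F" "\<And>x. x \<in> closure ?T \<Longrightarrow> cmod (g x - F x) < \<epsilon>"
      using alt_mode_dense[OF cg gz \<epsilon>] by blast
    \<comment> \<open>The approximant also contains modes of other eigenvalues. These are orthogonal
      to the \<open>e i\<close> with i in \<open>?J\<close>, so dropping them leaves the
      coefficients in question unchanged.\<close>
    obtain f f' where f: "lincomb alt_mode (UNIV \<inter> shell (\<mu>\<^sup>2)) f" "lincomb alt_mode (UNIV - shell (\<mu>\<^sup>2)) f'" "F = (\<lambda>x. f x + f' x)"
      using lincomb_split[OF F(1)] by blast
    have "cmod (L2_inner ?T f (e i) - cnj (e i p)) \<le> \<epsilon> * integral\<^sup>L (lebesgue_on ?T) (\<lambda>x. cmod (e i x))" if i: "i \<in> ?J" for i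
    proof -
      have "L2_inner ?T f' (e i) = 0" using i by (intro L2_inner_shell[OF f(2)]) auto
      then have "L2_inner ?T f (e i) = L2_inner ?T F (e i)"
        using L2_inner_add_scaled[of f f' "e i" 1] continuous_lincomb_alt_mode[OF f(1)] continuous_lincomb_alt_mode[OF f(2)] eigenfunction_props(3)
        by (simp add: f(3))
      moreover have "L2_inner ?T F (e i) - L2_inner ?T g (e i) = integral\<^sup>L (lebesgue_on ?T) (\<lambda>x. (F x - g x) * cnj (e i x))"
        unfolding L2_inner_def left_diff_distrib
        by (intro Bochner_Integration.integral_diff[symmetric] integrable_triangle continuous_intros continuous_lincomb_alt_mode[OF F(1)] cg eigenfunction_props)
      moreover have "cmod (integral\<^sup>L (lebesgue_on ?T) (\<lambda>x. (F x - g x) * cnj (e i x))) \<le> integral\<^sup>L (lebesgue_on ?T) (\<lambda>x. \<epsilon> * cmod (e i x))"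
      proof (rule order_trans[OF integral_norm_bound], rule integral_mono)
        show "integrable (lebesgue_on ?T) (\<lambda>x. cmod ((F x - g x) * cnj (e i x)))" "integrable (lebesgue_on ?T) (\<lambda>x. \<epsilon> * cmod (e i x))"
          by (intro integrable_triangle continuous_intros continuous_lincomb_alt_mode[OF F(1)] cg eigenfunction_props)+
        fix x assume "x \<in> space (lebesgue_on ?T)"
        then have "x \<in> closure ?T" using closure_subset by (auto simp: space_restrict_space)
        from F(2)[OF this] show "cmod ((F x - g x) * cnj (e i x)) \<le> \<epsilon> * cmod (e i x)"
          by (simp add: norm_mult norm_minus_commute mult_right_mono)
      qed
      ultimately show ?thesis using gi[OF i] by simp
    qed
    then show ?thesis using f(1) by auto
  qed
  have "\<exists>f. \<forall>m. lincomb alt_mode (shell (\<mu>\<^sup>2)) (f m) \<and> (\<forall>i\<in>?J. cmod (L2_inner ?T (f m) (e i) - cnj (e i p)) \<le> inverse (real (Suc m)) * integral\<^sup>L (lebesgue_on ?T) (\<lambda>x. cmod (e i x)))"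
    by (rule choice, rule allI, rule ex) simp
  then obtain f where f: "\<And>m. lincomb alt_mode (shell (\<mu>\<^sup>2)) (f m)"
      "\<And>m i. i \<in> ?J \<Longrightarrow> cmod (L2_inner ?T (f m) (e i) - cnj (e i p)) \<le> inverse (real (Suc m)) * integral\<^sup>L (lebesgue_on ?T) (\<lambda>x. cmod (e i x))"
    by blast
  have lim: "(\<lambda>m. L2_inner ?T (f m) (e i)) \<longlonglongrightarrow> cnj (e i p)" if i: "i \<in> ?J" for i
  proof (rule LIM_zero_cancel, rule Lim_null_comparison[OF always_eventually, OF allI])
    show "cmod (L2_inner ?T (f m) (e i) - cnj (e i p)) \<le> inverse (real (Suc m)) * integral\<^sup>L (lebesgue_on ?T) (\<lambda>x. cmod (e i x))" for m
      using f(2)[OF i] .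
    show "(\<lambda>m. inverse (real (Suc m)) * integral\<^sup>L (lebesgue_on ?T) (\<lambda>x. cmod (e i x))) \<longlonglongrightarrow> 0"
      using tendsto_mult_left_zero[OF LIMSEQ_inverse_real_of_nat] by simp
  qed
  \<comment> \<open>The expansion on the shell is a finite sum, so convergence of the coefficients
    gives convergence of the value at p.\<close>
  have "(\<lambda>m. f m p) \<longlonglongrightarrow> (\<Sum>i\<in>?J. cnj (e i p) * e i p)"
    unfolding shell_expansion[OF f(1) \<mu> pq(1)] by (intro tendsto_intros lim)
  then have "(\<lambda>m. (cmod (f m p))\<^sup>2) \<longlonglongrightarrow> (cmod (\<Sum>i\<in>?J. cnj (e i p) * e i p))\<^sup>2" by (intro tendsto_intros)
  moreover have "(\<Sum>i\<in>?J. cnj (e i p) * e i p) = complex_of_real (K p)"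
    unfolding K_def of_real_sum complex_norm_square by (simp add: mult.commute)
  ultimately have l1: "(\<lambda>m. (cmod (f m p))\<^sup>2) \<longlonglongrightarrow> (K p)\<^sup>2" by simp
  have "(\<lambda>m. (\<Sum>j\<in>?J. (cmod (L2_inner ?T (f m) (e j)))\<^sup>2) * K q) \<longlonglongrightarrow> (\<Sum>j\<in>?J. (cmod (cnj (e j p)))\<^sup>2) * K q"
    by (intro tendsto_intros lim)
  then have l2: "(\<lambda>m. (\<Sum>j\<in>?J. (cmod (L2_inner ?T (f m) (e j)))\<^sup>2) * K q) \<longlonglongrightarrow> K p * K q" by (simp add: K_def)
  have "(K p)\<^sup>2 \<le> K p * K q"
    by (rule LIMSEQ_le[OF l1 l2]) (use shell_point_bound[OF f(1) \<mu> pq] in \<open>auto simp: K_def\<close>)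
  moreover have "K p \<ge> 0" "K q \<ge> 0" by (auto simp: K_def intro: sum_nonneg)
  ultimately have "K p \<le> K q" by (cases "K p = 0") (auto simp: power2_eq_square)
  then show ?thesis by (simp add: K_def)
qed

text \<open>The hypothesis is symmetric in p and q, so the comparison of eigenspaces runs both ways.
  Indices with equal \<open>lam j\<close> are counted together, so the count is a sum over complete
  eigenspaces.\<close>

lemma local_weyl_count_eq:
  assumes pq: "p \<in> triangle_30_60_90" "q \<in> triangle_30_60_90" "\<And>k. alt_mode k p = alt_mode k q \<or> alt_mode k p = - alt_mode k q"
  shows "local_weyl_count e lam p L = local_weyl_count e lam q L"
proof -
  let ?S = "{j. lam j \<le> L}"
  have qp: "alt_mode k q = alt_mode k p \<or> alt_mode k q = - alt_mode k p" for k using pq(3)[of k] by auto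
  have eq: "(\<Sum>j | lam j = lam i. (cmod (e j p))\<^sup>2) = (\<Sum>j | lam j = lam i. (cmod (e j q))\<^sup>2)" for i
    using eigenspace_density_le[OF lam_pos pq, of i] eigenspace_density_le[OF lam_pos pq(2,1) qp, of i] by (rule antisym)
  have "local_weyl_count e lam x L = (\<Sum>\<mu>\<in>lam ` ?S. \<Sum>j | lam j = \<mu>. (cmod (e j x))\<^sup>2)" for x
  proof -
    have "local_weyl_count e lam x L = (\<Sum>\<mu>\<in>lam ` ?S. \<Sum>j\<in>{j \<in> ?S. lam j = \<mu>}. (cmod (e j x))\<^sup>2)"
      unfolding local_weyl_count_def by (rule sum.image_gen[OF finite_lam_le])
    also have "\<dots> = (\<Sum>\<mu>\<in>lam ` ?S. \<Sum>j | lam j = \<mu>. (cmod (e j x))\<^sup>2)"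
      by (intro sum.cong refl) auto
    finally show ?thesis .
  qed
  moreover have "(\<Sum>\<mu>\<in>lam ` ?S. \<Sum>j | lam j = \<mu>. (cmod (e j p))\<^sup>2) = (\<Sum>\<mu>\<in>lam ` ?S. \<Sum>j | lam j = \<mu>. (cmod (e j q))\<^sup>2)"
    by (rule sum.cong) (use eq in auto)
  ultimately show ?thesis by simp
qed

end

theorem theorem1p3:
  fixes e :: "nat \<Rightarrow> real ^ 2 \<Rightarrow> complex" and lam :: "nat \<Rightarrow> real" and L :: real
  assumes "dirichlet_eigenbasis triangle_30_60_90 e lam"
  shows "local_weyl_count e lam (vector [7 * sqrt 3 / 16, 3 / 16]) L =
         local_weyl_count e lam (vector [5 * sqrt 3 / 16, 3 / 16]) L"
proof (rule local_weyl_count_eq[OF assms])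
  show "vector [7 * sqrt 3 / 16, 3 / 16] \<in> triangle_30_60_90" "vector [5 * sqrt 3 / 16, 3 / 16] \<in> triangle_30_60_90"
    by (simp_all add: mem_triangle)
  have "torus_pos (vector [7 * sqrt 3 / 16, 3 / 16]) = (pi / 4, 3 * pi / 4)" "torus_pos (vector [5 * sqrt 3 / 16, 3 / 16]) = (pi / 4, pi / 2)"
    by (simp_all add: torus_pos_def)
  then show "alt_mode k (vector [7 * sqrt 3 / 16, 3 / 16]) = alt_mode k (vector [5 * sqrt 3 / 16, 3 / 16]) \<or>
    alt_mode k (vector [7 * sqrt 3 / 16, 3 / 16]) = - alt_mode k (vector [5 * sqrt 3 / 16, 3 / 16])" for k
    using alt_cosf_p_q[of k] by (auto simp: alt_mode_def)
qed

end
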